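(* Let $M$ be a compact smooth Riemannian manifold of dimension $m_0$, let $f:M\to M$ be a $C^{1+\gamma}$ expanding map (for some $\gamma>0$) with a repeller $\Lambda$, and assume that $f|\Lambda$ is topologically transitive. Suppose $f$ admits a dominated splitting $T_\Lambda M=E_1\oplus E_2\oplus\cdots\oplus E_k$ with $E_1\succeq E_2\succeq\cdots\succeq E_k$. Then $$\overline{\dim}_B\Lambda\le t^*,$$ where $\overline{\dim}_B$ is the upper box dimension and $t^*\in[0,m_0]$ is the unique root of the equation $\widetilde P_{\mathrm{sub}}(t)=0$, with $\widetilde P_{\mathrm{sub}}(t)=P(f|_\Lambda,\widetilde\Phi_f(t))$ the sub-additive topological pressure of the potential $\widetilde\Phi_f(t)$ associated with the splitting.
   Context: Repellers. Let $f:M\to M$ be a smooth map of a compact smooth Riemannian manifold and let $\Lambda$ be a compact $f$-invariant subset of $M$. $\Lambda$ is called a repeller for $f$, and $f$ expanding, if (1) there is an open neighborhood $U$ of $\Lambda$ such that $\Lambda=\{x\in U: f^n(x)\in U \text{ for all } n\ge 0\}$; (2) there is $\kappa>1$ such that $\|D_xf v\|\ge\kappa\|v\|$ for all $x\in\Lambda$ and $v\in T_xM$, where $\|\cdot\|$ is the norm induced by the Riemannian metric. Dominated splitting. A continuous $Df$-invariant splitting $T_\Lambda M=E_1\oplus\cdots\oplus E_k$ is dominated with $E_1\succeq\cdots\succeq E_k$ if there are numbers $\lambda_1>\lambda_2>\dots>\lambda_k$ and constants $C>0$ and $0<\eta<\min_i(\lambda_i-\lambda_{i+1})/100$ such that for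 every $x\in\Lambda$, $n\in\mathbb N$, $1\le j\le k$ and each unit vector $u\in E_j(x)$, $$C^{-1}e^{n(\lambda_j-\eta)}\le\|D_xf^n(u)\|\le Ce^{n(\lambda_j+\eta)}.$$ Potential. Let $m_i=\dim E_i$, $\ell_0=0$ and $\ell_d=m_k+\cdots+m_{k-d+1}$ for $d=1,\dots,k$. For $t\in[0,m_0]$ and $n\ge1$ define $$\widetilde\varphi^t(x,f^n)=\sum_{j=k-d+1}^{k}m_j\log m(D_xf^n|_{E_j})+(t-\ell_d)\log m(D_xf^n|_{E_{k-d}})$$ if $\ell_d\le t\le\ell_{d+1}$ for some $d\in\{0,1,\dots,k-1\}$, where $m(\cdot)$ denotes the minimum norm of an operator, $m(L)=\min_{\|v\|=1}\|Lv\|$. Set $\widetilde\Phi_f(t)=\{-\widetilde\varphi^t(\cdot,f^n)\}_{n\ge1}$; it is sub-additive, where a sequence of continuous functions $\{\varphi_n\}_{n\ge1}$ is sub-additive for $f$ if $\varphi_{m+n}\le\varphi_n+\varphi_m\circ f^n$ for all $m,n\ge1$. The function $\widetilde P_{\mathrm{sub}}$ is continuous and strictly decreasing. Sub-additive pressure. For a continuous map $f:X\to X$ of a compact metric space $(X,d)$, let $d_n(x,y)=\max_{0\le i<n}d(f^ix,f^iy)$; a set $E\subset X$ is $(n,\varepsilon)$-separated if $d_n(x,y)>\varepsilon$ for any two distinct points $x,y\in E$. For a sub-additive sequence of continuous functions $\Phi=\{\varphi_n\}_{n\ge1}$, $$P(f,\Phi)=\lim_{\varepsilon\to0}\limsup_{n\to\infty}\frac1n\log\sup\Big\{\sum_{x\in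 E}e^{\varphi_n(x)}: E\text{ is an }(n,\varepsilon)\text{-separated subset of }X\Big\}.$$
   Formalization: The existence of a root t* of the pressure equation in [0,m_0] is assumed (its uniqueness is proved), because it can fail: for the map diag(2,3) on the flat 2-torus with k=1 the pressure is log 6 − t log 2, positive on all of [0,2], so t* would be undefined. *)

theory Defs
  imports "HOL-Analysis.Analysis"
begin

text \<open>For \<open>S\<close> open in a finite-dimensional space: all iterated directional derivatives up to
  order \<open>r\<close> exist and are continuous.\<close>

primrec Ck_on :: "nat \<Rightarrow> 'a::real_normed_vector set \<Rightarrow> ('a \<Rightarrow> 'b::real_normed_vector) \<Rightarrow> bool" where
  "Ck_on 0 S F \<longleftrightarrow> continuous_on S F"
| "Ck_on (Suc r) S F \<longleftrightarrow>
     (\<forall>x\<in>S. F differentiable (at x)) \<and> (\<forall>v. Ck_on r S (\<lambda>x. frechet_derivative F (at x) v))"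

definition smooth_on :: "'a::real_normed_vector set \<Rightarrow> ('a \<Rightarrow> 'b::real_normed_vector) \<Rightarrow> bool" where
  "smooth_on S F \<longleftrightarrow> (\<forall>r. Ck_on r S F)"

text \<open>A chart is a pair (domain, coordinate map).\<close>

type_synonym ('m, 'e) chart = "'m set \<times> ('m \<Rightarrow> 'e)"

abbreviation chart_dom :: "('m, 'e) chart \<Rightarrow> 'm set" where
  "chart_dom \<equiv> fst"

abbreviation chart_map :: "('m, 'e) chart \<Rightarrow> 'm \<Rightarrow> 'e" where
  "chart_map \<equiv> snd"

definition chart_inv :: "('m, 'e) chart \<Rightarrow> 'e \<Rightarrow> 'm" where
  "chart_inv c = inv_into (chart_dom c) (chart_map c)"

definition is_chart :: "('m::topological_space, 'e::euclidean_space) chart \<Rightarrow> bool" where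
  "is_chart c \<longleftrightarrow> open (chart_dom c) \<and> open (chart_map c ` chart_dom c) \<and>
     homeomorphism (chart_dom c) (chart_map c ` chart_dom c) (chart_map c) (chart_inv c)"

definition smooth_atlas :: "('m::topological_space, 'e::euclidean_space) chart set \<Rightarrow> bool" where
  "smooth_atlas A \<longleftrightarrow> (\<forall>c\<in>A. is_chart c) \<and> (\<Union>c\<in>A. chart_dom c) = UNIV \<and>
     (\<forall>c\<in>A. \<forall>c'\<in>A. smooth_on (chart_map c ` (chart_dom c \<inter> chart_dom c'))
                              (chart_map c' \<circ> chart_inv c))"

text \<open>Tangent vectors. A tangent vector at \<open>p\<close> is a family of coordinate vectors, one for each
  chart around \<open>p\<close>, related by the derivatives of the coordinate changes; it is determined by
  its value in any one chart. One chart \<open>chart_at A p\<close> is selected for each point \<open>p\<close>, and a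
  tangent vector at \<open>p\<close> is represented by its coordinate vector in that chart, so that every
  tangent space is the vector space \<open>'e\<close>. The selection need not depend continuously on \<open>p\<close>:
  regularity conditions are always imposed after passing to a fixed chart \<open>c\<close> with
  \<open>to_chart\<close> and \<open>of_chart\<close>.\<close>

definition chart_at :: "('m, 'e) chart set \<Rightarrow> 'm \<Rightarrow> ('m, 'e) chart" where
  "chart_at A p = (SOME c. c \<in> A \<and> p \<in> chart_dom c)"

definition coord_change ::
    "('m, 'e::euclidean_space) chart \<Rightarrow> ('m, 'e) chart \<Rightarrow> 'm \<Rightarrow> 'e \<Rightarrow> 'e" where
  "coord_change c c' p = frechet_derivative (chart_map c' \<circ> chart_inv c) (at (chart_map c p))"

definition to_chart ::
    "('m, 'e::euclidean_space) chart set \<Rightarrow> ('m, 'e) chart \<Rightarrow> 'm \<Rightarrow> 'e \<Rightarrow> 'e" where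
  "to_chart A c p = coord_change (chart_at A p) c p"

definition of_chart ::
    "('m, 'e::euclidean_space) chart set \<Rightarrow> ('m, 'e) chart \<Rightarrow> 'm \<Rightarrow> 'e \<Rightarrow> 'e" where
  "of_chart A c p = coord_change c (chart_at A p) p"

text \<open>\<open>D\<^sub>xf : T\<^sub>xM \<rightarrow> T\<^bsub>f x\<^esub>M\<close>, in the selected charts at \<open>x\<close> and \<open>f x\<close>.\<close>

definition tangent_map ::
    "('m, 'e::euclidean_space) chart set \<Rightarrow> ('m \<Rightarrow> 'm) \<Rightarrow> 'm \<Rightarrow> 'e \<Rightarrow> 'e" where
  "tangent_map A f x =
     frechet_derivative (chart_map (chart_at A (f x)) \<circ> f \<circ> chart_inv (chart_at A x))
       (at (chart_map (chart_at A x) x))"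

text \<open>On the compact manifold, local Hoelder continuity of the derivative in charts amounts to
  global Hoelder continuity, so this is the class \<open>C\<^bsup>1+\<gamma>\<^esup>\<close>.\<close>

definition C1_holder_on :: "real \<Rightarrow> 'e::euclidean_space set \<Rightarrow> ('e \<Rightarrow> 'e) \<Rightarrow> bool" where
  "C1_holder_on \<gamma> S F \<longleftrightarrow> (\<forall>x\<in>S. F differentiable (at x)) \<and>
     (\<forall>x\<in>S. \<exists>r>0. \<exists>C. ball x r \<subseteq> S \<and>
        (\<forall>y\<in>ball x r. \<forall>z\<in>ball x r.
           onorm (\<lambda>v. frechet_derivative F (at y) v - frechet_derivative F (at z) v)
             \<le> C * dist y z powr \<gamma>))"

definition C1_holder_map ::
    "('m::topological_space, 'e::euclidean_space) chart set \<Rightarrow> real \<Rightarrow> ('m \<Rightarrow> 'm) \<Rightarrow> bool" where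
  "C1_holder_map A \<gamma> f \<longleftrightarrow> continuous_on UNIV f \<and>
     (\<forall>c\<in>A. \<forall>c'\<in>A. C1_holder_on \<gamma> (chart_map c ` (chart_dom c \<inter> f -` chart_dom c'))
                                  (chart_map c' \<circ> f \<circ> chart_inv c))"

text \<open>\<open>g p u v\<close> is the inner product of \<open>u, v \<in> T\<^sub>pM\<close>; its coefficients in every chart are
  smooth.\<close>

definition riemannian_metric ::
    "('m, 'e::euclidean_space) chart set \<Rightarrow> ('m \<Rightarrow> 'e \<Rightarrow> 'e \<Rightarrow> real) \<Rightarrow> bool" where
  "riemannian_metric A g \<longleftrightarrow>
     (\<forall>p. bilinear (g p) \<and> (\<forall>u v. g p u v = g p v u) \<and> (\<forall>u. u \<noteq> 0 \<longrightarrow> 0 < g p u u)) \<and>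
     (\<forall>c\<in>A. \<forall>u v. smooth_on (chart_map c ` chart_dom c)
        (\<lambda>y. let p = chart_inv c y in g p (of_chart A c p u) (of_chart A c p v)))"

text \<open>The manifold is the whole type \<open>'m\<close> (Hausdorff), of dimension \<open>DIM('e)\<close>; a compact one is
  automatically second countable. It is not required to be connected.\<close>

definition compact_riemannian_manifold ::
    "('m::t2_space, 'e::euclidean_space) chart set \<Rightarrow> ('m \<Rightarrow> 'e \<Rightarrow> 'e \<Rightarrow> real) \<Rightarrow> bool" where
  "compact_riemannian_manifold A g \<longleftrightarrow>
     compact (UNIV :: 'm set) \<and> smooth_atlas A \<and> riemannian_metric A g"

definition tnorm :: "('m \<Rightarrow> 'e \<Rightarrow> 'e \<Rightarrow> real) \<Rightarrow> 'm \<Rightarrow> 'e \<Rightarrow> real" where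
  "tnorm g p v = sqrt (g p v v)"

definition C1_curve_on ::
    "('m::topological_space, 'e::euclidean_space) chart set \<Rightarrow> real \<Rightarrow> real \<Rightarrow> (real \<Rightarrow> 'm) \<Rightarrow> bool"
  where
  "C1_curve_on A a b \<sigma> \<longleftrightarrow> continuous_on {a..b} \<sigma> \<and>
     (\<forall>c\<in>A. let T = {s\<in>{a..b}. \<sigma> s \<in> chart_dom c} in
        \<exists>D. continuous_on T D \<and>
          (\<forall>s\<in>T. ((chart_map c \<circ> \<sigma>) has_vector_derivative D s) (at s within {a..b})))"

definition piecewise_C1_curve ::
    "('m::topological_space, 'e::euclidean_space) chart set \<Rightarrow> (real \<Rightarrow> 'm) \<Rightarrow> bool" where
  "piecewise_C1_curve A \<sigma> \<longleftrightarrow>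
     (\<exists>S. finite S \<and>
        (\<forall>a b. 0 \<le> a \<and> a < b \<and> b \<le> 1 \<and> {a<..<b} \<inter> S = {} \<longrightarrow> C1_curve_on A a b \<sigma>))"

text \<open>The velocity is meaningless at the finitely many break points, which do not contribute to
  the integral.\<close>

definition curve_length ::
    "('m, 'e::euclidean_space) chart set \<Rightarrow> ('m \<Rightarrow> 'e \<Rightarrow> 'e \<Rightarrow> real) \<Rightarrow> (real \<Rightarrow> 'm) \<Rightarrow> ennreal" where
  "curve_length A g \<sigma> =
     (\<integral>\<^sup>+ s \<in> {0..1}. ennreal (tnorm g (\<sigma> s)
        (vector_derivative (chart_map (chart_at A (\<sigma> s)) \<circ> \<sigma>) (at s within {0..1}))) \<partial>lborel)"

text \<open>The value is \<open>\<infinity>\<close> for points in different components of the manifold.\<close>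

definition riem_dist ::
    "('m::topological_space, 'e::euclidean_space) chart set \<Rightarrow> ('m \<Rightarrow> 'e \<Rightarrow> 'e \<Rightarrow> real) \<Rightarrow>
       'm \<Rightarrow> 'm \<Rightarrow> ennreal" where
  "riem_dist A g p q =
     (INF \<sigma> \<in> {\<sigma>. piecewise_C1_curve A \<sigma> \<and> \<sigma> 0 = p \<and> \<sigma> 1 = q}. curve_length A g \<sigma>)"

text \<open>Condition (1) on \<open>U\<close> already entails \<open>f ` \<Lambda> \<subseteq> \<Lambda>\<close>.\<close>

definition repeller ::
    "('m::topological_space, 'e::euclidean_space) chart set \<Rightarrow> ('m \<Rightarrow> 'e \<Rightarrow> 'e \<Rightarrow> real) \<Rightarrow>
       ('m \<Rightarrow> 'm) \<Rightarrow> 'm set \<Rightarrow> bool" where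
  "repeller A g f \<Lambda> \<longleftrightarrow> compact \<Lambda> \<and> f ` \<Lambda> \<subseteq> \<Lambda> \<and>
     (\<exists>U. open U \<and> \<Lambda> \<subseteq> U \<and> \<Lambda> = {x\<in>U. \<forall>n. (f ^^ n) x \<in> U}) \<and>
     (\<exists>\<kappa>>1. \<forall>x\<in>\<Lambda>. \<forall>v. tnorm g (f x) (tangent_map A f x v) \<ge> \<kappa> * tnorm g x v)"

definition topologically_transitive_on ::
    "'m::topological_space set \<Rightarrow> ('m \<Rightarrow> 'm) \<Rightarrow> bool" where
  "topologically_transitive_on \<Lambda> f \<longleftrightarrow>
     (\<forall>V W. openin (top_of_set \<Lambda>) V \<and> V \<noteq> {} \<and> openin (top_of_set \<Lambda>) W \<and> W \<noteq> {} \<longrightarrow>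
        (\<exists>n. (f ^^ n) ` V \<inter> W \<noteq> {}))"

text \<open>\<open>T\<^sub>\<Lambda>M = E 1 \<oplus> \<dots> \<oplus> E k\<close> with \<open>dim (E j x) = m j > 0\<close>; continuity is expressed by local
  continuous frames in charts.\<close>

definition continuous_splitting ::
    "('m::topological_space, 'e::euclidean_space) chart set \<Rightarrow> 'm set \<Rightarrow> nat \<Rightarrow>
       (nat \<Rightarrow> 'm \<Rightarrow> 'e set) \<Rightarrow> (nat \<Rightarrow> nat) \<Rightarrow> bool" where
  "continuous_splitting A \<Lambda> k E m \<longleftrightarrow> 1 \<le> k \<and> (\<forall>j\<in>{1..k}. 0 < m j) \<and>
     (\<forall>x\<in>\<Lambda>. (\<forall>j\<in>{1..k}. subspace (E j x) \<and> dim (E j x) = m j) \<and>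
        (\<forall>v. \<exists>!w. w \<in> (\<Pi>\<^sub>E j\<in>{1..k}. E j x) \<and> v = (\<Sum>j=1..k. w j))) \<and>
     (\<forall>j\<in>{1..k}. \<forall>x\<in>\<Lambda>. \<exists>c\<in>A. \<exists>V. \<exists>e :: nat \<Rightarrow> 'm \<Rightarrow> 'e.
        open V \<and> x \<in> V \<and> V \<subseteq> chart_dom c \<and>
        (\<forall>i<m j. continuous_on (\<Lambda> \<inter> V) (e i)) \<and>
        (\<forall>y\<in>\<Lambda> \<inter> V. to_chart A c y ` E j y = span ((\<lambda>i. e i y) ` {..<m j})))"

definition dominated_splitting ::
    "('m::topological_space, 'e::euclidean_space) chart set \<Rightarrow> ('m \<Rightarrow> 'e \<Rightarrow> 'e \<Rightarrow> real) \<Rightarrow>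
       ('m \<Rightarrow> 'm) \<Rightarrow> 'm set \<Rightarrow> nat \<Rightarrow> (nat \<Rightarrow> 'm \<Rightarrow> 'e set) \<Rightarrow> (nat \<Rightarrow> nat) \<Rightarrow> bool" where
  "dominated_splitting A g f \<Lambda> k E m \<longleftrightarrow> continuous_splitting A \<Lambda> k E m \<and>
     (\<forall>x\<in>\<Lambda>. \<forall>j\<in>{1..k}. tangent_map A f x ` E j x = E j (f x)) \<and>
     (\<exists>lam :: nat \<Rightarrow> real. \<exists>C>0. \<exists>\<eta>>0.
        (\<forall>i\<in>{1..<k}. lam i > lam (Suc i) \<and> \<eta> < (lam i - lam (Suc i)) / 100) \<and>
        (\<forall>x\<in>\<Lambda>. \<forall>n. \<forall>j\<in>{1..k}. \<forall>u\<in>E j x. tnorm g x u = 1 \<longrightarrow>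
           inverse C * exp (real n * (lam j - \<eta>))
             \<le> tnorm g ((f ^^ n) x) (tangent_map A (f ^^ n) x u) \<and>
           tnorm g ((f ^^ n) x) (tangent_map A (f ^^ n) x u)
             \<le> C * exp (real n * (lam j + \<eta>))))"

text \<open>The minimum norm of \<open>D\<^sub>xf : T\<^sub>xM \<rightarrow> T\<^bsub>f x\<^esub>M\<close> restricted to the subspace \<open>F\<close>.\<close>

definition min_norm_on ::
    "('m, 'e::euclidean_space) chart set \<Rightarrow> ('m \<Rightarrow> 'e \<Rightarrow> 'e \<Rightarrow> real) \<Rightarrow> ('m \<Rightarrow> 'm) \<Rightarrow> 'm \<Rightarrow>
       'e set \<Rightarrow> real" where
  "min_norm_on A g f x F = (INF v \<in> {v\<in>F. tnorm g x v = 1}. tnorm g (f x) (tangent_map A f x v))"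

definition ell :: "nat \<Rightarrow> (nat \<Rightarrow> nat) \<Rightarrow> nat \<Rightarrow> nat" where
  "ell k m d = (\<Sum>j = k - d + 1..k. m j)"

text \<open>If \<open>t = \<ell>\<^sub>d\<close> with \<open>0 < d < k\<close>, two indices are admissible; both give the same value.\<close>

definition phi_tilde ::
    "('m, 'e::euclidean_space) chart set \<Rightarrow> ('m \<Rightarrow> 'e \<Rightarrow> 'e \<Rightarrow> real) \<Rightarrow> ('m \<Rightarrow> 'm) \<Rightarrow> nat \<Rightarrow>
       (nat \<Rightarrow> 'm \<Rightarrow> 'e set) \<Rightarrow> (nat \<Rightarrow> nat) \<Rightarrow> real \<Rightarrow> nat \<Rightarrow> 'm \<Rightarrow> real" where
  "phi_tilde A g f k E m t n x =
     (let d = (LEAST d. d < k \<and> real (ell k m d) \<le> t \<and> t \<le> real (ell k m (d + 1))) in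
        (\<Sum>j = k - d + 1..k. real (m j) * ln (min_norm_on A g (f ^^ n) x (E j x)))
        + (t - real (ell k m d)) * ln (min_norm_on A g (f ^^ n) x (E (k - d) x)))"

definition log_ennreal :: "ennreal \<Rightarrow> ereal" where
  "log_ennreal a = (if a = 0 then -\<infinity> else if a = \<infinity> then \<infinity> else ereal (ln (enn2real a)))"

definition bowen_dist :: "('m \<Rightarrow> 'm \<Rightarrow> ennreal) \<Rightarrow> ('m \<Rightarrow> 'm) \<Rightarrow> nat \<Rightarrow> 'm \<Rightarrow> 'm \<Rightarrow> ennreal" where
  "bowen_dist d f n x y = (SUP i\<in>{..<n}. d ((f ^^ i) x) ((f ^^ i) y))"

definition separated ::
    "('m \<Rightarrow> 'm \<Rightarrow> ennreal) \<Rightarrow> ('m \<Rightarrow> 'm) \<Rightarrow> nat \<Rightarrow> real \<Rightarrow> 'm set \<Rightarrow> bool" where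
  "separated d f n \<epsilon> E \<longleftrightarrow> (\<forall>x\<in>E. \<forall>y\<in>E. x \<noteq> y \<longrightarrow> ennreal \<epsilon> < bowen_dist d f n x y)"

text \<open>Pressure of \<open>f\<close> on the compact invariant set \<open>X\<close> (with the metric \<open>d\<close>). Separated subsets
  of \<open>X\<close> are finite anyway; the explicit finiteness only guards against \<open>sum\<close> being \<open>0\<close> on
  infinite sets.\<close>

definition pressure ::
    "('m \<Rightarrow> 'm \<Rightarrow> ennreal) \<Rightarrow> 'm set \<Rightarrow> ('m \<Rightarrow> 'm) \<Rightarrow> (nat \<Rightarrow> 'm \<Rightarrow> real) \<Rightarrow> ereal" where
  "pressure d X f \<Phi> =
     Lim (at_right 0) (\<lambda>\<epsilon>::real. limsup (\<lambda>n. ereal (1 / real n) *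
       log_ennreal (SUP E \<in> {E. finite E \<and> E \<subseteq> X \<and> separated d f n \<epsilon> E}.
                      ennreal (\<Sum>x\<in>E. exp (\<Phi> n x)))))"

definition P_sub_tilde ::
    "('m::topological_space, 'e::euclidean_space) chart set \<Rightarrow> ('m \<Rightarrow> 'e \<Rightarrow> 'e \<Rightarrow> real) \<Rightarrow>
       ('m \<Rightarrow> 'm) \<Rightarrow> 'm set \<Rightarrow> nat \<Rightarrow> (nat \<Rightarrow> 'm \<Rightarrow> 'e set) \<Rightarrow> (nat \<Rightarrow> nat) \<Rightarrow> real \<Rightarrow> ereal" where
  "P_sub_tilde A g f \<Lambda> k E m t =
     pressure (riem_dist A g) \<Lambda> f (\<lambda>n x. - phi_tilde A g f k E m t n x)"

text \<open>The least number of \<open>\<epsilon>\<close>-balls that cover \<open>X\<close> (for totally bounded \<open>X\<close>).\<close>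

definition covering_number :: "('m \<Rightarrow> 'm \<Rightarrow> ennreal) \<Rightarrow> 'm set \<Rightarrow> real \<Rightarrow> nat" where
  "covering_number d X \<epsilon> =
     (LEAST N. \<exists>C. finite C \<and> card C = N \<and> X \<subseteq> (\<Union>p\<in>C. {q. d p q < ennreal \<epsilon>}))"

definition upper_box_dim :: "('m \<Rightarrow> 'm \<Rightarrow> ennreal) \<Rightarrow> 'm set \<Rightarrow> ereal" where
  "upper_box_dim d X =
     Limsup (at_right 0) (\<lambda>\<epsilon>::real. ereal (ln (real (covering_number d X \<epsilon>)) / ln (1 / \<epsilon>)))"

end

theory Submission
  imports Defs
begin

text \<open>The box-counting estimate iterates one linear step. Fix \<open>N\<close>. On a set of sufficiently small
  diameter an inverse branch of \<open>f\<^sup>N\<close> is nearly linear, so the preimage of a set of diameter \<open>\<rho>\<close>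
  lies in a parallelepiped with \<open>m j\<close> sides of length about \<open>\<rho> / M j\<close>, where \<open>M j\<close> is the minimum
  norm of \<open>Df\<^sup>N\<close> on \<open>E j\<close>; it is covered by a constant (independent of \<open>N\<close>) times
  \<open>\<Prod>j>i. (M i / M j) ^ m j\<close> sets of diameter \<open>\<rho> / M i\<close>, and for \<open>i = k - d\<close> this product is
  \<open>M i powr t * exp (- phi_tilde t)\<close>. Choosing the points of a separated set greedily, in decreasing
  order of \<open>exp (- phi_tilde t)\<close>, partitions \<open>\<Lambda>\<close> into Bowen-small pieces whose suprema are bounded
  by the partition sum of the pressure. Coding orbits of \<open>f\<^sup>N\<close> by these pieces and stopping each
  itinerary when the product of the \<open>M i\<close> reaches \<open>1 / \<epsilon>\<close> yields covers by sets of diameter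
  \<open>\<epsilon>\<close>; for \<open>s > t\<close> and large \<open>N\<close> the total number is a geometric series times \<open>\<epsilon> powr (- s)\<close>.
  No distortion bound along whole orbits is needed, because \<open>N\<close> is fixed before the scale.\<close>

section \<open>Strict differentiability\<close>

text \<open>One step for \<open>f ^^ N\<close> costs a covering constant \<open>C\<close> and the
  factor 2 of the greedy choice, neither of which depends on \<open>N\<close>. Every
  \<open>M i\<close> is at least \<open>\<kappa> ^ N\<close>, so passing from the exponent
  \<open>t\<close> to \<open>s\<close> gains at least the factor
  \<open>exp (N * (s - t) * ln \<kappa>)\<close>. Half of this exponent pays for the growth that
  vanishing pressure still allows in the partition sum, the other half beats the constants; the
  weights of all pieces then sum to at most 1/2.

  Weights on a piece are compared with its centre only: a greedy centre has at least half of the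
  weight of every point attached to it. Hence any point of a cell can serve as its base point, and
  the stopping time is read off at that point alone.

  Inverse branches are never constructed. A compact set \<open>K\<close> of pairs on which
  \<open>f\<close> identifies no two distinct points replaces them: orbits that stay
  \<open>K\<close>-related for \<open>N\<close> steps and end close together have started close
  together.

  The chart net, its norm constants and the bound for components in the splitting are fixed before
  \<open>N\<close>; \<open>C\<close> is built from them and the dimensions
  \<open>m j\<close>.\<close>

definition strict_deriv ::
    "('a::real_normed_vector \<Rightarrow> 'b::real_normed_vector) \<Rightarrow> ('a \<Rightarrow> 'b) \<Rightarrow> 'a \<Rightarrow> bool" where
  "strict_deriv G D a \<longleftrightarrow> bounded_linear D \<and>
     (\<forall>\<tau>>0. \<exists>r>0. \<forall>y\<in>ball a r. \<forall>z\<in>ball a r. norm (G y - G z - D (y - z)) \<le> \<tau> * norm (y - z))"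

lemma strict_deriv_has_derivative:
  assumes "strict_deriv G D a"
  shows "(G has_derivative D) (at a)"
  unfolding has_derivative_at_alt
proof (intro conjI allI impI)
  show "bounded_linear D" using assms by (simp add: strict_deriv_def)
  fix e :: real assume "0 < e"
  then obtain r where r: "r > 0" "\<And>y z. y \<in> ball a r \<Longrightarrow> z \<in> ball a r \<Longrightarrow>
      norm (G y - G z - D (y - z)) \<le> e * norm (y - z)"
    using assms unfolding strict_deriv_def by meson
  show "\<exists>d>0. \<forall>y. norm (y - a) < d \<longrightarrow> norm (G y - G a - D (y - a)) \<le> e * norm (y - a)"
    using r by (auto intro!: exI[of _ r] simp: dist_norm norm_minus_commute)
qed

lemma strict_deriv_frechet:
  assumes "strict_deriv G D a"
  shows "frechet_derivative G (at a) = D"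
  using frechet_derivative_at[OF strict_deriv_has_derivative[OF assms]] by simp

lemma strict_deriv_cong:
  assumes "strict_deriv G D a" "open S" "a \<in> S" "\<And>y. y \<in> S \<Longrightarrow> H y = G y"
  shows "strict_deriv H D a"
  unfolding strict_deriv_def
proof (intro conjI allI impI)
  show "bounded_linear D" using assms by (simp add: strict_deriv_def)
  fix \<tau> :: real assume "\<tau> > 0"
  then obtain r where r: "r > 0" "\<And>y z. y \<in> ball a r \<Longrightarrow> z \<in> ball a r \<Longrightarrow>
      norm (G y - G z - D (y - z)) \<le> \<tau> * norm (y - z)"
    using assms unfolding strict_deriv_def by meson
  obtain r' where r': "r' > 0" "ball a r' \<subseteq> S" using assms openE by blast
  show "\<exists>r>0. \<forall>y\<in>ball a r. \<forall>z\<in>ball a r. norm (H y - H z - D (y - z)) \<le> \<tau> * norm (y - z)"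
  proof (intro exI[of _ "min r r'"] conjI ballI)
    fix y z assume "y \<in> ball a (min r r')" "z \<in> ball a (min r r')"
    then have "y \<in> ball a r" "z \<in> ball a r" "y \<in> S" "z \<in> S" using r' by auto
    then show "norm (H y - H z - D (y - z)) \<le> \<tau> * norm (y - z)" using r(2) assms(4) by simp
  qed (use r r' in auto)
qed

lemma strict_deriv_compose:
  assumes G: "strict_deriv G D a" and H: "strict_deriv H L (G a)"
  shows "strict_deriv (H \<circ> G) (L \<circ> D) a"
  unfolding strict_deriv_def
proof (intro conjI allI impI)
  have bl: "bounded_linear D" "bounded_linear L" using G H by (auto simp: strict_deriv_def)
  show "bounded_linear (L \<circ> D)" using bounded_linear_compose[OF bl(2) bl(1)] by (simp add: o_def)
  obtain KD where KD: "KD > 0" "\<And>x. norm (D x) \<le> norm x * KD"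
    using bounded_linear.pos_bounded[OF bl(1)] by metis
  obtain KL where KL: "KL > 0" "\<And>x. norm (L x) \<le> norm x * KL"
    using bounded_linear.pos_bounded[OF bl(2)] by metis
  fix \<tau> :: real assume \<tau>: "\<tau> > 0"
  \<comment> \<open>The two errors add up to \<open>e2 * (KD + 1) + e1 * KL\<close>, and each
    summand is made at most \<open>\<tau>/2\<close>. The cap 1 on \<open>e1\<close> makes
    \<open>G\<close> Lipschitz with constant \<open>KD + 1\<close> near \<open>a\<close>.\<close>
  define e1 where "e1 = min 1 (\<tau> / (2 * KL))"
  define e2 where "e2 = \<tau> / (2 * (KD + 1))"
  have e: "e1 > 0" "e2 > 0" using \<tau> KD KL by (auto simp: e1_def e2_def)
  obtain r1 where r1: "r1 > 0" "\<And>y z. y \<in> ball a r1 \<Longrightarrow> z \<in> ball a r1 \<Longrightarrow>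
      norm (G y - G z - D (y - z)) \<le> e1 * norm (y - z)"
    using G e(1) unfolding strict_deriv_def by meson
  obtain r2 where r2: "r2 > 0" "\<And>y z. y \<in> ball (G a) r2 \<Longrightarrow> z \<in> ball (G a) r2 \<Longrightarrow>
      norm (H y - H z - L (y - z)) \<le> e2 * norm (y - z)"
    using H e(2) unfolding strict_deriv_def by meson
  have lip: "norm (G y - G z) \<le> (KD + 1) * norm (y - z)"
    if "y \<in> ball a r1" "z \<in> ball a r1" for y z
  proof -
    have "norm (G y - G z) \<le> norm (G y - G z - D (y - z)) + norm (D (y - z))"
      by (metis diff_add_cancel norm_triangle_ineq)
    also have "\<dots> \<le> 1 * norm (y - z) + norm (y - z) * KD"
      using r1(2)[OF that] KD(2)[of "y - z"] mult_right_mono[of e1 1 "norm (y - z)"]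
      unfolding e1_def by auto
    finally show ?thesis by (simp add: algebra_simps)
  qed
  define r where "r = min r1 (r2 / (KD + 1))"
  have r: "r > 0" using r1 r2 KD by (auto simp: r_def)
  have inb: "G y \<in> ball (G a) r2" if "y \<in> ball a r" for y
  proof -
    have "norm (G a - G y) \<le> (KD + 1) * norm (a - y)"
      using that r1(1) by (intro lip) (auto simp: r_def)
    also have "\<dots> < (KD + 1) * (r2 / (KD + 1))"
      using that KD by (intro mult_strict_left_mono) (auto simp: r_def dist_norm)
    also have "\<dots> = r2" using KD by simp
    finally show ?thesis by (simp add: dist_norm)
  qed
  show "\<exists>r>0. \<forall>y\<in>ball a r. \<forall>z\<in>ball a r.
      norm ((H \<circ> G) y - (H \<circ> G) z - (L \<circ> D) (y - z)) \<le> \<tau> * norm (y - z)"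
  proof (intro exI[of _ r] conjI r ballI)
    fix y z assume yz: "y \<in> ball a r" "z \<in> ball a r"
    then have yz1: "y \<in> ball a r1" "z \<in> ball a r1" by (auto simp: r_def)
    have "(H \<circ> G) y - (H \<circ> G) z - (L \<circ> D) (y - z) =
        (H (G y) - H (G z) - L (G y - G z)) + L (G y - G z - D (y - z))"
      using bl(2) by (simp add: bounded_linear.linear linear_diff)
    then have "norm ((H \<circ> G) y - (H \<circ> G) z - (L \<circ> D) (y - z)) \<le>
        norm (H (G y) - H (G z) - L (G y - G z)) + norm (L (G y - G z - D (y - z)))"
      by (metis norm_triangle_ineq)
    also have "\<dots> \<le> e2 * norm (G y - G z) + norm (G y - G z - D (y - z)) * KL"
      using r2(2)[OF inb[OF yz(1)] inb[OF yz(2)]] KL(2) by (intro add_mono) auto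
    also have "\<dots> \<le> e2 * ((KD + 1) * norm (y - z)) + (e1 * norm (y - z)) * KL"
      using lip[OF yz1] r1(2)[OF yz1] e KL by (intro add_mono mult_left_mono mult_right_mono) auto
    also have "\<dots> \<le> \<tau>/2 * norm (y - z) + \<tau>/2 * norm (y - z)"
    proof (intro add_mono)
      have "e2 * (KD + 1) = \<tau>/2" using KD(1) by (simp add: e2_def divide_simps)
      then show "e2 * ((KD + 1) * norm (y - z)) \<le> \<tau>/2 * norm (y - z)"
        by (metis mult.assoc order_refl)
      have "e1 * KL \<le> \<tau> / (2 * KL) * KL" using KL by (intro mult_right_mono) (auto simp: e1_def)
      also have "\<dots> = \<tau>/2" using KL by simp
      finally have "e1 * KL * norm (y - z) \<le> \<tau>/2 * norm (y - z)" by (intro mult_right_mono) auto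
      then show "e1 * norm (y - z) * KL \<le> \<tau>/2 * norm (y - z)" by (simp add: mult_ac)
    qed
    finally show "norm ((H \<circ> G) y - (H \<circ> G) z - (L \<circ> D) (y - z)) \<le> \<tau> * norm (y - z)" by simp
  qed
qed

text \<open>On a short increment in the direction \<open>w\<close> the two-point estimate and the
  derivative at \<open>x\<close> describe the same difference of \<open>G\<close>, so the two linear
  maps differ by at most \<open>\<tau>\<close>. Strict differentiability at one point thus bounds
  the oscillation of the derivative on a whole ball.\<close>

lemma strict_deriv_near:
  assumes est: "\<And>y z. y \<in> ball a r \<Longrightarrow> z \<in> ball a r \<Longrightarrow>
      norm (G y - G z - D (y - z)) \<le> \<tau> * norm (y - z)"
    and D: "bounded_linear D" and x: "x \<in> ball a r" and D': "(G has_derivative D') (at x)"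
    and "0 \<le> \<tau>"
  shows "norm (D' w - D w) \<le> \<tau> * norm w"
proof (cases "w = 0")
  case True
  then show ?thesis using D D' has_derivative_bounded_linear
    by (metis bounded_linear.linear diff_self linear_0 mult_zero_right norm_zero order_refl)
next
  case False
  have "0 < norm w" using False by simp
  have lin': "linear D'" using D' has_derivative_bounded_linear bounded_linear.linear by blast
  have lin: "linear D" using D bounded_linear.linear by blast
  have "norm (D' w - D w) \<le> (\<tau> + e) * norm w" if "e > 0" for e
  proof -
    have "\<exists>d>0. \<forall>y. norm (y - x) < d \<longrightarrow> norm (G y - G x - D' (y - x)) \<le> e * norm (y - x)"
      using D' that unfolding has_derivative_at_alt by blast
    then obtain d where d: "d > 0" "\<forall>y. norm (y - x) < d \<longrightarrow>
        norm (G y - G x - D' (y - x)) \<le> e * norm (y - x)" by blast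
    \<comment> \<open>The increment has half the length of the room left, inside both the ball
      around \<open>a\<close> and the range \<open>d\<close> of the derivative at
      \<open>x\<close>.\<close>
    define h where "h = min d (r - dist a x) / (2 * norm w)"
    have h: "h > 0" using d x False by (auto simp: h_def)
    have hn: "norm (h *\<^sub>R w) = min d (r - dist a x) / 2"
      using d x False by (simp add: h_def)
    have hn1: "norm (h *\<^sub>R w) < d" "dist a x + norm (h *\<^sub>R w) < r"
      unfolding hn using d x by (auto simp: min_def field_simps)
    have inb: "x + h *\<^sub>R w \<in> ball a r"
      using hn1(2) norm_triangle_ineq4[of "a - x" "h *\<^sub>R w"] by (simp add: dist_norm algebra_simps)
    have "h *\<^sub>R (D' w - D w) =
       (G (x + h *\<^sub>R w) - G x - D (x + h *\<^sub>R w - x)) - (G (x + h *\<^sub>R w) - G x - D' (x + h *\<^sub>R w - x))"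
      by (simp add: linear_scale[OF lin] linear_scale[OF lin'] scaleR_diff_right)
    then have "norm (h *\<^sub>R (D' w - D w)) \<le>
       norm (G (x + h *\<^sub>R w) - G x - D (x + h *\<^sub>R w - x)) + norm (G (x + h *\<^sub>R w) - G x - D' (x + h *\<^sub>R w - x))"
      by (metis norm_triangle_ineq4)
    also have "\<dots> \<le> \<tau> * norm (h *\<^sub>R w) + e * norm (h *\<^sub>R w)"
      using est[OF inb x] d(2)[rule_format, of "x + h *\<^sub>R w"] hn1(1) by (intro add_mono) simp_all
    finally have "h * norm (D' w - D w) \<le> h * ((\<tau> + e) * norm w)"
      using h by (simp add: distrib_left distrib_right mult.left_commute)
    then show ?thesis using h by simp
  qed
  note A = this
  have "norm (D' w - D w) / norm w \<le> \<tau>"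
  proof (rule field_le_epsilon)
    fix e :: real assume "0 < e"
    from A[OF this] show "norm (D' w - D w) / norm w \<le> \<tau> + e"
      using \<open>0 < norm w\<close> by (simp add: pos_divide_le_eq)
  qed
  then show ?thesis using \<open>0 < norm w\<close> by (simp add: pos_divide_le_eq)
qed

text \<open>The mean value inequality for \<open>G\<close> minus its derivative at \<open>a\<close>,
  whose own derivative is small on a ball. Coordinate changes and the map \<open>f\<close> both get
  their strict derivatives in this way.\<close>

lemma strict_deriv_of_continuous_deriv:
  fixes G :: "'a::real_normed_vector \<Rightarrow> 'b::real_normed_vector"
  assumes S: "open S" "a \<in> S" and diff: "\<And>x. x \<in> S \<Longrightarrow> G differentiable (at x)"
    and cont: "\<And>\<tau>. \<tau> > 0 \<Longrightarrow> \<exists>r>0. \<forall>y\<in>ball a r \<inter> S.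
       onorm (\<lambda>v. frechet_derivative G (at y) v - frechet_derivative G (at a) v) \<le> \<tau>"
  shows "strict_deriv G (frechet_derivative G (at a)) a"
  unfolding strict_deriv_def
proof (intro conjI allI impI)
  have hd: "(G has_derivative frechet_derivative G (at x)) (at x)" if "x \<in> S" for x
    using diff[OF that] frechet_derivative_works by blast
  show bl: "bounded_linear (frechet_derivative G (at a))"
    using hd S(2) has_derivative_bounded_linear by blast
  fix \<tau> :: real assume "\<tau> > 0"
  from cont[OF this] obtain r1 where r1: "r1 > 0" "\<And>y. y \<in> ball a r1 \<inter> S \<Longrightarrow>
      onorm (\<lambda>v. frechet_derivative G (at y) v - frechet_derivative G (at a) v) \<le> \<tau>" by meson
  obtain r2 where r2: "r2 > 0" "ball a r2 \<subseteq> S" using S openE by blast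
  define r where "r = min r1 r2"
  show "\<exists>r>0. \<forall>y\<in>ball a r. \<forall>z\<in>ball a r.
     norm (G y - G z - frechet_derivative G (at a) (y - z)) \<le> \<tau> * norm (y - z)"
  proof (intro exI[of _ r] conjI ballI)
    show "r > 0" using r1 r2 by (simp add: r_def)
    fix y z assume yz: "y \<in> ball a r" "z \<in> ball a r"
    have "norm ((\<lambda>u. G u - frechet_derivative G (at a) u) y - (\<lambda>u. G u - frechet_derivative G (at a) u) z)
       \<le> \<tau> * norm (y - z)"
    proof (rule differentiable_bound[where S = "ball a r" and
         f' = "\<lambda>x v. frechet_derivative G (at x) v - frechet_derivative G (at a) v"])
      fix x assume "x \<in> ball a r"
      then have xS: "x \<in> S" "x \<in> ball a r1 \<inter> S" using r2 by (auto simp: r_def)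
      show "((\<lambda>u. G u - frechet_derivative G (at a) u) has_derivative
         (\<lambda>v. frechet_derivative G (at x) v - frechet_derivative G (at a) v)) (at x within ball a r)"
        using has_derivative_diff[OF hd[OF xS(1)] bounded_linear_imp_has_derivative[OF bl]]
          has_derivative_at_withinI by blast
      show "onorm (\<lambda>v. frechet_derivative G (at x) v - frechet_derivative G (at a) v) \<le> \<tau>"
        using r1(2)[OF xS(2)] .
    qed (use yz in auto)
    then show "norm (G y - G z - frechet_derivative G (at a) (y - z)) \<le> \<tau> * norm (y - z)"
      by (simp add: bounded_linear.linear[OF bl] linear_diff algebra_simps)
  qed
qed

text \<open>\<open>Ck_on\<close> controls the derivative one direction at a time. The sum over the
  finite basis turns this into continuity in the operator norm.\<close>

lemma strict_deriv_smooth_on: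
  fixes G :: "'a::euclidean_space \<Rightarrow> 'b::real_normed_vector"
  assumes S: "open S" "a \<in> S" and sm: "smooth_on S G"
  shows "strict_deriv G (frechet_derivative G (at a)) a"
proof (rule strict_deriv_of_continuous_deriv[OF S])
  have 1: "Ck_on (Suc 0) S G" using sm by (simp only: smooth_on_def)
  show d: "G differentiable (at x)" if "x \<in> S" for x using 1 that by simp
  have c: "continuous_on S (\<lambda>x. frechet_derivative G (at x) v)" for v using 1 by simp
  have bl: "bounded_linear (frechet_derivative G (at x))" if "x \<in> S" for x
    using d[OF that] frechet_derivative_works has_derivative_bounded_linear by blast
  fix \<tau> :: real assume \<tau>: "\<tau> > 0"
  have "continuous_on S (\<lambda>x. \<Sum>i\<in>Basis. norm (frechet_derivative G (at x) i - frechet_derivative G (at a) i))"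
    by (intro continuous_intros c)
  then obtain r where r: "r > 0" "\<And>y. y \<in> S \<Longrightarrow> dist y a < r \<Longrightarrow>
     dist (\<Sum>i\<in>Basis. norm (frechet_derivative G (at y) i - frechet_derivative G (at a) i))
       (\<Sum>i\<in>Basis. norm (frechet_derivative G (at a) i - frechet_derivative G (at a) i)) < \<tau>"
    using S(2) \<tau> unfolding continuous_on_iff by meson
  show "\<exists>r>0. \<forall>y\<in>ball a r \<inter> S.
     onorm (\<lambda>v. frechet_derivative G (at y) v - frechet_derivative G (at a) v) \<le> \<tau>"
  proof (intro exI[of _ r] conjI r(1) ballI)
    fix y assume y: "y \<in> ball a r \<inter> S"
    have "onorm (\<lambda>v. frechet_derivative G (at y) v - frechet_derivative G (at a) v) \<le>
      (\<Sum>i\<in>Basis. norm (frechet_derivative G (at y) i - frechet_derivative G (at a) i))"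
      using y by (intro onorm_componentwise bounded_linear_sub bl S(2)) auto
    also have "\<dots> \<le> \<tau>" using r(2)[of y] y by (auto simp: dist_norm norm_minus_commute)
    finally show "onorm (\<lambda>v. frechet_derivative G (at y) v - frechet_derivative G (at a) v) \<le> \<tau>" .
  qed
qed

lemma strict_deriv_C1_holder:
  fixes G :: "'a::euclidean_space \<Rightarrow> 'a"
  assumes S: "open S" "a \<in> S" and sm: "C1_holder_on \<gamma> S G" and "\<gamma> > 0"
  shows "strict_deriv G (frechet_derivative G (at a)) a"
proof (rule strict_deriv_of_continuous_deriv[OF S])
  show "G differentiable (at x)" if "x \<in> S" for x using sm that by (simp add: C1_holder_on_def)
  fix \<tau> :: real assume \<tau>: "\<tau> > 0"
  obtain r C where r: "r > 0" and C: "\<And>y z. y \<in> ball a r \<Longrightarrow> z \<in> ball a r \<Longrightarrow>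
     onorm (\<lambda>v. frechet_derivative G (at y) v - frechet_derivative G (at z) v)
             \<le> C * dist y z powr \<gamma>"
    using sm S(2) unfolding C1_holder_on_def by meson
  \<comment> \<open>The second radius solves
    \<open>(\<bar>C\<bar> + 1) * r' powr \<gamma> = \<tau>\<close>; here
    \<open>\<bar>C\<bar> + 1\<close> is positive whatever the sign of the Hoelder constant
    \<open>C\<close>.\<close>
  define r' where "r' = min r ((\<tau> / (\<bar>C\<bar> + 1)) powr (1 / \<gamma>))"
  show "\<exists>r>0. \<forall>y\<in>ball a r \<inter> S.
     onorm (\<lambda>v. frechet_derivative G (at y) v - frechet_derivative G (at a) v) \<le> \<tau>"
  proof (intro exI[of _ r'] conjI ballI)
    show "r' > 0" using r \<tau> by (simp add: r'_def)
    fix y assume y: "y \<in> ball a r' \<inter> S"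
    have "onorm (\<lambda>v. frechet_derivative G (at y) v - frechet_derivative G (at a) v)
        \<le> C * dist y a powr \<gamma>" using y r by (intro C) (auto simp: r'_def)
    also have "\<dots> \<le> (\<bar>C\<bar> + 1) * dist y a powr \<gamma>" by (intro mult_right_mono) auto
    also have "\<dots> \<le> (\<bar>C\<bar> + 1) * ((\<tau> / (\<bar>C\<bar> + 1)) powr (1 / \<gamma>)) powr \<gamma>"
      using y \<open>\<gamma> > 0\<close> by (intro mult_left_mono powr_mono2) (auto simp: r'_def dist_commute)
    also have "\<dots> = \<tau>" using \<open>\<gamma> > 0\<close> \<tau> by (simp add: powr_powr)
    finally show "onorm (\<lambda>v. frechet_derivative G (at y) v - frechet_derivative G (at a) v) \<le> \<tau>" .
  qed
qed

section \<open>Charts, tangent maps and norms\<close>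

definition chart_rep :: "('m \<Rightarrow> 'm) \<Rightarrow> ('m, 'e) chart \<Rightarrow> ('m, 'e) chart \<Rightarrow> 'e \<Rightarrow> 'e" where
  "chart_rep F c c' = chart_map c' \<circ> F \<circ> chart_inv c"

text \<open>With \<open>id\<close> for \<open>F\<close> this is a coordinate change, and in the
  selected charts it is the tangent map, so that one chain rule serves both.\<close>

definition chart_deriv ::
    "('m \<Rightarrow> 'm) \<Rightarrow> ('m, 'e::euclidean_space) chart \<Rightarrow> ('m, 'e) chart \<Rightarrow> 'm \<Rightarrow> 'e \<Rightarrow> 'e" where
  "chart_deriv F c c' p = frechet_derivative (chart_rep F c c') (at (chart_map c p))"

text \<open>All pairs of charts are required, since the displacement between nearby points has to be
  read in one fixed chart while the selected charts may jump.\<close>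

definition strict_diff_at ::
    "('m, 'e::euclidean_space) chart set \<Rightarrow> ('m \<Rightarrow> 'm) \<Rightarrow> 'm \<Rightarrow> bool" where
  "strict_diff_at A F p \<longleftrightarrow> (\<forall>c\<in>A. \<forall>c'\<in>A. p \<in> chart_dom c \<longrightarrow> F p \<in> chart_dom c' \<longrightarrow>
     strict_deriv (chart_rep F c c') (chart_deriv F c c' p) (chart_map c p))"

locale compact_riem_mfd =
  fixes A :: "('m::t2_space, 'e::euclidean_space) chart set"
    and g :: "'m \<Rightarrow> 'e \<Rightarrow> 'e \<Rightarrow> real"
  assumes crm: "compact_riemannian_manifold A g"
begin

lemma atlas: "smooth_atlas A" and compact_M: "compact (UNIV :: 'm set)"
  and metric: "riemannian_metric A g"
  using crm by (auto simp: compact_riemannian_manifold_def)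

lemma chart_at: "chart_at A p \<in> A" "p \<in> chart_dom (chart_at A p)"
proof -
  have "\<exists>c. c \<in> A \<and> p \<in> chart_dom c" using atlas unfolding smooth_atlas_def by blast
  from someI_ex[OF this] show "chart_at A p \<in> A" "p \<in> chart_dom (chart_at A p)"
    unfolding chart_at_def by auto
qed

context
  fixes c assumes c: "c \<in> A"
begin

lemma is_chart: "is_chart c" using atlas c by (auto simp: smooth_atlas_def)

lemma chart_dom_open: "open (chart_dom c)" and chart_img_open: "open (chart_map c ` chart_dom c)"
  and chart_map_cont: "continuous_on (chart_dom c) (chart_map c)"
  and chart_inv_cont: "continuous_on (chart_map c ` chart_dom c) (chart_inv c)"
  and chart_inv_map: "p \<in> chart_dom c \<Longrightarrow> chart_inv c (chart_map c p) = p"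
  and chart_map_inv: "y \<in> chart_map c ` chart_dom c \<Longrightarrow> chart_map c (chart_inv c y) = y"
  using is_chart by (auto simp: is_chart_def homeomorphism_def)

lemma chart_inv_in: "y \<in> chart_map c ` chart_dom c \<Longrightarrow> chart_inv c y \<in> chart_dom c"
  using chart_inv_map by auto

lemma open_chart_image: "open W \<Longrightarrow> open (chart_map c ` (chart_dom c \<inter> W))"
proof -
  assume W: "open W"
  have eq: "chart_map c ` (chart_dom c \<inter> W) = chart_inv c -` W \<inter> chart_map c ` chart_dom c"
    using chart_inv_map by force
  show ?thesis unfolding eq
    using chart_inv_cont chart_img_open W continuous_on_open_vimage by blast
qed

lemma open_chart_preimage: "open B \<Longrightarrow> open {p \<in> chart_dom c. chart_map c p \<in> B}"
proof -
  assume B: "open B"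
  have eq: "{p \<in> chart_dom c. chart_map c p \<in> B} = chart_map c -` B \<inter> chart_dom c" by auto
  show ?thesis unfolding eq
    using continuous_on_open_vimage[OF chart_dom_open] chart_map_cont B by blast
qed

lemma chart_map_inj: "p \<in> chart_dom c \<Longrightarrow> q \<in> chart_dom c \<Longrightarrow> chart_map c p = chart_map c q \<Longrightarrow> p = q"
  using chart_inv_map by metis

end

lemma coord_change_eq: "coord_change c c' p = chart_deriv id c c' p"
  by (simp add: coord_change_def chart_deriv_def chart_rep_def)

lemma tangent_map_eq: "tangent_map A F p = chart_deriv F (chart_at A p) (chart_at A (F p)) p"
  by (simp add: tangent_map_def chart_deriv_def chart_rep_def)

lemma strict_diff_at_id: "strict_diff_at A id p"
  unfolding strict_diff_at_def
proof (intro ballI impI)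
  fix c c' assume cc: "c \<in> A" "c' \<in> A" "p \<in> chart_dom c" "id p \<in> chart_dom c'"
  have "smooth_on (chart_map c ` (chart_dom c \<inter> chart_dom c')) (chart_rep id c c')"
    using atlas cc by (simp add: smooth_atlas_def chart_rep_def)
  then show "strict_deriv (chart_rep id c c') (chart_deriv id c c' p) (chart_map c p)"
    unfolding chart_deriv_def using cc
    by (intro strict_deriv_smooth_on[OF open_chart_image[OF cc(1) chart_dom_open[OF cc(2)]]]) auto
qed

lemma strict_diff_at_C1_holder:
  assumes "C1_holder_map A \<gamma> f" "0 < \<gamma>"
  shows "strict_diff_at A f p"
  unfolding strict_diff_at_def
proof (intro ballI impI)
  fix c c' assume cc: "c \<in> A" "c' \<in> A" "p \<in> chart_dom c" "f p \<in> chart_dom c'"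
  have "C1_holder_on \<gamma> (chart_map c ` (chart_dom c \<inter> f -` chart_dom c')) (chart_rep f c c')"
    using assms cc by (simp add: C1_holder_map_def chart_rep_def)
  moreover have "open (f -` chart_dom c')"
    using assms(1) chart_dom_open[OF cc(2)] by (auto simp: C1_holder_map_def intro: open_vimage)
  ultimately show "strict_deriv (chart_rep f c c') (chart_deriv f c c' p) (chart_map c p)"
    unfolding chart_deriv_def using cc assms(2)
    by (intro strict_deriv_C1_holder[OF open_chart_image[OF cc(1)]]) auto
qed

lemma strict_deriv_chain:
  assumes F: "continuous_on UNIV F" "strict_diff_at A F p" and H: "strict_diff_at A H (F p)"
    and c: "c \<in> A" "p \<in> chart_dom c" and c': "c' \<in> A" "F p \<in> chart_dom c'"
    and c'': "c'' \<in> A" "H (F p) \<in> chart_dom c''"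
  shows "strict_deriv (chart_rep (H \<circ> F) c c'')
           (chart_deriv H c' c'' (F p) \<circ> chart_deriv F c c' p) (chart_map c p)"
proof (rule strict_deriv_cong)
  have "chart_map c' (F p) = chart_rep F c c' (chart_map c p)"
    using c by (simp add: chart_rep_def chart_inv_map)
  then show "strict_deriv (chart_rep H c' c'' \<circ> chart_rep F c c')
     (chart_deriv H c' c'' (F p) \<circ> chart_deriv F c c' p) (chart_map c p)"
    using F H c c' c'' unfolding strict_diff_at_def
    by (intro strict_deriv_compose) auto
  show "open (chart_map c ` (chart_dom c \<inter> F -` chart_dom c'))"
    using F(1) c(1) chart_dom_open[OF c'(1)] by (intro open_chart_image open_vimage)
  show "chart_map c p \<in> chart_map c ` (chart_dom c \<inter> F -` chart_dom c')"
    using c c' by auto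
  fix y assume "y \<in> chart_map c ` (chart_dom c \<inter> F -` chart_dom c')"
  then show "chart_rep (H \<circ> F) c c'' y = (chart_rep H c' c'' \<circ> chart_rep F c c') y"
    using c c' by (auto simp: chart_rep_def chart_inv_map)
qed

lemma chart_deriv_chain:
  assumes F: "continuous_on UNIV F" "strict_diff_at A F p" and H: "strict_diff_at A H (F p)"
    and c: "c \<in> A" "p \<in> chart_dom c" and c': "c' \<in> A" "F p \<in> chart_dom c'"
    and c'': "c'' \<in> A" "H (F p) \<in> chart_dom c''"
  shows "chart_deriv (H \<circ> F) c c'' p = chart_deriv H c' c'' (F p) \<circ> chart_deriv F c c' p"
  using strict_deriv_frechet[OF strict_deriv_chain[OF assms]] by (simp add: chart_deriv_def)

lemma strict_diff_at_compose:
  assumes F: "continuous_on UNIV F" "strict_diff_at A F p" and H: "strict_diff_at A H (F p)"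
  shows "strict_diff_at A (H \<circ> F) p"
  unfolding strict_diff_at_def
proof (intro ballI impI)
  fix c c' assume "c \<in> A" "c' \<in> A" "p \<in> chart_dom c" "(H \<circ> F) p \<in> chart_dom c'"
  then show "strict_deriv (chart_rep (H \<circ> F) c c') (chart_deriv (H \<circ> F) c c' p) (chart_map c p)"
    using strict_deriv_chain[OF assms _ _ chart_at(1) chart_at(2), of c c']
      chart_deriv_chain[OF assms _ _ chart_at(1) chart_at(2), of c c'] by simp
qed

lemma chart_deriv_id:
  assumes c: "c \<in> A" "p \<in> chart_dom c"
  shows "chart_deriv id c c p = id"
proof -
  have "strict_deriv (chart_rep id c c) id (chart_map c p)"
  proof (rule strict_deriv_cong)
    show "strict_deriv (\<lambda>y. y) id (chart_map c p)"
      by (auto simp: strict_deriv_def id_def intro: exI[of _ 1])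
    show "open (chart_map c ` chart_dom c)" using chart_img_open[OF c(1)] .
    show "chart_map c p \<in> chart_map c ` chart_dom c" using c by auto
    show "chart_rep id c c y = y" if "y \<in> chart_map c ` chart_dom c" for y
      using that c by (auto simp: chart_rep_def chart_map_inv)
  qed
  then show ?thesis unfolding chart_deriv_def by (rule strict_deriv_frechet)
qed

text \<open>By the chain rule for \<open>id \<circ> id\<close>, the coordinate changes between two
  charts are inverse to each other.\<close>

lemma of_to_chart:
  assumes c: "c \<in> A" "p \<in> chart_dom c"
  shows "of_chart A c p (to_chart A c p w) = w" "to_chart A c p (of_chart A c p w) = w"
proof -
  have *: "chart_deriv id c2 c1 p (chart_deriv id c1 c2 p w) = w"
    if "c1 \<in> A" "p \<in> chart_dom c1" "c2 \<in> A" "p \<in> chart_dom c2" for c1 c2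
  proof -
    have "chart_deriv (id \<circ> id) c1 c1 p = chart_deriv id c2 c1 (id p) \<circ> chart_deriv id c1 c2 p"
      by (rule chart_deriv_chain) (use that strict_diff_at_id in \<open>auto simp: continuous_on_id\<close>)
    then show ?thesis using chart_deriv_id[OF that(1,2)] by (simp add: fun_eq_iff)
  qed
  show "of_chart A c p (to_chart A c p w) = w" "to_chart A c p (of_chart A c p w) = w"
    using *[OF chart_at c] *[OF c chart_at] by (simp_all add: of_chart_def to_chart_def coord_change_eq)
qed

lemma chart_deriv_linear:
  assumes "strict_diff_at A F p" "c \<in> A" "p \<in> chart_dom c" "c' \<in> A" "F p \<in> chart_dom c'"
  shows "bounded_linear (chart_deriv F c c' p)"
  using assms unfolding strict_diff_at_def strict_deriv_def by blast

lemma of_chart_linear: "c \<in> A \<Longrightarrow> p \<in> chart_dom c \<Longrightarrow> linear (of_chart A c p)"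
  and to_chart_linear: "c \<in> A \<Longrightarrow> p \<in> chart_dom c \<Longrightarrow> linear (to_chart A c p)"
  unfolding of_chart_def to_chart_def coord_change_eq
  by (intro bounded_linear.linear chart_deriv_linear strict_diff_at_id; simp add: chart_at)+

lemma tangent_map_linear: "strict_diff_at A F p \<Longrightarrow> linear (tangent_map A F p)"
  unfolding tangent_map_eq by (intro bounded_linear.linear chart_deriv_linear chart_at)

text \<open>The chain rule for \<open>F \<circ> id\<close> and \<open>id \<circ> F\<close> inserts
  the selected charts at \<open>p\<close> and \<open>F p\<close>. This is the passage between
  estimates in a fixed chart and \<open>tnorm\<close>, which refers to the selected charts.\<close>

lemma chart_deriv_eq:
  assumes F: "continuous_on UNIV F" "strict_diff_at A F p"
    and c: "c \<in> A" "p \<in> chart_dom c" and c': "c' \<in> A" "F p \<in> chart_dom c'"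
  shows "chart_deriv F c c' p w = to_chart A c' (F p) (tangent_map A F p (of_chart A c p w))"
proof -
  let ?a = "chart_at A p" and ?b = "chart_at A (F p)"
  have 1: "chart_deriv (F \<circ> id) c ?b p = chart_deriv F ?a ?b (id p) \<circ> chart_deriv id c ?a p"
    by (rule chart_deriv_chain) (use F c chart_at strict_diff_at_id in \<open>auto simp: continuous_on_id\<close>)
  have 2: "chart_deriv (id \<circ> F) c c' p = chart_deriv id ?b c' (F p) \<circ> chart_deriv F c ?b p"
    by (rule chart_deriv_chain) (use F c c' chart_at strict_diff_at_id in auto)
  show ?thesis using 1 2
    by (simp add: to_chart_def of_chart_def coord_change_eq tangent_map_eq)
qed

lemma tangent_map_comp:
  assumes "continuous_on UNIV F" "strict_diff_at A F p" "strict_diff_at A H (F p)"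
  shows "tangent_map A (H \<circ> F) p = tangent_map A H (F p) \<circ> tangent_map A F p"
  unfolding tangent_map_eq using chart_deriv_chain[OF assms chart_at chart_at, of "chart_at A (H (F p))"] chart_at
  by simp

section \<open>Riemannian norms and their comparison with coordinate norms\<close>

lemma metric_bilinear: "bilinear (g p)" and metric_sym: "g p u v = g p v u"
  and metric_pos: "u \<noteq> 0 \<Longrightarrow> 0 < g p u u"
  using metric unfolding riemannian_metric_def by blast+

lemma metric_nonneg: "0 \<le> g p u u"
  using metric_pos[of u p] bilinear_lzero[OF metric_bilinear, of p 0] by (cases "u = 0") auto

lemma tnorm_nonneg: "0 \<le> tnorm g p u" by (simp add: tnorm_def metric_nonneg)

lemma tnorm_pos: "u \<noteq> 0 \<Longrightarrow> 0 < tnorm g p u" by (simp add: tnorm_def metric_pos)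

lemma tnorm_zero: "tnorm g p 0 = 0"
  using bilinear_lzero[OF metric_bilinear] by (simp add: tnorm_def)

lemma tnorm_scale: "tnorm g p (a *\<^sub>R u) = \<bar>a\<bar> * tnorm g p u"
  by (simp add: tnorm_def bilinear_lmul[OF metric_bilinear] bilinear_rmul[OF metric_bilinear]
      real_sqrt_mult mult.assoc[symmetric])

lemma metric_add: "g p (u + v) (u + v) = g p u u + 2 * g p u v + g p v v"
  using metric_sym[of p v u]
  by (simp add: bilinear_ladd[OF metric_bilinear] bilinear_radd[OF metric_bilinear])

lemma tnorm_triangle: "tnorm g p (u + v) \<le> tnorm g p u + tnorm g p v"
proof -
  have cs: "g p u v \<le> tnorm g p u * tnorm g p v"
  proof (cases "u = 0 \<or> v = 0")
    case True
    then show ?thesis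
      using bilinear_lzero[OF metric_bilinear] bilinear_rzero[OF metric_bilinear] by (auto simp: tnorm_zero)
  next
    case False
    let ?a = "tnorm g p u" and ?b = "tnorm g p v"
    have ab: "?a > 0" "?b > 0" using False tnorm_pos by auto
    have sq: "g p u u = ?a\<^sup>2" "g p v v = ?b\<^sup>2" by (simp_all add: tnorm_def metric_nonneg)
    \<comment> \<open>Cauchy-Schwarz from the positivity of the metric on the combination of
      \<open>u\<close> and \<open>v\<close> in which both terms have the same norm.\<close>
    have "0 \<le> g p (?b *\<^sub>R u + (- ?a) *\<^sub>R v) (?b *\<^sub>R u + (- ?a) *\<^sub>R v)" by (rule metric_nonneg)
    also have "\<dots> = ?b\<^sup>2 * g p u u - 2 * ?a * ?b * g p u v + ?a\<^sup>2 * g p v v"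
      unfolding metric_add
      by (simp only: bilinear_lmul[OF metric_bilinear] bilinear_rmul[OF metric_bilinear])
         (simp add: power2_eq_square algebra_simps)
    also have "\<dots> = 2 * (?a * ?b) * (?a * ?b - g p u v)"
      unfolding sq by (simp add: power2_eq_square algebra_simps)
    finally show ?thesis using mult_pos_pos[OF ab] by (auto simp: zero_le_mult_iff)
  qed
  have sq: "(tnorm g p w)\<^sup>2 = g p w w" for w by (simp add: tnorm_def metric_nonneg)
  have "(tnorm g p (u + v))\<^sup>2 = (tnorm g p u)\<^sup>2 + 2 * g p u v + (tnorm g p v)\<^sup>2"
    unfolding sq by (rule metric_add)
  also have "\<dots> \<le> (tnorm g p u + tnorm g p v)\<^sup>2" using cs by (simp add: power2_sum)
  finally show ?thesis using tnorm_nonneg by (simp add: power2_le_iff_abs_le)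
qed

lemma tnorm_minus: "tnorm g p (- u) = tnorm g p u" using tnorm_scale[of p "-1" u] by simp

lemma tnorm_sum: "tnorm g p (\<Sum>i\<in>I. u i) \<le> (\<Sum>i\<in>I. tnorm g p (u i))"
proof (induction I rule: infinite_finite_induct)
  case (insert x F)
  then show ?case using tnorm_triangle[of p "u x" "\<Sum>i\<in>F. u i"] by simp
qed (auto simp: tnorm_zero)

text \<open>In coordinates the norm is a positive continuous function on the compact set
  \<open>K \<times> sphere 0 1\<close>; its minimum and maximum are the constants, and homogeneity
  extends the bounds to all vectors.\<close>

lemma chart_norm_bounds:
  assumes c: "c \<in> A" and K: "compact K" "K \<subseteq> chart_map c ` chart_dom c"
  shows "\<exists>c1>0. \<exists>c2>0. \<forall>p\<in>chart_dom c. chart_map c p \<in> K \<longrightarrow>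
     (\<forall>w. c1 * norm w \<le> tnorm g p (of_chart A c p w) \<and> tnorm g p (of_chart A c p w) \<le> c2 * norm w)"
proof (cases "K = {}")
  case True
  then show ?thesis by (auto intro: exI[of _ 1])
next
  case False
  define G where "G a b y = g (chart_inv c y) (of_chart A c (chart_inv c y) a) (of_chart A c (chart_inv c y) b)"
    for a b y
  have Gc: "continuous_on K (G a b)" for a b
  proof -
    have "smooth_on (chart_map c ` chart_dom c) (G a b)"
      using metric c unfolding riemannian_metric_def Let_def G_def by blast
    then have "Ck_on 0 (chart_map c ` chart_dom c) (G a b)" unfolding smooth_on_def by blast
    then show ?thesis using K(2) by (auto intro: continuous_on_subset)
  qed
  \<comment> \<open>Continuity of the metric is given for fixed coordinate vectors. The expansion
    over the basis makes it joint in the point and the vector.\<close>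
  have expand: "G w w y = (\<Sum>a\<in>Basis. \<Sum>b\<in>Basis. (w \<bullet> a) * (w \<bullet> b) * G a b y)" if "y \<in> K" for w y
  proof -
    let ?p = "chart_inv c y"
    have p: "?p \<in> chart_dom c" using that K(2) chart_inv_in[OF c] by auto
    have bil: "bilinear (\<lambda>u v. g ?p (of_chart A c ?p u) (of_chart A c ?p v))"
      using metric_bilinear[of ?p] of_chart_linear[OF c p] unfolding bilinear_def
      by (auto intro: linear_compose[unfolded o_def])
    have "G w w y = G (\<Sum>a\<in>Basis. (w \<bullet> a) *\<^sub>R a) (\<Sum>b\<in>Basis. (w \<bullet> b) *\<^sub>R b) y"
      by (simp add: euclidean_representation)
    also have "\<dots> = (\<Sum>(a,b)\<in>Basis \<times> Basis. G ((w \<bullet> a) *\<^sub>R a) ((w \<bullet> b) *\<^sub>R b) y)"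
      unfolding G_def by (rule bilinear_sum[OF bil])
    also have "\<dots> = (\<Sum>a\<in>Basis. \<Sum>b\<in>Basis. (w \<bullet> a) * (w \<bullet> b) * G a b y)"
      unfolding sum.cartesian_product[symmetric] G_def
      by (simp only: bilinear_lmul[OF bil] bilinear_rmul[OF bil]) (simp add: mult_ac)
    finally show ?thesis .
  qed
  define h where "h = (\<lambda>(y, w). sqrt (\<Sum>a\<in>Basis. \<Sum>b\<in>Basis. (w \<bullet> a) * (w \<bullet> b) * G a b y))"
  have hc: "continuous_on (K \<times> sphere 0 1) h"
    unfolding h_def case_prod_beta
    by (intro continuous_intros continuous_on_compose2[OF Gc, of _ fst]) auto
  have heq: "h (chart_map c p, w) = tnorm g p (of_chart A c p w)"
    if "p \<in> chart_dom c" "chart_map c p \<in> K" for p w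
    using expand[OF that(2), of w] by (simp add: h_def tnorm_def G_def chart_inv_map[OF c that(1)])
  have cK: "compact (K \<times> sphere (0::'e) 1)" using K(1) by (intro compact_Times) auto
  have ne: "K \<times> sphere (0::'e) 1 \<noteq> {}" using False by simp
  obtain m where m: "m \<in> K \<times> sphere 0 1" "\<And>z. z \<in> K \<times> sphere 0 1 \<Longrightarrow> h m \<le> h z"
    using continuous_attains_inf[OF cK ne hc] by blast
  obtain M where M: "M \<in> K \<times> sphere 0 1" "\<And>z. z \<in> K \<times> sphere 0 1 \<Longrightarrow> h z \<le> h M"
    using continuous_attains_sup[OF cK ne hc] by blast
  have hpos: "h z > 0" if z: "z \<in> K \<times> sphere 0 1" for z
  proof -
    obtain y w where yw: "z = (y, w)" "y \<in> K" "norm w = 1" using z by auto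
    obtain p where p: "p \<in> chart_dom c" "y = chart_map c p" using yw K(2) by auto
    have "of_chart A c p w \<noteq> 0"
    proof
      assume "of_chart A c p w = 0"
      then have "w = to_chart A c p 0" using of_to_chart[OF c p(1)] by metis
      then show False using yw(3) linear_0[OF to_chart_linear[OF c p(1)]] by simp
    qed
    then show ?thesis using heq[of p w] p yw tnorm_pos by simp
  qed
  show ?thesis
  proof (rule exI[of _ "h m"], rule conjI[OF hpos[OF m(1)]], rule exI[of _ "h M"],
      rule conjI[OF hpos[OF M(1)]], intro ballI impI allI)
    fix p w assume p: "p \<in> chart_dom c" "chart_map c p \<in> K"
    show "h m * norm w \<le> tnorm g p (of_chart A c p w) \<and> tnorm g p (of_chart A c p w) \<le> h M * norm w"
    proof (cases "w = 0")
      case True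
      then show ?thesis using linear_0[OF of_chart_linear[OF c p(1)]] by (simp add: tnorm_zero)
    next
      case False
      define u where "u = w /\<^sub>R norm w"
      have u: "norm u = 1" "w = norm w *\<^sub>R u" using False by (auto simp: u_def)
      have "tnorm g p (of_chart A c p w) = norm w * h (chart_map c p, u)"
        by (subst u(2)) (simp add: linear_scale[OF of_chart_linear[OF c p(1)]] tnorm_scale heq[OF p])
      moreover have "h m \<le> h (chart_map c p, u)" "h (chart_map c p, u) \<le> h M"
        using m(2) M(2) p(2) u(1) by auto
      ultimately show ?thesis by (simp add: mult.commute mult_right_mono mult_left_mono)
    qed
  qed
qed

end

section \<open>The Riemannian distance\<close>

definition chart_ball :: "('m, 'e::euclidean_space) chart \<Rightarrow> 'e \<Rightarrow> real \<Rightarrow> 'm set" where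
  "chart_ball c a r = {p \<in> chart_dom c. chart_map c p \<in> ball a r}"

context compact_riem_mfd
begin

lemma open_chart_ball: "c \<in> A \<Longrightarrow> open (chart_ball c a r)"
  unfolding chart_ball_def by (rule open_chart_preimage) auto

text \<open>The competitor is the straight segment in the chart: convexity of \<open>K\<close> keeps
  it where the norm bound holds, so its speed is at most \<open>C\<close> times the length of the
  segment.\<close>

lemma riem_dist_le_chart:
  assumes c: "c \<in> A" and K: "convex K" "K \<subseteq> chart_map c ` chart_dom c"
    and pq: "p \<in> chart_dom c" "q \<in> chart_dom c" "chart_map c p \<in> K" "chart_map c q \<in> K"
    and bound: "\<And>x w. x \<in> chart_dom c \<Longrightarrow> chart_map c x \<in> K \<Longrightarrow>
       tnorm g x (of_chart A c x w) \<le> C * norm w"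
  shows "riem_dist A g p q \<le> ennreal (C * norm (chart_map c q - chart_map c p))"
proof -
  define w where "w = chart_map c q - chart_map c p"
  define y where "y s = chart_map c p + s *\<^sub>R w" for s :: real
  define \<sigma> where "\<sigma> s = chart_inv c (y s)" for s
  have yK: "y s \<in> K" if "s \<in> {0..1}" for s
  proof -
    have "y s = (1 - s) *\<^sub>R chart_map c p + s *\<^sub>R chart_map c q"
      by (simp add: y_def w_def algebra_simps)
    then show ?thesis using convexD_alt[OF K(1) pq(3,4), of s] that by auto
  qed
  have \<sigma>: "\<sigma> s \<in> chart_dom c" "chart_map c (\<sigma> s) = y s" if "s \<in> {0..1}" for s
    using yK[OF that] K(2) by (auto simp: \<sigma>_def chart_inv_in[OF c] chart_map_inv[OF c])
  define D where "D c' s = frechet_derivative (chart_rep id c c') (at (y s)) w" for c' s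
  have yd: "(y has_vector_derivative w) (at s)" for s
    unfolding y_def by (auto intro!: derivative_eq_intros)
  have yc: "continuous_on S y" for S unfolding y_def by (intro continuous_intros)
  \<comment> \<open>Admissible curves and their length refer to all charts met, so the velocity is
    carried through every coordinate change.\<close>
  have vd: "((chart_map c' \<circ> \<sigma>) has_vector_derivative D c' s) (at s)"
    if c': "c' \<in> A" "\<sigma> s \<in> chart_dom c'" and s: "s \<in> {0..1}" for c' s
  proof -
    have eq: "chart_map c' \<circ> \<sigma> = chart_rep id c c' \<circ> y"
      by (auto simp: chart_rep_def \<sigma>_def)
    have "strict_deriv (chart_rep id c c') (chart_deriv id c c' (\<sigma> s)) (y s)"
      using strict_diff_at_id[of "\<sigma> s"] c c' \<sigma>[OF s] unfolding strict_diff_at_def by auto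
    then have "(chart_rep id c c' has_derivative frechet_derivative (chart_rep id c c') (at (y s))) (at (y s))"
      using strict_deriv_has_derivative strict_deriv_frechet by metis
    from vector_derivative_diff_chain_within[OF yd has_derivative_at_withinI[OF this]]
    show ?thesis unfolding eq D_def by simp
  qed
  have Dc: "continuous_on {s \<in> {a..b}. \<sigma> s \<in> chart_dom c'} (D c')"
    if c': "c' \<in> A" and ab: "0 \<le> a" "b \<le> 1" for c' a b
  proof -
    have "smooth_on (chart_map c ` (chart_dom c \<inter> chart_dom c')) (chart_rep id c c')"
      using atlas c c' by (simp add: smooth_atlas_def chart_rep_def)
    then have "Ck_on (Suc 0) (chart_map c ` (chart_dom c \<inter> chart_dom c')) (chart_rep id c c')"
      unfolding smooth_on_def by blast
    then have *: "continuous_on (chart_map c ` (chart_dom c \<inter> chart_dom c'))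
        (\<lambda>x. frechet_derivative (chart_rep id c c') (at x) w)" by simp
    show ?thesis unfolding D_def
    proof (rule continuous_on_compose2[OF * yc], safe)
      fix s assume "s \<in> {a..b}" "\<sigma> s \<in> chart_dom c'"
      then show "y s \<in> chart_map c ` (chart_dom c \<inter> chart_dom c')"
        using \<sigma>[of s] ab by (auto simp: image_iff intro!: bexI[of _ "\<sigma> s"])
    qed
  qed
  have \<sigma>c: "continuous_on {0..1} \<sigma>" unfolding \<sigma>_def
    by (rule continuous_on_compose2[OF chart_inv_cont[OF c] yc]) (use yK K in blast)
  have "piecewise_C1_curve A \<sigma>"
    unfolding piecewise_C1_curve_def
  proof (intro exI[of _ "{}"] conjI allI impI)
    fix a b :: real assume "0 \<le> a \<and> a < b \<and> b \<le> 1 \<and> {a<..<b} \<inter> {} = {}"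
    then have ab: "0 \<le> a" "b \<le> 1" by auto
    show "C1_curve_on A a b \<sigma>" unfolding C1_curve_on_def Let_def
    proof (intro conjI ballI)
      show "continuous_on {a..b} \<sigma>" using ab by (intro continuous_on_subset[OF \<sigma>c]) auto
      fix c' assume c': "c' \<in> A"
      show "\<exists>D. continuous_on {s \<in> {a..b}. \<sigma> s \<in> chart_dom c'} D \<and>
          (\<forall>s\<in>{s \<in> {a..b}. \<sigma> s \<in> chart_dom c'}.
             (chart_map c' \<circ> \<sigma> has_vector_derivative D s) (at s within {a..b}))"
        using Dc[OF c' ab] vd[OF c'] ab
        by (intro exI[of _ "D c'"]) (auto intro: has_vector_derivative_at_within)
    qed
  qed simp
  moreover have "\<sigma> 0 = p" "\<sigma> 1 = q"
    using pq chart_inv_map[OF c] by (auto simp: \<sigma>_def y_def w_def)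
  ultimately have "riem_dist A g p q \<le> curve_length A g \<sigma>"
    unfolding riem_dist_def by (intro INF_lower) auto
  also have "\<dots> \<le> (\<integral>\<^sup>+ s \<in> {0..1::real}. ennreal (C * norm w) \<partial>lborel)"
    unfolding curve_length_def
  proof (rule nn_integral_mono)
    fix s :: real
    show "ennreal (tnorm g (\<sigma> s) (vector_derivative (chart_map (chart_at A (\<sigma> s)) \<circ> \<sigma>) (at s within {0..1})))
       * indicator {0..1} s \<le> ennreal (C * norm w) * indicator {0..1} s"
    proof (cases "s \<in> {0..1}")
      case True
      let ?b = "chart_at A (\<sigma> s)"
      have "vector_derivative (chart_map ?b \<circ> \<sigma>) (at s within {0..1}) = D ?b s"
        using True by (intro vector_derivative_at_within_ivl vd chart_at) auto
      also have "\<dots> = of_chart A c (\<sigma> s) w"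
        using \<sigma>[OF True] by (simp add: D_def of_chart_def coord_change_eq chart_deriv_def)
      finally show ?thesis using bound[of "\<sigma> s" w] \<sigma>[OF True] yK[OF True] True
        by (auto intro: ennreal_leI)
    qed auto
  qed
  also have "\<dots> = ennreal (C * norm w)"
    by (subst nn_integral_cmult_indicator) auto
  finally show ?thesis unfolding w_def .
qed

text \<open>Every time, a break point or not, is an endpoint of closed intervals on either side
  whose interiors avoid \<open>S\<close>. The pieces therefore give continuity from the left and
  from the right; at 0 and 1 one side is degenerate.\<close>

lemma piecewise_C1_continuous:
  assumes "piecewise_C1_curve A \<sigma>"
  shows "continuous_on {0..1} \<sigma>"
proof -
  obtain S where S: "finite S"
    "\<And>a b. 0 \<le> a \<Longrightarrow> a < b \<Longrightarrow> b \<le> 1 \<Longrightarrow> {a<..<b} \<inter> S = {} \<Longrightarrow> C1_curve_on A a b \<sigma>"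
    using assms unfolding piecewise_C1_curve_def by blast
  have "continuous (at s within {0..1}) \<sigma>" if s: "s \<in> {0..1}" for s
  proof -
    obtain e where e: "e > 0" "\<forall>x\<in>S. x \<noteq> s \<longrightarrow> e \<le> dist s x"
      using finite_set_avoid[OF S(1)] by blast
    have L: "continuous (at s within {0..s}) \<sigma>"
    proof (cases "s = 0")
      case False
      define a where "a = max 0 (s - e)"
      have "C1_curve_on A a s \<sigma>"
        using s e False by (intro S(2)) (force simp: a_def dist_real_def)+
      then have "continuous (at s within {a..s}) \<sigma>"
        using s e by (auto simp: C1_curve_on_def a_def continuous_on_eq_continuous_within)
      moreover have "at s within {a..s} = at s within {0..s}"
        by (rule at_within_nhd[of s "{a<..}"]) (use s e False in \<open>auto simp: a_def\<close>)
      ultimately show ?thesis by simp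
    next
      case True
      then have "at s within {0..s} = bot" by (simp add: at_within_eq_bot_iff)
      then show ?thesis by (simp add: continuous_within)
    qed
    have R: "continuous (at s within {s..1}) \<sigma>"
    proof (cases "s = 1")
      case False
      define b where "b = min 1 (s + e)"
      have "C1_curve_on A s b \<sigma>"
        using s e False by (intro S(2)) (force simp: b_def dist_real_def)+
      then have "continuous (at s within {s..b}) \<sigma>"
        using s e by (auto simp: C1_curve_on_def b_def continuous_on_eq_continuous_within)
      moreover have "at s within {s..b} = at s within {s..1}"
        by (rule at_within_nhd[of s "{..<b}"]) (use s e False in \<open>auto simp: b_def\<close>)
      ultimately show ?thesis by simp
    next
      case True
      then have "at s within {s..1} = bot" by (simp add: at_within_eq_bot_iff)
      then show ?thesis by (simp add: continuous_within)
    qed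
    have "{0..1} = {0..s} \<union> {s..1}" using s by auto
    then show ?thesis using L R unfolding continuous_within
      by (simp add: Lim_within_Un)
  qed
  then show ?thesis by (simp add: continuous_on_eq_continuous_within)
qed

text \<open>The fundamental theorem of calculus: the displacement in the chart is the integral of
  the coordinate velocity, and the speed is at least \<open>C\<close> times the norm of this
  velocity.\<close>

lemma curve_length_ge_chart:
  assumes c: "c \<in> A" and C: "0 \<le> C"
    and bound: "\<And>x w. x \<in> V \<Longrightarrow> C * norm w \<le> tnorm g x (of_chart A c x w)"
    and \<sigma>: "piecewise_C1_curve A \<sigma>" and s': "0 < s'" "s' \<le> 1"
    and V: "V \<subseteq> chart_dom c" "\<And>s. s \<in> {0..s'} \<Longrightarrow> \<sigma> s \<in> V"
  shows "ennreal (C * norm (chart_map c (\<sigma> s') - chart_map c (\<sigma> 0))) \<le> curve_length A g \<sigma>"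
proof -
  obtain S where S: "finite S"
    "\<And>a b. 0 \<le> a \<Longrightarrow> a < b \<Longrightarrow> b \<le> 1 \<Longrightarrow> {a<..<b} \<inter> S = {} \<Longrightarrow> C1_curve_on A a b \<sigma>"
    using \<sigma> unfolding piecewise_C1_curve_def by blast
  define h where "h = chart_map c \<circ> \<sigma>"
  define h' where "h' s = vector_derivative h (at s)" for s
  define N where "N = {0<..<s'} - S"
  have oN: "open N" unfolding N_def using S(1) by (intro open_Diff finite_imp_closed) auto
  have loc: "\<exists>e>0. {s - e<..<s + e} \<subseteq> N \<and> continuous_on {s - e<..<s + e} h' \<and>
      (h has_vector_derivative h' s) (at s)" if s: "s \<in> N" for s
  proof -
    obtain e0 where e0: "e0 > 0" "cball s e0 \<subseteq> N" using oN s open_contains_cball by blast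
    have sub: "{s - e0..s + e0} \<subseteq> N" using e0(2) by (simp add: cball_eq_atLeastAtMost)
    then have lim: "s - e0 \<in> N" "s + e0 \<in> N" using e0(1) by auto
    have "{s - e0<..<s + e0} \<inter> S = {}"
    proof -
      have "x \<notin> S" if "x \<in> {s - e0<..<s + e0}" for x
      proof -
        have "x \<in> {s - e0..s + e0}" using that by auto
        then show ?thesis using sub by (auto simp: N_def)
      qed
      then show ?thesis by blast
    qed
    moreover have "0 \<le> s - e0" "s - e0 < s + e0" "s + e0 \<le> 1"
      using lim e0(1) s' by (auto simp: N_def)
    ultimately have "C1_curve_on A (s - e0) (s + e0) \<sigma>" by (intro S(2))
    moreover have T: "{u \<in> {s - e0..s + e0}. \<sigma> u \<in> chart_dom c} = {s - e0..s + e0}"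
      using sub V unfolding N_def by fastforce
    ultimately obtain D where D: "continuous_on {s - e0..s + e0} D"
      "\<And>u. u \<in> {s - e0..s + e0} \<Longrightarrow> (h has_vector_derivative D u) (at u within {s - e0..s + e0})"
      unfolding C1_curve_on_def Let_def h_def using c by (metis (no_types, lifting))
    have at: "(h has_vector_derivative D u) (at u)" if "u \<in> {s - e0<..<s + e0}" for u
      using D(2)[of u] that by (simp add: at_within_Icc_at)
    then have Dh: "D u = h' u" if "u \<in> {s - e0<..<s + e0}" for u
      using vector_derivative_at[OF at[OF that]] by (simp add: h'_def)
    have "continuous_on {s - e0<..<s + e0} h'"
      by (rule continuous_on_eq[OF continuous_on_subset[OF D(1)] Dh]) auto
    moreover have "(h has_vector_derivative h' s) (at s)" using at[of s] Dh[of s] e0(1) by simp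
    moreover have "{s - e0<..<s + e0} \<subseteq> N" using sub greaterThanLessThan_subseteq_atLeastAtMost_iff by blast
    ultimately show ?thesis using e0(1) by blast
  qed
  have h'c: "continuous_on N h'"
  proof -
    have "continuous (at s) h'" if "s \<in> N" for s
      using loc[OF that] by (auto simp: continuous_on_eq_continuous_at)
    then show ?thesis using continuous_at_imp_continuous_on by blast
  qed
  \<comment> \<open>Cut off to the open set \<open>N\<close> of times that are not break points, the
    velocity is Borel on the whole line; within \<open>{0..s'}\<close> only finitely many times are
    lost.\<close>
  define B where "B s = indicator N s *\<^sub>R h' s" for s
  have Bm: "B \<in> borel_measurable lborel"
    unfolding B_def using borel_measurable_continuous_on_indicator[OF _ h'c] oN by simp
  have speed: "C * norm (B s) \<le> tnorm g (\<sigma> s) (vector_derivative (chart_map (chart_at A (\<sigma> s)) \<circ> \<sigma>) (at s within {0..1}))"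
    if s: "s \<in> N" for s
  proof -
    let ?b = "chart_at A (\<sigma> s)"
    have s01: "s \<in> {0<..<s'}" using s by (auto simp: N_def)
    then have \<sigma>V: "\<sigma> s \<in> V" using V by auto
    have "strict_deriv (chart_rep id c ?b) (chart_deriv id c ?b (\<sigma> s)) (h s)"
      using strict_diff_at_id[of "\<sigma> s"] c chart_at V(1) \<sigma>V unfolding strict_diff_at_def h_def by auto
    then have "(chart_rep id c ?b has_derivative of_chart A c (\<sigma> s)) (at (h s))"
      using strict_deriv_has_derivative by (auto simp: of_chart_def coord_change_eq)
    then have gd: "(chart_rep id c ?b has_derivative of_chart A c (\<sigma> s)) (at (h s) within h ` UNIV)"
      by (rule has_derivative_at_withinI)
    have hd: "(h has_vector_derivative h' s) (at s)" using loc[OF s] by (elim exE conjE)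
    have "(chart_rep id c ?b \<circ> h has_vector_derivative of_chart A c (\<sigma> s) (h' s)) (at s)"
      by (rule vector_derivative_diff_chain_within[OF hd gd])
    then have "(chart_map ?b \<circ> \<sigma> has_vector_derivative of_chart A c (\<sigma> s) (h' s)) (at s)"
    proof (rule has_vector_derivative_transform_within_open[of _ _ _ N])
      show "(chart_rep id c ?b \<circ> h) u = (chart_map ?b \<circ> \<sigma>) u" if "u \<in> N" for u
        using that V[of] chart_inv_map[OF c] by (auto simp: chart_rep_def h_def N_def subset_iff)
    qed (use oN s in auto)
    then have "vector_derivative (chart_map ?b \<circ> \<sigma>) (at s within {0..1}) = of_chart A c (\<sigma> s) (h' s)"
      using s01 s' by (intro vector_derivative_at_within_ivl) auto
    then show ?thesis using bound[OF \<sigma>V, of "h' s"] s by (simp add: B_def)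
  qed
  have le: "ennreal C * (\<integral>\<^sup>+ s. ennreal (norm (B s)) \<partial>lborel) \<le> curve_length A g \<sigma>"
  proof -
    have "ennreal C * (\<integral>\<^sup>+ s. ennreal (norm (B s)) \<partial>lborel) = (\<integral>\<^sup>+ s. ennreal C * ennreal (norm (B s)) \<partial>lborel)"
      using Bm by (intro nn_integral_cmult[symmetric]) auto
    also have "\<dots> \<le> curve_length A g \<sigma>"
      unfolding curve_length_def
    proof (rule nn_integral_mono)
      fix s
      show "ennreal C * ennreal (norm (B s)) \<le> ennreal (tnorm g (\<sigma> s)
         (vector_derivative (chart_map (chart_at A (\<sigma> s)) \<circ> \<sigma>) (at s within {0..1}))) * indicator {0..1} s"
      proof (cases "s \<in> N")
        case True
        then have "s \<in> {0..1}" using s' by (auto simp: N_def)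
        then show ?thesis using speed[OF True] C by (simp add: ennreal_mult[symmetric] ennreal_leI)
      qed (simp add: B_def)
    qed
    finally show ?thesis .
  qed
  \<comment> \<open>Either the velocity is integrable and its integral is the displacement, or its
    norm has infinite integral; then the length is infinite as well unless
    \<open>C = 0\<close>.\<close>
  show ?thesis
  proof (cases "(\<integral>\<^sup>+ s. ennreal (norm (B s)) \<partial>lborel) < \<infinity>")
    case True
    have int: "integrable lborel B" using Bm True by (rule integrableI_bounded)
    have "(h' has_integral (h s' - h 0)) {0..s'}"
    proof (rule fundamental_theorem_of_calculus_interior_strong[OF S(1)])
      show "continuous_on {0..s'} h" unfolding h_def
      proof (rule continuous_on_compose)
        show "continuous_on {0..s'} \<sigma>"
          using s' by (intro continuous_on_subset[OF piecewise_C1_continuous[OF \<sigma>]]) auto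
        show "continuous_on (\<sigma> ` {0..s'}) (chart_map c)"
          using V by (intro continuous_on_subset[OF chart_map_cont[OF c]]) auto
      qed
    qed (use s' loc in \<open>auto simp: N_def\<close>)
    moreover have "negligible (S \<union> {0, s'})" using S(1) by (intro negligible_finite) auto
    ultimately have "(B has_integral (h s' - h 0)) {0..s'}"
      by (rule has_integral_spike[rotated -1]) (auto simp: B_def N_def)
    then have "(B has_integral (h s' - h 0)) UNIV"
      by (rule has_integral_on_superset) (auto simp: B_def N_def)
    then have eq: "h s' - h 0 = integral\<^sup>L lborel B"
      using has_integral_integral_lborel[OF int] has_integral_unique by blast
    have "ennreal (C * norm (h s' - h 0)) = ennreal C * ennreal (norm (h s' - h 0))"
      using C by (simp add: ennreal_mult)
    also have "\<dots> \<le> ennreal C * (\<integral>\<^sup>+ s. ennreal (norm (B s)) \<partial>lborel)"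
      unfolding eq by (intro mult_left_mono integral_norm_bound_ennreal[OF int]) auto
    finally show ?thesis using le by (simp add: h_def)
  next
    case False
    then have inf: "(\<integral>\<^sup>+ s. ennreal (norm (B s)) \<partial>lborel) = \<infinity>" by (simp add: not_less top_unique)
    show ?thesis
    proof (cases "C = 0")
      case False
      then have "ennreal C * (\<integral>\<^sup>+ s. ennreal (norm (B s)) \<partial>lborel) = \<infinity>"
        using C inf by (simp add: ennreal_mult_top)
      then show ?thesis using le by (simp add: top_unique)
    qed simp
  qed
qed

text \<open>A curve that leaves the ball of radius \<open>2 * r\<close> has to cross the annulus
  around the ball of radius \<open>r\<close>. At its exit time it may already be outside the chart,
  so the displacement is measured slightly earlier.\<close>

lemma riem_dist_ge_chart:
  assumes c: "c \<in> A" and r: "0 < r" "cball a (2 * r) \<subseteq> chart_map c ` chart_dom c" and C: "0 \<le> C"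
    and bound: "\<And>x w. x \<in> chart_dom c \<Longrightarrow> chart_map c x \<in> cball a (2 * r) \<Longrightarrow>
       C * norm w \<le> tnorm g x (of_chart A c x w)"
    and y: "y \<in> chart_ball c a r" and z: "z \<notin> chart_ball c a (2 * r)"
  shows "ennreal (C * r) \<le> riem_dist A g y z"
  unfolding riem_dist_def
proof (rule INF_greatest, clarify)
  fix \<sigma> assume \<sigma>: "piecewise_C1_curve A \<sigma>" "y = \<sigma> 0" "z = \<sigma> 1"
  let ?U = "chart_ball c a (2 * r)"
  have \<sigma>c: "continuous_on {0..1} \<sigma>" by (rule piecewise_C1_continuous[OF \<sigma>(1)])
  define T where "T = {0..1} \<inter> \<sigma> -` (- ?U)"
  have "closed T" unfolding T_def
    using open_chart_ball[OF c] by (intro continuous_closed_preimage[OF \<sigma>c]) auto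
  moreover have "1 \<in> T" using z \<sigma> by (auto simp: T_def)
  moreover have "bdd_below T" by (auto simp: T_def)
  ultimately have InfT: "Inf T \<in> T" "\<And>s. s \<in> T \<Longrightarrow> Inf T \<le> s"
    using closed_contains_Inf[of T] cInf_lower[of _ T] by auto
  define s1 where "s1 = Inf T"
  have s1: "s1 \<in> {0..1}" "\<sigma> s1 \<notin> ?U" using InfT(1) by (auto simp: T_def s1_def)
  have before: "\<sigma> s \<in> ?U" if "0 \<le> s" "s < s1" for s
    using InfT(2)[of s] that s1(1) by (force simp: T_def s1_def)
  have "0 < s1"
  proof (rule ccontr)
    assume "\<not> 0 < s1"
    then have "s1 = 0" using s1(1) by auto
    then show False using s1(2) y \<sigma> r(1) by (auto simp: chart_ball_def)
  qed
  \<comment> \<open>This equals \<open>r + dist a (chart_map c y)\<close>, so a point at coordinate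
    distance at least \<open>\<rho>\<close> from \<open>a\<close> is displaced by at least
    \<open>r\<close> from \<open>y\<close>.\<close>
  define \<rho> where "\<rho> = 2 * r - (r - dist a (chart_map c y))"
  have y': "y \<in> chart_dom c" "dist a (chart_map c y) < r" using y by (auto simp: chart_ball_def)
  then have \<rho>: "\<rho> < 2 * r" by (auto simp: \<rho>_def)
  have "\<exists>s. 0 < s \<and> s < s1 \<and> \<rho> \<le> dist a (chart_map c (\<sigma> s))"
  proof (rule ccontr)
    assume neg: "\<not> ?thesis"
    \<comment> \<open>Were the curve confined to the closed ball of radius \<open>\<rho>\<close>,
      its limit at the exit time would lie in the compact, hence closed, set \<open>K\<close>, still
      inside the larger ball.\<close>
    define K where "K = chart_inv c ` cball a \<rho>"
    have sub: "cball a \<rho> \<subseteq> chart_map c ` chart_dom c"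
      using r(2) \<rho> by (meson less_eq_real_def order_trans subset_cball)
    have "closed K" unfolding K_def
      by (intro compact_imp_closed compact_continuous_image continuous_on_subset[OF chart_inv_cont[OF c] sub]) auto
    have inK: "\<sigma> s \<in> K" if "s \<in> {0<..<s1}" for s
    proof -
      have "\<sigma> s \<in> chart_dom c" using before[of s] that by (auto simp: chart_ball_def)
      moreover have "chart_map c (\<sigma> s) \<in> cball a \<rho>" using neg that by auto
      ultimately show ?thesis unfolding K_def using chart_inv_map[OF c] by (metis imageI)
    qed
    have "(\<sigma> \<longlongrightarrow> \<sigma> s1) (at s1 within {0<..<s1})"
      using \<sigma>c s1(1) unfolding continuous_on_def by (rule_tac tendsto_within_subset[of _ _ _ "{0..1}"]) auto
    moreover have "at s1 within {0<..<s1} \<noteq> bot"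
      using \<open>0 < s1\<close> by (simp add: at_within_eq_bot_iff)
    ultimately have "\<sigma> s1 \<in> K"
      using \<open>closed K\<close> inK by (intro Lim_in_closed_set) (auto simp: eventually_at_filter)
    then have "\<sigma> s1 \<in> ?U" using sub \<rho> chart_inv_in[OF c] chart_map_inv[OF c]
      by (fastforce simp: K_def chart_ball_def)
    then show False using s1(2) by simp
  qed
  then obtain s where s: "0 < s" "s < s1" "\<rho> \<le> dist a (chart_map c (\<sigma> s))" by blast
  have "\<rho> \<le> dist a (chart_map c y) + dist (chart_map c y) (chart_map c (\<sigma> s))"
    using s(3) dist_triangle order_trans by blast
  then have "r \<le> norm (chart_map c (\<sigma> s) - chart_map c (\<sigma> 0))"
    using \<sigma>(2) by (simp add: \<rho>_def dist_norm norm_minus_commute)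
  then have "ennreal (C * r) \<le> ennreal (C * norm (chart_map c (\<sigma> s) - chart_map c (\<sigma> 0)))"
    using C by (intro ennreal_leI mult_left_mono)
  also have "\<dots> \<le> curve_length A g \<sigma>"
    by (rule curve_length_ge_chart[OF c C, of ?U])
       (use before s s1 bound \<sigma> in \<open>auto simp: chart_ball_def less_imp_le\<close>)
  finally show "ennreal (C * r) \<le> curve_length A g \<sigma>" .
qed

text \<open>Leaving a chart ball costs a definite length, and finitely many chart balls cover the
  manifold. This ties the distance in the pressure to the topology.\<close>

lemma riem_dist_entourage:
  assumes G: "open G" "\<And>p. (p, p) \<in> G"
  shows "\<exists>\<epsilon>>0. \<forall>y z. riem_dist A g y z \<le> ennreal \<epsilon> \<longrightarrow> (y, z) \<in> G"
proof -
  define Q where "Q p c a r C \<longleftrightarrow> c \<in> A \<and> 0 < r \<and> 0 < C \<and> p \<in> chart_ball c a r \<and>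
     (\<forall>y z. y \<in> chart_ball c a r \<longrightarrow> riem_dist A g y z < ennreal (C * r) \<longrightarrow> (y, z) \<in> G)"
    for p c a and r C :: real
  have "\<exists>c a r C. Q p c a r C" for p
  proof -
    let ?c = "chart_at A p"
    note c = chart_at[of p]
    obtain W1 W2 where W: "open W1" "open W2" "(p, p) \<in> W1 \<times> W2" "W1 \<times> W2 \<subseteq> G"
      using open_prod_elim[OF G(1) G(2)] by blast
    have "open (chart_map ?c ` (chart_dom ?c \<inter> (W1 \<inter> W2)))"
      by (rule open_chart_image[OF c(1)]) (use W in auto)
    moreover have "chart_map ?c p \<in> chart_map ?c ` (chart_dom ?c \<inter> (W1 \<inter> W2))"
      using c(2) W(3) by blast
    ultimately obtain e where e: "e > 0"
      "cball (chart_map ?c p) e \<subseteq> chart_map ?c ` (chart_dom ?c \<inter> (W1 \<inter> W2))"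
      using open_contains_cball by blast
    define r where "r = e / 2"
    have r: "0 < r" "cball (chart_map ?c p) (2 * r) \<subseteq> chart_map ?c ` (chart_dom ?c \<inter> (W1 \<inter> W2))"
      using e by (auto simp: r_def)
    then have sub: "cball (chart_map ?c p) (2 * r) \<subseteq> chart_map ?c ` chart_dom ?c" by auto
    obtain C where C: "C > 0" "\<And>x w. x \<in> chart_dom ?c \<Longrightarrow> chart_map ?c x \<in> cball (chart_map ?c p) (2 * r) \<Longrightarrow>
       C * norm w \<le> tnorm g x (of_chart A ?c x w)"
      using chart_norm_bounds[OF c(1) compact_cball sub] by blast
    have inW: "x \<in> W1 \<inter> W2" if "x \<in> chart_ball ?c (chart_map ?c p) (2 * r)" for x
    proof -
      have x: "x \<in> chart_dom ?c" "chart_map ?c x \<in> cball (chart_map ?c p) (2 * r)"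
        using that by (auto simp: chart_ball_def)
      then obtain x' where "x' \<in> chart_dom ?c \<inter> (W1 \<inter> W2)" "chart_map ?c x = chart_map ?c x'"
        using r(2) by blast
      then show ?thesis using chart_map_inj[OF c(1) x(1)] by auto
    qed
    have "(y, z) \<in> G" if y: "y \<in> chart_ball ?c (chart_map ?c p) r"
      and d: "riem_dist A g y z < ennreal (C * r)" for y z
    proof -
      have "z \<in> chart_ball ?c (chart_map ?c p) (2 * r)"
      proof (rule ccontr)
        assume "z \<notin> chart_ball ?c (chart_map ?c p) (2 * r)"
        then have "ennreal (C * r) \<le> riem_dist A g y z"
          using C(2) by (intro riem_dist_ge_chart[OF c(1) r(1) sub less_imp_le[OF C(1)] _ y])
        then show False using d by simp
      qed
      moreover have "y \<in> chart_ball ?c (chart_map ?c p) (2 * r)"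
        using y r(1) by (auto simp: chart_ball_def)
      ultimately show ?thesis using inW W(4) by blast
    qed
    moreover have "p \<in> chart_ball ?c (chart_map ?c p) r"
      using c r(1) by (simp add: chart_ball_def)
    ultimately have "Q p ?c (chart_map ?c p) r C"
      unfolding Q_def using c(1) r(1) C(1) by blast
    then show ?thesis by blast
  qed
  then have "\<forall>p. \<exists>c. \<exists>a r C. Q p c a r C" by blast
  from choice[OF this] obtain c where "\<forall>p. \<exists>a. \<exists>r C. Q p (c p) a r C" ..
  from choice[OF this] obtain a where "\<forall>p. \<exists>r. \<exists>C. Q p (c p) (a p) r C" ..
  from choice[OF this] obtain r where "\<forall>p. \<exists>C. Q p (c p) (a p) (r p) C" ..
  from choice[OF this] obtain C where "\<forall>p. Q p (c p) (a p) (r p) (C p)" ..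
  then have *: "c p \<in> A" "0 < r p" "0 < C p" "p \<in> chart_ball (c p) (a p) (r p)"
    "y \<in> chart_ball (c p) (a p) (r p) \<Longrightarrow> riem_dist A g y z < ennreal (C p * r p) \<Longrightarrow> (y, z) \<in> G"
    for p y z unfolding Q_def by simp_all
  have op: "open (chart_ball (c p) (a p) (r p))" for p by (rule open_chart_ball[OF *(1)])
  obtain P where P: "finite P" "UNIV \<subseteq> (\<Union>p\<in>P. chart_ball (c p) (a p) (r p))"
  proof (rule compactE_image[OF compact_M, of UNIV "\<lambda>p. chart_ball (c p) (a p) (r p)"])
    show "UNIV \<subseteq> (\<Union>p\<in>UNIV. chart_ball (c p) (a p) (r p))" using *(4) by (intro subsetI UN_I UNIV_I)
  qed (use op in auto)
  \<comment> \<open>Halved because the assumed bound on the distance is not strict; the 1 keeps the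
    set nonempty.\<close>
  define \<epsilon> where "\<epsilon> = Min (insert 1 ((\<lambda>p. C p * r p / 2) ` P))"
  have \<epsilon>: "\<epsilon> > 0" unfolding \<epsilon>_def using P(1) * by (subst Min_gr_iff) auto
  show ?thesis
  proof (intro exI[of _ \<epsilon>] conjI \<epsilon> allI impI)
    fix y z assume yz: "riem_dist A g y z \<le> ennreal \<epsilon>"
    obtain p where p: "p \<in> P" "y \<in> chart_ball (c p) (a p) (r p)" using P(2) by auto
    have "\<epsilon> \<le> C p * r p / 2" unfolding \<epsilon>_def using P(1) p(1) by (intro Min_le) auto
    also have "\<dots> < C p * r p" using *(2,3)[of p] by simp
    finally have "ennreal \<epsilon> < ennreal (C p * r p)" using \<epsilon> by (intro ennreal_lessI) auto
    then show "(y, z) \<in> G" using *(5)[OF p(2)] yz by (meson order.strict_trans1)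
  qed
qed

section \<open>Expansion and local injectivity\<close>

text \<open>A small closed coordinate ball is compact, hence closed in the Hausdorff space, and so
  contains the closure of the open one.\<close>

lemma chart_regular:
  fixes p :: 'm
  assumes "open W" "p \<in> W"
  shows "\<exists>V. open V \<and> p \<in> V \<and> closure V \<subseteq> W"
proof -
  let ?c = "chart_at A p"
  note c = chart_at[of p]
  have "open (chart_map ?c ` (chart_dom ?c \<inter> W))" by (rule open_chart_image[OF c(1) assms(1)])
  moreover have "chart_map ?c p \<in> chart_map ?c ` (chart_dom ?c \<inter> W)" using c(2) assms(2) by blast
  ultimately obtain e where e: "e > 0"
    "cball (chart_map ?c p) e \<subseteq> chart_map ?c ` (chart_dom ?c \<inter> W)"
    using open_contains_cball by blast
  define V where "V = chart_ball ?c (chart_map ?c p) e"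
  have sub: "cball (chart_map ?c p) e \<subseteq> chart_map ?c ` chart_dom ?c" using e(2) by auto
  have "closed (chart_inv ?c ` cball (chart_map ?c p) e)"
    by (intro compact_imp_closed compact_continuous_image
        continuous_on_subset[OF chart_inv_cont[OF c(1)] sub]) auto
  moreover have "V \<subseteq> chart_inv ?c ` cball (chart_map ?c p) e"
  proof
    fix x assume "x \<in> V"
    then have "x \<in> chart_dom ?c" "chart_map ?c x \<in> cball (chart_map ?c p) e"
      by (auto simp: V_def chart_ball_def)
    then show "x \<in> chart_inv ?c ` cball (chart_map ?c p) e"
      using chart_inv_map[OF c(1)] by (metis imageI)
  qed
  ultimately have "closure V \<subseteq> chart_inv ?c ` cball (chart_map ?c p) e" by (rule closure_minimal[rotated])
  moreover have "chart_inv ?c ` cball (chart_map ?c p) e \<subseteq> W"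
  proof
    fix x assume "x \<in> chart_inv ?c ` cball (chart_map ?c p) e"
    then obtain y where "y \<in> chart_dom ?c \<inter> W" "x = chart_inv ?c (chart_map ?c y)" using e(2) by blast
    then show "x \<in> W" using chart_inv_map[OF c(1)] by auto
  qed
  ultimately have "closure V \<subseteq> W" by blast
  moreover have "open V" "p \<in> V"
    using open_chart_ball[OF c(1)] c(2) e(1) by (auto simp: V_def chart_ball_def)
  ultimately show ?thesis by blast
qed

text \<open>The type \<open>'m\<close> carries no metric, so uniform smallness is expressed by open neighbourhoods of the
  diagonal.\<close>

lemma lebesgue_entourage:
  fixes \<Lambda> :: "'m set"
  assumes \<Lambda>: "compact \<Lambda>" and W: "\<And>p. p \<in> \<Lambda> \<Longrightarrow> open (W p)" "\<And>p. p \<in> \<Lambda> \<Longrightarrow> p \<in> W p"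
  shows "\<exists>P G. finite P \<and> P \<subseteq> \<Lambda> \<and> open G \<and> (\<forall>p. (p, p) \<in> G) \<and>
     (\<forall>x\<in>\<Lambda>. \<exists>p\<in>P. \<forall>z. (x, z) \<in> G \<longrightarrow> z \<in> W p)"
proof -
  have "\<forall>p\<in>\<Lambda>. \<exists>V. open V \<and> p \<in> V \<and> closure V \<subseteq> W p" using chart_regular W by blast
  from bchoice[OF this] obtain V where V: "\<And>p. p \<in> \<Lambda> \<Longrightarrow> open (V p)" "\<And>p. p \<in> \<Lambda> \<Longrightarrow> p \<in> V p"
    "\<And>p. p \<in> \<Lambda> \<Longrightarrow> closure (V p) \<subseteq> W p" by blast
  obtain P where P: "P \<subseteq> \<Lambda>" "finite P" "\<Lambda> \<subseteq> (\<Union>p\<in>P. V p)"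
  proof (rule compactE_image[OF \<Lambda>, of \<Lambda> V])
    show "\<Lambda> \<subseteq> (\<Union>p\<in>\<Lambda>. V p)" using V(2) by blast
  qed (use V(1) in auto)
  \<comment> \<open>For each \<open>p\<close> in \<open>P\<close> the condition reads: if
    \<open>x\<close> is in \<open>closure (V p)\<close> then \<open>z\<close> is in
    \<open>W p\<close>. It is open because the closures are closed, and it holds on the diagonal
    because \<open>closure (V p) \<subseteq> W p\<close>.\<close>
  define G where "G = (\<Inter>p\<in>P. (- closure (V p)) \<times> UNIV \<union> UNIV \<times> W p)"
  have "open G" unfolding G_def using P W(1)
    by (intro open_INT ballI open_Un open_Times) auto
  moreover have "(p, p) \<in> G" for p
    using V(3) P(1) unfolding G_def by blast
  moreover have "\<exists>p\<in>P. \<forall>z. (x, z) \<in> G \<longrightarrow> z \<in> W p" if "x \<in> \<Lambda>" for x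
  proof -
    have "x \<in> (\<Union>p\<in>P. V p)" using P(3) that by (rule subsetD)
    then obtain p where "p \<in> P" "x \<in> V p" by (rule UN_E)
    then show ?thesis using closure_subset[of "V p"] unfolding G_def by blast
  qed
  ultimately show ?thesis using P(1,2) by (intro exI[of _ P] exI[of _ G]) blast
qed

text \<open>One half of \<open>\<tau>\<close> is spent on strict differentiability at
  \<open>p\<close>, the other on replacing the derivative at \<open>p\<close> by the one at
  \<open>x\<close>. The base point \<open>x\<close> ranges over all of \<open>W\<close> because a
  cell is linearized at a point with no preferred position.\<close>

lemma chart_linearization:
  assumes F: "continuous_on UNIV F" "\<And>x. strict_diff_at A F x"
    and c: "c \<in> A" "p \<in> chart_dom c" and c': "c' \<in> A" "F p \<in> chart_dom c'" and \<tau>: "0 < \<tau>"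
  obtains W where "open W" "p \<in> W" "W \<subseteq> chart_dom c" "F ` W \<subseteq> chart_dom c'"
    "\<forall>x\<in>W. \<forall>w. norm (chart_deriv F c c' x w - chart_deriv F c c' p w) \<le> \<tau> * norm w"
    "\<forall>x\<in>W. \<forall>y\<in>W. \<forall>z\<in>W.
       norm (chart_map c' (F y) - chart_map c' (F z) - chart_deriv F c c' x (chart_map c y - chart_map c z))
         \<le> \<tau> * norm (chart_map c y - chart_map c z)"
proof -
  let ?G = "chart_rep F c c'" and ?D = "chart_deriv F c c' p"
  have sd: "strict_deriv ?G ?D (chart_map c p)" using F(2) c c' unfolding strict_diff_at_def by blast
  moreover have "\<tau> / 2 > 0" using \<tau> by simp
  ultimately obtain r where r: "r > 0" "\<And>y z. y \<in> ball (chart_map c p) r \<Longrightarrow> z \<in> ball (chart_map c p) r \<Longrightarrow>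
      norm (?G y - ?G z - ?D (y - z)) \<le> \<tau> / 2 * norm (y - z)"
    unfolding strict_deriv_def by meson
  have bl: "bounded_linear ?D" using sd by (simp add: strict_deriv_def)
  define W where "W = chart_ball c (chart_map c p) r \<inter> F -` chart_dom c'"
  have W: "open W" "p \<in> W" "W \<subseteq> chart_dom c" "F ` W \<subseteq> chart_dom c'"
    using open_Int[OF open_chart_ball[OF c(1)] open_vimage[OF chart_dom_open[OF c'(1)] F(1)]] c c' r(1)
    unfolding W_def by (simp, auto simp: chart_ball_def)
  have inb: "chart_map c x \<in> ball (chart_map c p) r" if "x \<in> W" for x
    using that by (auto simp: W_def chart_ball_def)
  have near: "norm (chart_deriv F c c' x w - ?D w) \<le> \<tau> / 2 * norm w" if "x \<in> W" for x w
  proof (rule strict_deriv_near[OF r(2) bl inb[OF that]])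
    have "strict_deriv ?G (chart_deriv F c c' x) (chart_map c x)"
      using F(2) c c' W that unfolding strict_diff_at_def by blast
    then show "(?G has_derivative chart_deriv F c c' x) (at (chart_map c x))"
      by (rule strict_deriv_has_derivative)
  qed (use \<tau> in auto)
  have lin: "norm (chart_map c' (F y) - chart_map c' (F z) - chart_deriv F c c' x (chart_map c y - chart_map c z))
          \<le> \<tau> * norm (chart_map c y - chart_map c z)" if "x \<in> W" "y \<in> W" "z \<in> W" for x y z
  proof -
    let ?w = "chart_map c y - chart_map c z"
    have eq: "?G (chart_map c u) = chart_map c' (F u)" if "u \<in> W" for u
      using that W(3) chart_inv_map[OF c(1)] by (auto simp: chart_rep_def)
    have "chart_map c' (F y) - chart_map c' (F z) - chart_deriv F c c' x ?w =
       (?G (chart_map c y) - ?G (chart_map c z) - ?D ?w) - (chart_deriv F c c' x ?w - ?D ?w)"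
      using eq that by simp
    also have "norm \<dots> \<le> \<tau> / 2 * norm ?w + \<tau> / 2 * norm ?w"
      by (intro order_trans[OF norm_triangle_ineq4] add_mono r(2) near inb that)
    finally show ?thesis by simp
  qed
  have near': "norm (chart_deriv F c c' x w - ?D w) \<le> \<tau> * norm w" if "x \<in> W" for x w
  proof -
    have "\<tau> / 2 * norm w \<le> \<tau> * norm w" using \<tau> by (intro mult_right_mono) auto
    then show ?thesis using near[OF that, of w] by linarith
  qed
  show ?thesis by (rule that[OF W]) (use near' lin in blast)+
qed

text \<open>Near \<open>p\<close> the chart derivative is within 1 of the one at \<open>p\<close>,
  and chart norms compare with \<open>tnorm\<close>; compactness of the manifold makes the bound
  uniform. Fixed charts are used because the selected ones may jump.\<close>

lemma tangent_map_bounded: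
  assumes F: "continuous_on UNIV F" "\<And>x. strict_diff_at A F x"
  shows "\<exists>B\<ge>1. \<forall>x v. tnorm g (F x) (tangent_map A F x v) \<le> B * tnorm g x v"
proof -
  have "\<exists>W B. open W \<and> p \<in> W \<and> (\<forall>x\<in>W. \<forall>v. tnorm g (F x) (tangent_map A F x v) \<le> B * tnorm g x v)" for p
  proof -
    let ?c = "chart_at A p" and ?d = "chart_at A (F p)"
    note c = chart_at[of p] note d = chart_at[of "F p"]
    obtain W where W: "open W" "p \<in> W" "W \<subseteq> chart_dom ?c" "F ` W \<subseteq> chart_dom ?d"
      "\<forall>x\<in>W. \<forall>w. norm (chart_deriv F ?c ?d x w - chart_deriv F ?c ?d p w) \<le> 1 * norm w"
      by (rule chart_linearization[OF F c d zero_less_one]) (rule that)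
    obtain e where e: "e > 0" "cball (chart_map ?c p) e \<subseteq> chart_map ?c ` chart_dom ?c"
      using chart_img_open[OF c(1)] c(2) open_contains_cball by blast
    obtain e' where e': "e' > 0" "cball (chart_map ?d (F p)) e' \<subseteq> chart_map ?d ` chart_dom ?d"
      using chart_img_open[OF d(1)] d(2) open_contains_cball by blast
    obtain c1 where c1: "c1 > 0" "\<And>x w. x \<in> chart_dom ?c \<Longrightarrow> chart_map ?c x \<in> cball (chart_map ?c p) e \<Longrightarrow>
        c1 * norm w \<le> tnorm g x (of_chart A ?c x w)"
      using chart_norm_bounds[OF c(1) compact_cball e(2)] by blast
    obtain c2 where c2: "c2 > 0" "\<And>x w. x \<in> chart_dom ?d \<Longrightarrow> chart_map ?d x \<in> cball (chart_map ?d (F p)) e' \<Longrightarrow>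
        tnorm g x (of_chart A ?d x w) \<le> c2 * norm w"
      using chart_norm_bounds[OF d(1) compact_cball e'(2)] by blast
    have bl: "bounded_linear (chart_deriv F ?c ?d p)" by (intro chart_deriv_linear F c d)
    obtain L where L: "L > 0" "\<And>w. norm (chart_deriv F ?c ?d p w) \<le> norm w * L"
      using bounded_linear.pos_bounded[OF bl] by metis
    define V where "V = W \<inter> chart_ball ?c (chart_map ?c p) e \<inter> F -` chart_ball ?d (chart_map ?d (F p)) e'"
    have V: "open V" "p \<in> V"
      unfolding V_def
      by (intro open_Int W(1) open_chart_ball[OF c(1)] open_vimage[OF open_chart_ball[OF d(1)] F(1)])
         (use W(2) c d e(1) e'(1) in \<open>auto simp: chart_ball_def\<close>)
    have "tnorm g (F x) (tangent_map A F x v) \<le> (c2 * (L + 1) / c1) * tnorm g x v" if "x \<in> V" for x v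
    proof -
      have x: "x \<in> W" "x \<in> chart_dom ?c" "F x \<in> chart_dom ?d"
        "chart_map ?c x \<in> cball (chart_map ?c p) e" "chart_map ?d (F x) \<in> cball (chart_map ?d (F p)) e'"
        using that by (auto simp: V_def chart_ball_def)
      define w where "w = to_chart A ?c x v"
      have v: "v = of_chart A ?c x w" unfolding w_def using of_to_chart[OF c(1) x(2)] by simp
      have "tangent_map A F x v = of_chart A ?d (F x) (chart_deriv F ?c ?d x w)"
        unfolding v using chart_deriv_eq[OF F c(1) x(2) d(1) x(3)] of_to_chart[OF d(1) x(3)] by simp
      then have "tnorm g (F x) (tangent_map A F x v) \<le> c2 * norm (chart_deriv F ?c ?d x w)"
        using c2(2)[OF x(3) x(5)] by simp
      also have "norm (chart_deriv F ?c ?d x w) \<le> (L + 1) * norm w"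
        using W(5)[rule_format, OF x(1), of w] L(2)[of w]
          norm_triangle_ineq2[of "chart_deriv F ?c ?d x w" "chart_deriv F ?c ?d p w"]
        by (simp add: algebra_simps)
      also have "norm w \<le> tnorm g x v / c1"
        using c1(2)[OF x(2) x(4), of w] c1(1) by (simp add: v field_simps)
      finally show ?thesis using c2(1) L(1) by (simp add: mult_ac)
    qed
    then show ?thesis using V by blast
  qed
  then have "\<forall>p. \<exists>W. \<exists>B. open W \<and> p \<in> W \<and> (\<forall>x\<in>W. \<forall>v. tnorm g (F x) (tangent_map A F x v) \<le> B * tnorm g x v)"
    by (intro allI)
  from choice[OF this] obtain W where
    "\<forall>p. \<exists>B. open (W p) \<and> p \<in> W p \<and> (\<forall>x\<in>W p. \<forall>v. tnorm g (F x) (tangent_map A F x v) \<le> B * tnorm g x v)" ..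
  from choice[OF this] obtain B where B: "\<And>p. open (W p)" "\<And>p. p \<in> W p"
    "\<And>p x v. x \<in> W p \<Longrightarrow> tnorm g (F x) (tangent_map A F x v) \<le> B p * tnorm g x v" by blast
  obtain P where P: "finite P" "UNIV \<subseteq> (\<Union>p\<in>P. W p)"
  proof (rule compactE_image[OF compact_M, of UNIV W])
    show "UNIV \<subseteq> (\<Union>p\<in>UNIV. W p)" using B(2) by blast
  qed (use B(1) in auto)
  define C where "C = Max (insert 1 (B ` P))"
  have "tnorm g (F x) (tangent_map A F x v) \<le> C * tnorm g x v" for x v
  proof -
    obtain p where p: "p \<in> P" "x \<in> W p" using P(2) by auto
    have "B p \<le> C" unfolding C_def using P(1) p(1) by (intro Max_ge) auto
    then have "B p * tnorm g x v \<le> C * tnorm g x v" by (intro mult_right_mono tnorm_nonneg)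
    then show ?thesis using B(3)[OF p(2), of v] by linarith
  qed
  moreover have "C \<ge> 1" unfolding C_def using P(1) by (intro Max_ge) auto
  ultimately show ?thesis by blast
qed

end

section \<open>Expanding maps and the separation of preimages\<close>

locale expanding_on = compact_riem_mfd A g
  for A :: "('m::t2_space, 'e::euclidean_space) chart set" and g :: "'m \<Rightarrow> 'e \<Rightarrow> 'e \<Rightarrow> real" +
  fixes f :: "'m \<Rightarrow> 'm" and \<Lambda> :: "'m set" and \<kappa> :: real
  assumes f_cont: "continuous_on UNIV f" and f_sd: "\<And>p. strict_diff_at A f p"
    and compact_\<Lambda>: "compact \<Lambda>" and f_\<Lambda>: "f ` \<Lambda> \<subseteq> \<Lambda>" and \<kappa>: "1 < \<kappa>"
    and expand: "\<And>x v. x \<in> \<Lambda> \<Longrightarrow> \<kappa> * tnorm g x v \<le> tnorm g (f x) (tangent_map A f x v)"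
begin

lemma funpow_\<Lambda>: "x \<in> \<Lambda> \<Longrightarrow> (f ^^ n) x \<in> \<Lambda>"
  using f_\<Lambda> by (induction n) auto

lemma funpow_cont: "continuous_on UNIV (f ^^ n)"
  by (induction n) (auto intro: continuous_on_compose2[OF f_cont] simp: o_def)

lemma funpow_sd: "strict_diff_at A (f ^^ n) p"
proof (induction n)
  case 0
  then show ?case unfolding funpow.simps(1) by (rule strict_diff_at_id)
next
  case (Suc n)
  show ?case unfolding funpow.simps(2) by (rule strict_diff_at_compose[OF funpow_cont Suc f_sd])
qed

lemma tangent_map_0: "tangent_map A (f ^^ 0) x v = v"
  using chart_deriv_id[OF chart_at] by (simp add: tangent_map_eq)

lemma tangent_map_Suc:
  "tangent_map A (f ^^ Suc n) x v = tangent_map A f ((f ^^ n) x) (tangent_map A (f ^^ n) x v)"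
  using tangent_map_comp[OF funpow_cont funpow_sd f_sd] by simp

lemma expand_funpow:
  assumes "x \<in> \<Lambda>"
  shows "\<kappa> ^ n * tnorm g x v \<le> tnorm g ((f ^^ n) x) (tangent_map A (f ^^ n) x v)"
proof (induction n)
  case (Suc n)
  have "\<kappa> ^ Suc n * tnorm g x v \<le> \<kappa> * tnorm g ((f ^^ n) x) (tangent_map A (f ^^ n) x v)"
    using Suc \<kappa> by simp
  also have "\<dots> \<le> tnorm g (f ((f ^^ n) x)) (tangent_map A f ((f ^^ n) x) (tangent_map A (f ^^ n) x v))"
    by (rule expand[OF funpow_\<Lambda>[OF assms]])
  finally show ?case unfolding tangent_map_Suc by simp
next
  case 0
  then show ?case unfolding tangent_map_0 by simp
qed

text \<open>Expansion makes the derivative injective, hence bounded below by some \<open>b\<close>;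
  a linearization error of \<open>b / 2\<close> is too small to bring distinct points
  together.\<close>

lemma f_locally_inj:
  assumes p: "p \<in> \<Lambda>"
  shows "\<exists>W. open W \<and> p \<in> W \<and> inj_on f W"
proof -
  let ?c = "chart_at A p" and ?d = "chart_at A (f p)"
  note c = chart_at[of p] note d = chart_at[of "f p"]
  let ?D = "chart_deriv f ?c ?d p"
  have lin: "linear ?D" by (intro bounded_linear.linear chart_deriv_linear f_sd c d)
  have "inj ?D"
    unfolding linear_injective_0[OF lin]
  proof (intro allI impI)
    fix w assume "?D w = 0"
    then have "tangent_map A f p (of_chart A ?c p w) = 0"
      using chart_deriv_eq[OF f_cont f_sd c d, of w] of_to_chart[OF d]
        linear_0[OF of_chart_linear[OF d]] by metis
    then have "\<kappa> * tnorm g p (of_chart A ?c p w) \<le> 0" using expand[OF p] by (metis tnorm_zero)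
    then have "of_chart A ?c p w = 0"
      using tnorm_pos[of "of_chart A ?c p w" p] \<kappa> by (auto simp: mult_le_0_iff)
    then show "w = 0" using of_to_chart[OF c] linear_0[OF to_chart_linear[OF c]] by metis
  qed
  then obtain b where b: "b > 0" "\<And>w. b * norm w \<le> norm (?D w)"
    using linear_inj_bounded_below_pos[OF lin] by metis
  obtain W where W: "open W" "p \<in> W" "W \<subseteq> chart_dom ?c"
    "\<forall>x\<in>W. \<forall>y\<in>W. \<forall>z\<in>W.
        norm (chart_map ?d (f y) - chart_map ?d (f z) - chart_deriv f ?c ?d x (chart_map ?c y - chart_map ?c z))
          \<le> b / 2 * norm (chart_map ?c y - chart_map ?c z)"
    by (rule chart_linearization[OF f_cont f_sd c d half_gt_zero[OF b(1)]]) (rule that)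
  have "inj_on f W"
  proof (rule inj_onI)
    fix y z assume yz: "y \<in> W" "z \<in> W" "f y = f z"
    let ?w = "chart_map ?c y - chart_map ?c z"
    have "b * norm ?w \<le> b / 2 * norm ?w" using W(4)[rule_format, OF W(2) yz(1,2)] yz(3) b(2)[of ?w] by simp
    then have "norm ?w = 0" using b(1) by simp
    then show "y = z" using chart_map_inj[OF c(1)] W(3) yz(1,2) by auto
  qed
  then show ?thesis using W(1,2) by blast
qed

text \<open>\<open>K\<close> is a finite union of squares of compact sets on which \<open>f\<close>
  is injective. Points near a common centre \<open>e\<close> fall into one square, which is how two
  points with the same greedy centre are compared. Symmetrizing the entourage admits either order of
  the arguments of \<open>riem_dist\<close>.\<close>

lemma expansive_pairs:
  "\<exists>\<epsilon>>0. \<exists>K. compact K \<and> (\<forall>y z. (y, z) \<in> K \<longrightarrow> f y = f z \<longrightarrow> y = z) \<and>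
     (\<forall>e\<in>\<Lambda>. \<forall>y\<in>\<Lambda>. \<forall>z\<in>\<Lambda>.
        (riem_dist A g e y \<le> ennreal \<epsilon> \<or> riem_dist A g y e \<le> ennreal \<epsilon>) \<longrightarrow>
        (riem_dist A g e z \<le> ennreal \<epsilon> \<or> riem_dist A g z e \<le> ennreal \<epsilon>) \<longrightarrow> (y, z) \<in> K)"
proof -
  have "\<exists>V. open V \<and> p \<in> V \<and> inj_on f (closure V)" if "p \<in> \<Lambda>" for p
    using f_locally_inj[OF that] chart_regular inj_on_subset by meson
  then have "\<forall>p\<in>\<Lambda>. \<exists>V. open V \<and> p \<in> V \<and> inj_on f (closure V)" by blast
  from bchoice[OF this] obtain V where V: "\<And>p. p \<in> \<Lambda> \<Longrightarrow> open (V p)" "\<And>p. p \<in> \<Lambda> \<Longrightarrow> p \<in> V p"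
    "\<And>p. p \<in> \<Lambda> \<Longrightarrow> inj_on f (closure (V p))" by blast
  obtain P G where P: "finite P" "P \<subseteq> \<Lambda>" and G: "open G" "\<And>p. (p, p) \<in> G"
    "\<And>x. x \<in> \<Lambda> \<Longrightarrow> \<exists>p\<in>P. \<forall>z. (x, z) \<in> G \<longrightarrow> z \<in> V p"
    using lebesgue_entourage[OF compact_\<Lambda> V(1,2)] by blast
  define H where "H = G \<inter> prod.swap -` G"
  have H: "open H" "\<And>p. (p, p) \<in> H"
    using G(1,2) by (auto simp: H_def intro!: open_Int open_vimage continuous_on_swap)
  obtain \<epsilon> where \<epsilon>: "\<epsilon> > 0" "\<And>y z. riem_dist A g y z \<le> ennreal \<epsilon> \<Longrightarrow> (y, z) \<in> H"
    using riem_dist_entourage[OF H] by blast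
  define K where "K = (\<Union>p\<in>P. (closure (V p) \<inter> \<Lambda>) \<times> (closure (V p) \<inter> \<Lambda>))"
  have K1: "compact K" unfolding K_def
    by (intro compact_UN P compact_Times closed_Int_compact compact_\<Lambda> closed_closure)
  have K2: "y = z" if "(y, z) \<in> K" "f y = f z" for y z
    using that V(3) P(2) unfolding K_def by (auto dest: inj_onD)
  have K3: "(y, z) \<in> K" if eyz: "e \<in> \<Lambda>" "y \<in> \<Lambda>" "z \<in> \<Lambda>" and near:
    "riem_dist A g e y \<le> ennreal \<epsilon> \<or> riem_dist A g y e \<le> ennreal \<epsilon>"
    "riem_dist A g e z \<le> ennreal \<epsilon> \<or> riem_dist A g z e \<le> ennreal \<epsilon>" for e y z
  proof -
    have "(e, y) \<in> G" "(e, z) \<in> G" using near \<epsilon>(2) by (auto simp: H_def)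
    then obtain p where "p \<in> P" "y \<in> V p" "z \<in> V p" using G(3)[OF eyz(1)] by blast
    then show ?thesis using eyz(2,3) closure_subset unfolding K_def by blast
  qed
  show ?thesis
    by (intro exI[of _ \<epsilon>] exI[of _ K] conjI ballI allI impI; (rule \<epsilon>(1) K1 | rule K2 K3; assumption))
qed

text \<open>Continuity of inverse branches in relational form. The pairs of \<open>K\<close> outside
  \<open>H\<close> form a compact set that \<open>f\<close> maps off the diagonal, so the complement
  of its image is again an open neighbourhood of the diagonal.\<close>

lemma pullback_entourage:
  assumes K: "compact K" "\<And>y z. (y, z) \<in> K \<Longrightarrow> f y = f z \<Longrightarrow> y = z" and G: "open G" "\<And>p. (p, p) \<in> G"
  shows "\<exists>H. open H \<and> (\<forall>p. (p, p) \<in> H) \<and>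
    (\<forall>y z. (\<forall>l<n. ((f ^^ l) y, (f ^^ l) z) \<in> K) \<longrightarrow> ((f ^^ n) y, (f ^^ n) z) \<in> H \<longrightarrow> (y, z) \<in> G)"
proof (induction n)
  case 0
  then show ?case using G by (intro exI[of _ G]) auto
next
  case (Suc n)
  then obtain H where H: "open H" "\<And>p. (p, p) \<in> H"
    "\<And>y z. (\<forall>l<n. ((f ^^ l) y, (f ^^ l) z) \<in> K) \<Longrightarrow> ((f ^^ n) y, (f ^^ n) z) \<in> H \<Longrightarrow> (y, z) \<in> G"
    by blast
  define H' where "H' = - ((\<lambda>q. (f (fst q), f (snd q))) ` (K - H))"
  have "compact (K - H)" using K(1) H(1) by (rule compact_diff)
  moreover have "continuous_on S (\<lambda>q. (f (fst q), f (snd q)))" for S :: "('m \<times> 'm) set"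
    by (intro continuous_intros continuous_on_compose2[OF f_cont]) auto
  ultimately have "open H'" unfolding H'_def
    by (intro open_Compl compact_imp_closed compact_continuous_image)
  moreover have "(p, p) \<in> H'" for p using K(2) H(2) by (force simp: H'_def)
  moreover have "(y, z) \<in> G" if "\<forall>l<Suc n. ((f ^^ l) y, (f ^^ l) z) \<in> K"
    "((f ^^ Suc n) y, (f ^^ Suc n) z) \<in> H'" for y z
  proof (rule H(3))
    show "((f ^^ n) y, (f ^^ n) z) \<in> H"
    proof (rule ccontr)
      assume "((f ^^ n) y, (f ^^ n) z) \<notin> H"
      then have "((f ^^ n) y, (f ^^ n) z) \<in> K - H" using that(1) by blast
      then show False using that(2) by (force simp: H'_def)
    qed
  qed (use that(1) in auto)
  ultimately show ?case by blast
qed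

end

section \<open>Dominated splittings\<close>

locale split_expanding = expanding_on A g f \<Lambda> \<kappa>
  for A :: "('m::t2_space, 'e::euclidean_space) chart set" and g :: "'m \<Rightarrow> 'e \<Rightarrow> 'e \<Rightarrow> real"
    and f :: "'m \<Rightarrow> 'm" and \<Lambda> :: "'m set" and \<kappa> :: real +
  fixes k :: nat and E :: "nat \<Rightarrow> 'm \<Rightarrow> 'e set" and m :: "nat \<Rightarrow> nat"
    and lam :: "nat \<Rightarrow> real" and Cd \<eta> :: real
  assumes k: "1 \<le> k" and m_pos: "\<And>j. j \<in> {1..k} \<Longrightarrow> 0 < m j"
    and E_subspace: "\<And>x j. x \<in> \<Lambda> \<Longrightarrow> j \<in> {1..k} \<Longrightarrow> subspace (E j x)"
    and E_dim: "\<And>x j. x \<in> \<Lambda> \<Longrightarrow> j \<in> {1..k} \<Longrightarrow> dim (E j x) = m j"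
    and E_direct: "\<And>x v. x \<in> \<Lambda> \<Longrightarrow> \<exists>!w. w \<in> (\<Pi>\<^sub>E j\<in>{1..k}. E j x) \<and> v = (\<Sum>j=1..k. w j)"
    and E_inv: "\<And>x j. x \<in> \<Lambda> \<Longrightarrow> j \<in> {1..k} \<Longrightarrow> tangent_map A f x ` E j x = E j (f x)"
    and Cd: "0 < Cd" and \<eta>: "0 < \<eta>"
    and gap: "\<And>i. i \<in> {1..<k} \<Longrightarrow> lam (Suc i) < lam i \<and> \<eta> < (lam i - lam (Suc i)) / 100"
    and dominated: "\<And>x n j u. x \<in> \<Lambda> \<Longrightarrow> j \<in> {1..k} \<Longrightarrow> u \<in> E j x \<Longrightarrow> tnorm g x u = 1 \<Longrightarrow>
        inverse Cd * exp (real n * (lam j - \<eta>)) \<le> tnorm g ((f ^^ n) x) (tangent_map A (f ^^ n) x u) \<and>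
        tnorm g ((f ^^ n) x) (tangent_map A (f ^^ n) x u) \<le> Cd * exp (real n * (lam j + \<eta>))"
begin

abbreviation minorm :: "nat \<Rightarrow> nat \<Rightarrow> 'm \<Rightarrow> real" where
  "minorm n j x \<equiv> min_norm_on A g (f ^^ n) x (E j x)"

abbreviation Dn :: "nat \<Rightarrow> 'm \<Rightarrow> 'e \<Rightarrow> 'e" where
  "Dn n x \<equiv> tangent_map A (f ^^ n) x"

lemma Dn_linear: "linear (Dn n x)" by (rule tangent_map_linear[OF funpow_sd])

lemma unit_vector:
  assumes "x \<in> \<Lambda>" "j \<in> {1..k}"
  obtains v where "v \<in> E j x" "tnorm g x v = 1"
proof -
  have "E j x \<noteq> {0}"
  proof
    assume "E j x = {0}"
    then have "dim (E j x) = 0" by simp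
    then show False using E_dim[OF assms] m_pos[OF assms(2)] by linarith
  qed
  then obtain u where u: "u \<in> E j x" "u \<noteq> 0"
    using subspace_0[OF E_subspace[OF assms]] by blast
  then have "tnorm g x ((1 / tnorm g x u) *\<^sub>R u) = 1"
    using tnorm_pos[of u x] by (simp only: tnorm_scale) simp
  moreover have "(1 / tnorm g x u) *\<^sub>R u \<in> E j x"
    using subspace_scale[OF E_subspace[OF assms]] u(1) by blast
  ultimately show ?thesis using that by blast
qed

lemma minorm_lower:
  assumes "x \<in> \<Lambda>" "j \<in> {1..k}" "v \<in> E j x"
  shows "minorm n j x * tnorm g x v \<le> tnorm g ((f ^^ n) x) (Dn n x v)"
proof (cases "v = 0")
  case True
  then show ?thesis by (simp add: tnorm_zero tnorm_nonneg)
next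
  case False
  then have pos: "tnorm g x v > 0" by (rule tnorm_pos)
  define u where "u = (1 / tnorm g x v) *\<^sub>R v"
  have u: "u \<in> E j x" "tnorm g x u = 1"
    using subspace_scale[OF E_subspace[OF assms(1,2)] assms(3)] pos
    by (auto simp: u_def tnorm_scale)
  have "minorm n j x \<le> tnorm g ((f ^^ n) x) (Dn n x u)"
    unfolding min_norm_on_def using u
    by (intro cINF_lower bdd_belowI2[of _ 0]) (auto simp: tnorm_nonneg)
  also have "\<dots> = tnorm g ((f ^^ n) x) (Dn n x v) / tnorm g x v"
    using pos by (simp add: u_def linear_scale[OF Dn_linear] tnorm_scale)
  finally show ?thesis using pos by (simp add: field_simps)
qed

lemma minorm_greatest:
  assumes "x \<in> \<Lambda>" "j \<in> {1..k}"
    and "\<And>v. v \<in> E j x \<Longrightarrow> tnorm g x v = 1 \<Longrightarrow> b \<le> tnorm g ((f ^^ n) x) (Dn n x v)"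
  shows "b \<le> minorm n j x"
proof -
  obtain v where "v \<in> E j x" "tnorm g x v = 1" by (rule unit_vector[OF assms(1,2)])
  then show ?thesis unfolding min_norm_on_def using assms(3) by (intro cINF_greatest) auto
qed

lemma minorm_ge_power:
  assumes "x \<in> \<Lambda>" "j \<in> {1..k}"
  shows "\<kappa> ^ n \<le> minorm n j x"
proof (rule minorm_greatest[OF assms])
  fix v assume "tnorm g x v = 1"
  then show "\<kappa> ^ n \<le> tnorm g ((f ^^ n) x) (Dn n x v)"
    using expand_funpow[OF assms(1), of n v] by simp
qed

lemma minorm_ge_1: "x \<in> \<Lambda> \<Longrightarrow> j \<in> {1..k} \<Longrightarrow> 1 \<le> minorm n j x"
  using minorm_ge_power[of x j n] one_le_power[of \<kappa> n] \<kappa> by linarith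

lemma minorm_bounded: "\<exists>B\<ge>1. \<forall>x\<in>\<Lambda>. \<forall>j\<in>{1..k}. minorm n j x \<le> B"
proof -
  obtain B where B: "B \<ge> 1" "\<And>x v. tnorm g ((f ^^ n) x) (Dn n x v) \<le> B * tnorm g x v"
    using tangent_map_bounded[OF funpow_cont funpow_sd] by blast
  have "minorm n j x \<le> B" if xj: "x \<in> \<Lambda>" "j \<in> {1..k}" for x j
  proof -
    obtain v where v: "v \<in> E j x" "tnorm g x v = 1" by (rule unit_vector[OF xj])
    then show ?thesis using minorm_lower[OF xj v(1), of n] B(2)[of x v] by simp
  qed
  then show ?thesis using B(1) by blast
qed

lemma E_inv_funpow:
  assumes "x \<in> \<Lambda>" "j \<in> {1..k}" "v \<in> E j x"
  shows "Dn n x v \<in> E j ((f ^^ n) x)"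
proof (induction n)
  case 0
  then show ?case unfolding tangent_map_0 using assms(3) by simp
next
  case (Suc n)
  then have "tangent_map A f ((f ^^ n) x) (Dn n x v) \<in> E j (f ((f ^^ n) x))"
    using E_inv[OF funpow_\<Lambda>[OF assms(1)] assms(2)] by blast
  then show ?case unfolding tangent_map_Suc by simp
qed

lemma dominated_scaled:
  assumes "x \<in> \<Lambda>" "j \<in> {1..k}" "u \<in> E j x"
  shows "inverse Cd * exp (real n * (lam j - \<eta>)) * tnorm g x u \<le> tnorm g ((f ^^ n) x) (Dn n x u)"
    and "tnorm g ((f ^^ n) x) (Dn n x u) \<le> Cd * exp (real n * (lam j + \<eta>)) * tnorm g x u"
proof -
  have "inverse Cd * exp (real n * (lam j - \<eta>)) * tnorm g x u \<le> tnorm g ((f ^^ n) x) (Dn n x u) \<and>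
     tnorm g ((f ^^ n) x) (Dn n x u) \<le> Cd * exp (real n * (lam j + \<eta>)) * tnorm g x u"
  proof (cases "u = 0")
    case True
    then show ?thesis using linear_0[OF Dn_linear] by (simp add: tnorm_zero)
  next
    case False
    then have pos: "tnorm g x u > 0" by (rule tnorm_pos)
    define v where "v = (1 / tnorm g x u) *\<^sub>R u"
    have v: "v \<in> E j x" "tnorm g x v = 1"
      using subspace_scale[OF E_subspace[OF assms(1,2)] assms(3)] pos by (auto simp: v_def tnorm_scale)
    have "tnorm g ((f ^^ n) x) (Dn n x v) = tnorm g ((f ^^ n) x) (Dn n x u) / tnorm g x u"
      using pos by (simp add: v_def linear_scale[OF Dn_linear] tnorm_scale)
    then show ?thesis using dominated[OF assms(1,2) v, of n] pos
      by (simp add: pos_le_divide_eq pos_divide_le_eq)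
  qed
  then show "inverse Cd * exp (real n * (lam j - \<eta>)) * tnorm g x u \<le> tnorm g ((f ^^ n) x) (Dn n x u)"
    "tnorm g ((f ^^ n) x) (Dn n x u) \<le> Cd * exp (real n * (lam j + \<eta>)) * tnorm g x u" by auto
qed

section \<open>Consequences of domination: ordered minimum norms and bounded components\<close>

lemma lam_antimono:
  assumes "1 \<le> i" "i \<le> j" "j \<le> k"
  shows "lam j \<le> lam i"
  using assms(2,1,3)
proof (induction rule: dec_induct)
  case (step n)
  then show ?case using gap[of n] by fastforce
qed auto

lemma lam_gap:
  assumes "1 \<le> i" "i < j" "j \<le> k"
  shows "lam j + 100 * \<eta> < lam i"
  using gap[of i] lam_antimono[of "Suc i" j] assms by fastforce

lemma exp_unbounded:
  fixes a b :: real assumes "0 < a"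
  shows "\<exists>N. \<forall>n\<ge>N. b \<le> exp (real n * a)"
proof -
  obtain N where N: "b / a < real N" using reals_Archimedean2 by blast
  have "b \<le> exp (real n * a)" if "n \<ge> N" for n
  proof -
    have "b = b / a * a" using assms by simp
    also have "\<dots> \<le> real n * a" using N that assms by (intro mult_right_mono) auto
    also have "\<dots> \<le> exp (real n * a)" using exp_ge_add_one_self[of "real n * a"] by linarith
    finally show ?thesis .
  qed
  then show ?thesis by blast
qed

text \<open>Between the upper rate of the weaker bundle and the lower rate of the stronger one, the
  gap of \<open>100 * \<eta>\<close> minus two errors \<open>\<eta>\<close> leaves
  \<open>98 * \<eta>\<close> to absorb \<open>Cd * Cd\<close>; hence the ordering is claimed for
  large \<open>n\<close> only.\<close>

lemma minorm_ordered:
  "\<exists>N. \<forall>n\<ge>N. \<forall>x\<in>\<Lambda>. \<forall>i j. 1 \<le> i \<longrightarrow> i \<le> j \<longrightarrow> j \<le> k \<longrightarrow> minorm n j x \<le> minorm n i x"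
proof -
  obtain N where N: "\<And>n. n \<ge> N \<Longrightarrow> Cd * Cd \<le> exp (real n * (98 * \<eta>))"
    using exp_unbounded[of "98 * \<eta>" "Cd * Cd"] \<eta> by auto
  have "minorm n j x \<le> minorm n i x" if n: "n \<ge> N" and x: "x \<in> \<Lambda>" and ij: "1 \<le> i" "i \<le> j" "j \<le> k" for n x i j
  proof (cases "i = j")
    case False
    have i: "i \<in> {1..k}" and j: "j \<in> {1..k}" using ij by auto
    obtain v where v: "v \<in> E j x" "tnorm g x v = 1" by (rule unit_vector[OF x j])
    have "minorm n j x \<le> tnorm g ((f ^^ n) x) (Dn n x v)" using minorm_lower[OF x j v(1), of n] v(2) by simp
    also have "\<dots> \<le> Cd * exp (real n * (lam j + \<eta>))" using dominated[OF x j v] by blast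
    also have "\<dots> \<le> inverse Cd * exp (real n * (lam i - \<eta>))"
    proof -
      have "Cd * Cd * exp (real n * (lam j + \<eta>)) \<le> exp (real n * (98 * \<eta>)) * exp (real n * (lam j + \<eta>))"
        by (intro mult_right_mono N n) auto
      also have "\<dots> = exp (real n * (lam j + 99 * \<eta>))" by (simp add: mult_exp_exp algebra_simps)
      also have "\<dots> \<le> exp (real n * (lam i - \<eta>))"
        using lam_gap[of i j] ij False by (simp add: mult_left_mono)
      finally show ?thesis using Cd by (simp add: field_simps)
    qed
    also have "\<dots> \<le> minorm n i x" by (rule minorm_greatest[OF x i]) (use dominated[OF x i] in blast)
    finally show ?thesis .
  qed simp
  then show ?thesis by blast
qed

text \<open>Two vectors from different bundles that were almost parallel would have to grow at almost the
  same rate for a long time; hence the domination alone bounds the components.\<close>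

lemma partial_components_bounded:
  assumes "1 \<le> i" "i \<le> k"
  shows "\<exists>C\<ge>1. \<forall>x\<in>\<Lambda>. \<forall>u. (\<forall>j\<in>{i..k}. u j \<in> E j x) \<longrightarrow>
     (\<forall>j\<in>{i..k}. tnorm g x (u j) \<le> C * tnorm g x (\<Sum>j=i..k. u j))"
  using assms(2,1)
\<comment> \<open>Downward induction from the weakest bundle; each step adjoins a bundle that grows
  faster than all previous ones.\<close>
proof (induction rule: inc_induct)
  case base
  then show ?case by (intro exI[of _ 1]) auto
next
  case (step i)
  then have ik: "i \<in> {1..k}" by auto
  obtain C where C: "C \<ge> 1" "\<And>x u j. x \<in> \<Lambda> \<Longrightarrow> (\<forall>j\<in>{Suc i..k}. u j \<in> E j x) \<Longrightarrow> j \<in> {Suc i..k} \<Longrightarrow>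
      tnorm g x (u j) \<le> C * tnorm g x (\<Sum>j=Suc i..k. u j)"
    using step.IH step.prems by auto
  have "lam i - lam (Suc i) - 2 * \<eta> > 0" using lam_gap[of i "Suc i"] step \<eta> by auto
  \<comment> \<open>So large that \<open>f ^^ n\<close> stretches \<open>E i\<close> by at least
    \<open>2 * b\<close>, where \<open>b\<close> bounds the stretching of any sum \<open>v'\<close>
    from the later bundles.\<close>
  then obtain n where n: "2 * real k * Cd * Cd * C \<le> exp (real n * (lam i - lam (Suc i) - 2 * \<eta>))"
    using exp_unbounded by blast
  define b where "b = real k * Cd * C * exp (real n * (lam (Suc i) + \<eta>))"
  have b: "b > 0" using k Cd C(1) by (simp add: b_def)
  have "Cd * (2 * b) = (2 * real k * Cd * Cd * C) * exp (real n * (lam (Suc i) + \<eta>))" by (simp add: b_def)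
  also have "\<dots> \<le> exp (real n * (lam i - lam (Suc i) - 2 * \<eta>)) * exp (real n * (lam (Suc i) + \<eta>))"
    by (intro mult_right_mono n) auto
  also have "\<dots> = exp (real n * (lam i - \<eta>))" by (simp add: mult_exp_exp algebra_simps)
  finally have b2: "2 * b \<le> inverse Cd * exp (real n * (lam i - \<eta>))" using Cd by (simp add: field_simps)
  obtain B where B: "B \<ge> 1" "\<And>x v. tnorm g ((f ^^ n) x) (Dn n x v) \<le> B * tnorm g x v"
    using tangent_map_bounded[OF funpow_cont funpow_sd] by blast
  show ?case
  \<comment> \<open>\<open>u i\<close> grows by at least \<open>2 * b\<close>, \<open>v'\<close> by
    at most \<open>b\<close> and the total by at most \<open>B\<close>, which bounds
    \<open>u i\<close> with the factor \<open>B / b + 1\<close>. The triangle inequality adds 1 for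
    \<open>v'\<close>, and \<open>C\<close> passes from \<open>v'\<close> to its components.\<close>
  proof (intro exI[of _ "C * (B / b + 2)"] conjI ballI allI impI)
    have "1 * 1 \<le> C * (B / b + 2)" using C(1) B(1) b by (intro mult_mono) auto
    then show "1 \<le> C * (B / b + 2)" by simp
    fix x u j assume x: "x \<in> \<Lambda>" and u: "\<forall>j\<in>{i..k}. u j \<in> E j x" and j: "j \<in> {i..k}"
    define v' where "v' = (\<Sum>j=Suc i..k. u j)"
    define v where "v = (\<Sum>j=i..k. u j)"
    have v: "v = u i + v'" using ik by (simp add: v_def v'_def sum.atLeast_Suc_atMost)
    have u': "\<forall>j\<in>{Suc i..k}. u j \<in> E j x" using u by auto
    have v'u: "tnorm g x (u j) \<le> C * tnorm g x v'" if "j \<in> {Suc i..k}" for j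
      unfolding v'_def by (rule C(2)[OF x u' that])
    have Tv': "tnorm g ((f ^^ n) x) (Dn n x v') \<le> b * tnorm g x v'"
    proof -
      have "tnorm g ((f ^^ n) x) (Dn n x v') \<le> (\<Sum>j=Suc i..k. tnorm g ((f ^^ n) x) (Dn n x (u j)))"
        unfolding v'_def linear_sum[OF Dn_linear] by (rule tnorm_sum)
      also have "\<dots> \<le> (\<Sum>j=Suc i..k. Cd * exp (real n * (lam (Suc i) + \<eta>)) * (C * tnorm g x v'))"
      proof (rule sum_mono)
        fix j assume j: "j \<in> {Suc i..k}"
        have "tnorm g ((f ^^ n) x) (Dn n x (u j)) \<le> Cd * exp (real n * (lam j + \<eta>)) * tnorm g x (u j)"
          using u' j ik by (intro dominated_scaled(2) x) auto
        also have "\<dots> \<le> Cd * exp (real n * (lam (Suc i) + \<eta>)) * (C * tnorm g x v')"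
          using lam_antimono[of "Suc i" j] j Cd
          by (intro mult_mono v'u mult_left_mono) (auto simp: tnorm_nonneg mult_left_mono)
        finally show "tnorm g ((f ^^ n) x) (Dn n x (u j)) \<le>
          Cd * exp (real n * (lam (Suc i) + \<eta>)) * (C * tnorm g x v')" .
      qed
      also have "\<dots> = real (card {Suc i..k}) * (Cd * exp (real n * (lam (Suc i) + \<eta>)) * (C * tnorm g x v'))"
        by simp
      also have "\<dots> \<le> real k * (Cd * exp (real n * (lam (Suc i) + \<eta>)) * (C * tnorm g x v'))"
        using Cd C(1) by (intro mult_right_mono) (auto simp: tnorm_nonneg)
      also have "\<dots> = b * tnorm g x v'" by (simp add: b_def)
      finally show ?thesis .
    qed
    have v'le: "tnorm g x v' \<le> tnorm g x v + tnorm g x (u i)"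
      using tnorm_triangle[of x v "- u i"] by (simp add: v tnorm_minus)
    have "2 * b * tnorm g x (u i) \<le> inverse Cd * exp (real n * (lam i - \<eta>)) * tnorm g x (u i)"
      using b2 by (intro mult_right_mono) (auto simp: tnorm_nonneg)
    also have "\<dots> \<le> tnorm g ((f ^^ n) x) (Dn n x (u i))"
      using u ik by (intro dominated_scaled(1) x) auto
    also have "Dn n x (u i) = Dn n x v + - Dn n x v'"
      by (simp add: v linear_add[OF Dn_linear])
    also have "tnorm g ((f ^^ n) x) (Dn n x v + - Dn n x v') \<le> B * tnorm g x v + b * tnorm g x v'"
      using tnorm_triangle[of "(f ^^ n) x" "Dn n x v" "- Dn n x v'"] B(2)[of x v] Tv' by (simp add: tnorm_minus)
    also have "b * tnorm g x v' \<le> b * (tnorm g x v + tnorm g x (u i))" using b v'le by simp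
    finally have "b * tnorm g x (u i) \<le> (B + b) * tnorm g x v" by (simp add: algebra_simps)
    then have ui: "tnorm g x (u i) \<le> (B / b + 1) * tnorm g x v" using b by (simp add: field_simps)
    have "tnorm g x v' \<le> (B / b + 2) * tnorm g x v" using v'le ui by (simp add: algebra_simps)
    then have Cv': "C * tnorm g x v' \<le> C * (B / b + 2) * tnorm g x v" using C(1) by simp
    have "tnorm g x (u j) \<le> C * (B / b + 2) * tnorm g x v"
    proof (cases "j = i")
      case True
      have "(B / b + 1) * tnorm g x v \<le> C * (B / b + 2) * tnorm g x v"
      proof (intro mult_right_mono tnorm_nonneg)
        have "1 * (B / b + 1) \<le> C * (B / b + 2)" using C(1) B(1) b by (intro mult_mono) auto
        then show "B / b + 1 \<le> C * (B / b + 2)" by simp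
      qed
      then show ?thesis using ui True by simp
    next
      case False
      then show ?thesis using v'u[of j] j Cv' by auto
    qed
    then show "tnorm g x (u j) \<le> C * (B / b + 2) * tnorm g x (\<Sum>j=i..k. u j)" by (simp add: v_def)
  qed
qed

lemma components_bounded:
  obtains C where "C \<ge> 1"
    "\<And>x u j. x \<in> \<Lambda> \<Longrightarrow> (\<And>j. j \<in> {1..k} \<Longrightarrow> u j \<in> E j x) \<Longrightarrow> j \<in> {1..k} \<Longrightarrow>
       tnorm g x (u j) \<le> C * tnorm g x (\<Sum>j=1..k. u j)"
  using partial_components_bounded[of 1] k by auto

lemma components_exist:
  assumes "x \<in> \<Lambda>"
  obtains u where "\<And>j. j \<in> {1..k} \<Longrightarrow> u j \<in> E j x" "v = (\<Sum>j=1..k. u j)"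
  using ex1_implies_ex[OF E_direct[OF assms, of v]] by (auto simp: PiE_def Pi_def)

end

section \<open>Covers by small sets\<close>

lemma norm_le_sum_orthonormal:
  fixes x :: "'a::euclidean_space"
  assumes "finite B" "pairwise orthogonal B" "\<And>b. b \<in> B \<Longrightarrow> norm b = 1" "x \<in> span B"
  shows "norm x \<le> (\<Sum>b\<in>B. \<bar>x \<bullet> b\<bar>)"
proof -
  obtain q where q: "x = (\<Sum>b\<in>B. q b *\<^sub>R b)"
    using assms(4) unfolding span_finite[OF assms(1)] by auto
  have "x \<bullet> b = q b" if "b \<in> B" for b
  proof -
    have "x \<bullet> b = (\<Sum>b'\<in>B. q b' * (b' \<bullet> b))" by (simp add: q inner_sum_left)
    also have "\<dots> = (\<Sum>b'\<in>B. if b' = b then q b else 0)"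
    proof (rule sum.cong[OF refl])
      fix b' assume b': "b' \<in> B"
      show "q b' * (b' \<bullet> b) = (if b' = b then q b else 0)"
      proof (cases "b' = b")
        case True
        then show ?thesis using assms(3)[OF that] by (simp add: dot_square_norm)
      next
        case False
        then have "b' \<bullet> b = 0" using assms(2) b' that by (auto simp: pairwise_def orthogonal_def)
        then show ?thesis using False by simp
      qed
    qed
    also have "\<dots> = q b" using assms(1) that by simp
    finally show ?thesis .
  qed
  then have "x = (\<Sum>b\<in>B. (x \<bullet> b) *\<^sub>R b)" using q by (metis (no_types, lifting) sum.cong)
  then have "norm x \<le> (\<Sum>b\<in>B. norm ((x \<bullet> b) *\<^sub>R b))" by (metis norm_sum)
  also have "\<dots> = (\<Sum>b\<in>B. \<bar>x \<bullet> b\<bar>)" using assms(3) by simp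
  finally show ?thesis .
qed

text \<open>Points are labelled by the integer parts of their rescaled coordinates in an orthonormal
  basis of each \<open>F j\<close>; orthogonality is used within each \<open>F j\<close> only. Equal
  labels leave a difference of at most \<open>r / q\<close> in each of the \<open>q\<close>
  coordinates, and a coordinate bounded by \<open>R j\<close> takes at most
  \<open>2 * (q * R j / r) + 2\<close> labels. The map \<open>\<phi>\<close> starts from an abstract
  set \<open>W\<close>, so that the pieces can be sets of points of the manifold.\<close>

lemma parallelepiped_cover:
  fixes u :: "nat \<Rightarrow> 'w \<Rightarrow> 'a::euclidean_space" and \<phi> :: "'w \<Rightarrow> 'a" and m :: "nat \<Rightarrow> nat"
  assumes F: "\<And>j. j \<in> J \<Longrightarrow> subspace (F j)" "\<And>j. j \<in> J \<Longrightarrow> dim (F j) = m j"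
    and J: "finite J" and q: "q = (\<Sum>j\<in>J. m j)" "0 < q" and r: "0 < r"
    and u: "\<And>j y. j \<in> J \<Longrightarrow> y \<in> W \<Longrightarrow> u j y \<in> F j" "\<And>j y. j \<in> J \<Longrightarrow> y \<in> W \<Longrightarrow> norm (u j y) \<le> R j"
    and R: "\<And>j. j \<in> J \<Longrightarrow> 0 \<le> R j"
    and \<phi>: "\<And>y. y \<in> W \<Longrightarrow> \<phi> y = (\<Sum>j\<in>J. u j y)"
  shows "\<exists>\<C>. finite \<C> \<and> real (card \<C>) \<le> (\<Prod>j\<in>J. (2 * (real q * R j / r) + 2) ^ m j) \<and> W \<subseteq> \<Union>\<C> \<and>
     (\<forall>T\<in>\<C>. T \<subseteq> W \<and> (\<forall>y\<in>T. \<forall>z\<in>T. norm (\<phi> y - \<phi> z) \<le> r))"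
proof (cases "W = {}")
  case True
  then show ?thesis using R r by (intro exI[of _ "{}"]) (auto intro!: prod_nonneg)
next
  case False
  have "\<forall>j\<in>J. \<exists>B. B \<subseteq> F j \<and> pairwise orthogonal B \<and> (\<forall>b\<in>B. norm b = 1) \<and> finite B \<and> card B = m j \<and> span B = F j"
  proof
    fix j assume j: "j \<in> J"
    obtain B where "B \<subseteq> F j" "pairwise orthogonal B" "\<And>b. b \<in> B \<Longrightarrow> norm b = 1" "independent B"
      "card B = dim (F j)" "span B = F j"
      using orthonormal_basis_subspace[OF F(1)[OF j]] by metis
    then show "\<exists>B. B \<subseteq> F j \<and> pairwise orthogonal B \<and> (\<forall>b\<in>B. norm b = 1) \<and> finite B \<and> card B = m j \<and> span B = F j"
      using F(2)[OF j] independent_imp_finite[of B] by (intro exI[of _ B] conjI ballI) simp_all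
  qed
  from bchoice[OF this] obtain B where B: "\<And>j. j \<in> J \<Longrightarrow> pairwise orthogonal (B j)"
    "\<And>j b. j \<in> J \<Longrightarrow> b \<in> B j \<Longrightarrow> norm b = 1" "\<And>j. j \<in> J \<Longrightarrow> finite (B j)"
    "\<And>j. j \<in> J \<Longrightarrow> card (B j) = m j" "\<And>j. j \<in> J \<Longrightarrow> span (B j) = F j" by blast
  define s where "s y p = real q * (u (fst p) y \<bullet> snd p) / r" for y p
  define lab where "lab y = restrict (\<lambda>p. \<lfloor>s y p\<rfloor>) (Sigma J B)" for y
  define x where "x j = real q * R j / r" for j
  define L where "L = (\<Pi>\<^sub>E p\<in>Sigma J B. {\<lfloor>- x (fst p)\<rfloor>..\<lfloor>x (fst p)\<rfloor>})"
  have x0: "0 \<le> x j" if "j \<in> J" for j using R[OF that] r by (simp add: x_def)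
  have finS: "finite (Sigma J B)" using J B(3) by auto
  have labL: "lab y \<in> L" if y: "y \<in> W" for y
  proof -
    have "\<bar>s y p\<bar> \<le> x (fst p)" if p: "p \<in> Sigma J B" for p
    proof -
      have "\<bar>u (fst p) y \<bullet> snd p\<bar> \<le> norm (u (fst p) y) * norm (snd p)" by (rule Cauchy_Schwarz_ineq2)
      also have "\<dots> \<le> R (fst p)" using p B(2)[of "fst p" "snd p"] u(2)[of "fst p" y] y by auto
      finally have "real q * \<bar>u (fst p) y \<bullet> snd p\<bar> / r \<le> real q * R (fst p) / r"
        using r by (intro divide_right_mono mult_left_mono) auto
      then show ?thesis using r by (simp add: s_def x_def abs_mult)
    qed
    then have "- x (fst p) \<le> s y p \<and> s y p \<le> x (fst p)" if "p \<in> Sigma J B" for p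
      using that by (simp add: abs_le_iff minus_le_iff)
    then show ?thesis unfolding lab_def L_def by (auto intro!: floor_mono)
  qed
  have finL: "finite L" unfolding L_def by (intro finite_PiE finS) auto
  have cardL: "real (card L) \<le> (\<Prod>j\<in>J. (2 * x j + 2) ^ m j)"
  proof -
    have "real (card L) = (\<Prod>p\<in>Sigma J B. real (card {\<lfloor>- x (fst p)\<rfloor>..\<lfloor>x (fst p)\<rfloor>}))"
      unfolding L_def by (simp only: card_PiE[OF finS] of_nat_prod)
    also have "\<dots> \<le> (\<Prod>p\<in>Sigma J B. 2 * x (fst p) + 2)"
    proof (rule prod_mono, intro conjI)
      fix p assume "p \<in> Sigma J B"
      then have "0 \<le> x (fst p)" using x0 by auto
      then have "real (card {\<lfloor>- x (fst p)\<rfloor>..\<lfloor>x (fst p)\<rfloor>}) = real_of_int (\<lfloor>x (fst p)\<rfloor> - \<lfloor>- x (fst p)\<rfloor> + 1)"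
        using floor_mono[of "- x (fst p)" "x (fst p)"] by simp
      also have "\<dots> \<le> 2 * x (fst p) + 2" by (simp, linarith)
      finally show "real (card {\<lfloor>- x (fst p)\<rfloor>..\<lfloor>x (fst p)\<rfloor>}) \<le> 2 * x (fst p) + 2" .
    qed simp
    also have "\<dots> = (\<Prod>j\<in>J. \<Prod>b\<in>B j. 2 * x j + 2)"
      by (subst prod.Sigma) (use J B(3) in \<open>auto simp: case_prod_beta\<close>)
    also have "\<dots> = (\<Prod>j\<in>J. (2 * x j + 2) ^ m j)" using B(4) by simp
    finally show ?thesis .
  qed
  define \<C> where "\<C> = (\<lambda>l. {y \<in> W. lab y = l}) ` (lab ` W)"
  have labsub: "lab ` W \<subseteq> L" using labL by auto
  then have finW: "finite (lab ` W)" using finL finite_subset by blast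
  have "card \<C> \<le> card (lab ` W)" unfolding \<C>_def by (rule card_image_le[OF finW])
  also have "\<dots> \<le> card L" by (rule card_mono[OF finL labsub])
  finally have "real (card \<C>) \<le> (\<Prod>j\<in>J. (2 * x j + 2) ^ m j)" using cardL by linarith
  moreover have "norm (\<phi> y - \<phi> z) \<le> r" if yz: "y \<in> W" "z \<in> W" "lab y = lab z" for y z
  proof -
    have *: "\<bar>(u j y - u j z) \<bullet> b\<bar> \<le> r / real q" if jb: "j \<in> J" "b \<in> B j" for j b
    proof -
      have "\<lfloor>s y (j, b)\<rfloor> = \<lfloor>s z (j, b)\<rfloor>"
        using fun_cong[OF yz(3), of "(j, b)"] jb by (simp add: lab_def)
      then have "\<bar>s y (j, b) - s z (j, b)\<bar> \<le> 1" by linarith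
      moreover have "s y (j, b) - s z (j, b) = real q / r * ((u j y - u j z) \<bullet> b)"
        by (simp add: s_def inner_diff_left diff_divide_distrib right_diff_distrib)
      ultimately have "real q / r * \<bar>(u j y - u j z) \<bullet> b\<bar> \<le> 1" using q(2) r by (simp add: abs_mult)
      then show ?thesis using q(2) r by (simp add: field_simps)
    qed
    have "norm (u j y - u j z) \<le> real (m j) * (r / real q)" if j: "j \<in> J" for j
    proof -
      have "u j y - u j z \<in> span (B j)"
        using B(5)[OF j] u(1)[OF j] yz by (metis span_diff)
      then have "norm (u j y - u j z) \<le> (\<Sum>b\<in>B j. \<bar>(u j y - u j z) \<bullet> b\<bar>)"
        using B j by (intro norm_le_sum_orthonormal) auto
      also have "\<dots> \<le> (\<Sum>b\<in>B j. r / real q)" using * j by (intro sum_mono) auto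
      finally show ?thesis using B(4)[OF j] by simp
    qed
    then have "(\<Sum>j\<in>J. norm (u j y - u j z)) \<le> (\<Sum>j\<in>J. real (m j) * (r / real q))" by (rule sum_mono)
    also have "\<dots> = real q * (r / real q)" unfolding q(1) sum_distrib_right[symmetric] by simp
    also have "\<dots> = r" using q(2) by simp
    finally show ?thesis using norm_sum[of "\<lambda>j. u j y - u j z" J] yz by (simp add: \<phi> sum_subtractf)
  qed
  moreover have "finite \<C>" unfolding \<C>_def using finW by blast
  moreover have "W \<subseteq> \<Union>\<C>" by (auto simp: \<C>_def)
  ultimately show ?thesis by (intro exI[of _ \<C>]) (auto simp: \<C>_def x_def)
qed

section \<open>A finite net of charts with uniform norm constants\<close>

context compact_riem_mfd
begin

lemma finite_chart_net:
  "\<exists>I c1 c2. finite I \<and> 0 < c1 \<and> 0 < c2 \<and>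
     (\<forall>i\<in>I. case i of (c, a, r) \<Rightarrow> c \<in> A \<and> 0 < r \<and> cball a r \<subseteq> chart_map c ` chart_dom c \<and>
        (\<forall>p\<in>chart_dom c. chart_map c p \<in> cball a r \<longrightarrow> (\<forall>w. c1 * norm w \<le> tnorm g p (of_chart A c p w) \<and>
            tnorm g p (of_chart A c p w) \<le> c2 * norm w))) \<and>
     (\<forall>p. \<exists>i\<in>I. case i of (c, a, r) \<Rightarrow> p \<in> chart_ball c a r)"
proof -
  define N where "N c a r c1 c2 \<longleftrightarrow> c \<in> A \<and> 0 < r \<and> cball a r \<subseteq> chart_map c ` chart_dom c \<and> 0 < c1 \<and> 0 < c2 \<and>
        (\<forall>p\<in>chart_dom c. chart_map c p \<in> cball a r \<longrightarrow> (\<forall>w. c1 * norm w \<le> tnorm g p (of_chart A c p w) \<and>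
            tnorm g p (of_chart A c p w) \<le> c2 * norm w))" for c a and r c1 c2 :: real
  have "\<exists>r c1 c2. N (chart_at A p) (chart_map (chart_at A p) p) r c1 c2" for p
  proof -
    let ?c = "chart_at A p"
    note c = chart_at[of p]
    obtain r where r: "r > 0" "cball (chart_map ?c p) r \<subseteq> chart_map ?c ` chart_dom ?c"
      using chart_img_open[OF c(1)] c(2) open_contains_cball by blast
    then show ?thesis using chart_norm_bounds[OF c(1) compact_cball r(2)] c unfolding N_def by blast
  qed
  then have "\<forall>p. \<exists>r. \<exists>c1 c2. N (chart_at A p) (chart_map (chart_at A p) p) r c1 c2" by blast
  from choice[OF this] obtain r where
    "\<forall>p. \<exists>c1. \<exists>c2. N (chart_at A p) (chart_map (chart_at A p) p) (r p) c1 c2" ..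
  from choice[OF this] obtain c1 where
    "\<forall>p. \<exists>c2. N (chart_at A p) (chart_map (chart_at A p) p) (r p) (c1 p) c2" ..
  from choice[OF this] obtain c2 where
    N: "\<And>p. N (chart_at A p) (chart_map (chart_at A p) p) (r p) (c1 p) (c2 p)" by blast
  define U where "U p = chart_ball (chart_at A p) (chart_map (chart_at A p) p) (r p)" for p
  have rp: "r p > 0" "c1 p > 0" "c2 p > 0" for p using N[of p] unfolding N_def by auto
  obtain P where P: "finite P" "UNIV \<subseteq> (\<Union>p\<in>P. U p)"
  proof (rule compactE_image[OF compact_M, of UNIV U])
    show "open (U p)" for p unfolding U_def by (rule open_chart_ball[OF chart_at(1)])
    show "UNIV \<subseteq> (\<Union>p\<in>UNIV. U p)"
      using chart_at(2) rp(1) by (auto simp: U_def chart_ball_def)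
  qed auto
  define d1 where "d1 = Min (insert 1 (c1 ` P))"
  define d2 where "d2 = Max (insert 1 (c2 ` P))"
  have d: "0 < d1" "0 < d2" "\<And>p. p \<in> P \<Longrightarrow> d1 \<le> c1 p" "\<And>p. p \<in> P \<Longrightarrow> c2 p \<le> d2"
  proof -
    show "0 < d1" unfolding d1_def using P(1) rp by (subst Min_gr_iff) auto
    have "1 \<le> d2" unfolding d2_def using P(1) by (intro Max_ge) auto
    then show "0 < d2" by simp
  qed (use P(1) in \<open>auto simp: d1_def d2_def intro: Min_le Max_ge\<close>)
  define I where "I = (\<lambda>p. (chart_at A p, chart_map (chart_at A p) p, r p)) ` P"
  show ?thesis
  proof (rule exI[of _ I], rule exI[of _ d1], rule exI[of _ d2], intro conjI)
    show "finite I" using P(1) by (simp add: I_def)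
    show "\<forall>i\<in>I. case i of (c, a, r) \<Rightarrow> c \<in> A \<and> 0 < r \<and> cball a r \<subseteq> chart_map c ` chart_dom c \<and>
        (\<forall>p\<in>chart_dom c. chart_map c p \<in> cball a r \<longrightarrow> (\<forall>w. d1 * norm w \<le> tnorm g p (of_chart A c p w) \<and>
            tnorm g p (of_chart A c p w) \<le> d2 * norm w))"
    proof
      fix i assume "i \<in> I"
      then obtain p where p: "p \<in> P" and i: "i = (chart_at A p, chart_map (chart_at A p) p, r p)"
        by (auto simp: I_def)
      show "case i of (c, a, r) \<Rightarrow> c \<in> A \<and> 0 < r \<and> cball a r \<subseteq> chart_map c ` chart_dom c \<and>
        (\<forall>p\<in>chart_dom c. chart_map c p \<in> cball a r \<longrightarrow> (\<forall>w. d1 * norm w \<le> tnorm g p (of_chart A c p w) \<and>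
            tnorm g p (of_chart A c p w) \<le> d2 * norm w))"
        unfolding i prod.case
      proof (intro conjI ballI impI allI)
        show "chart_at A p \<in> A" "0 < r p" "cball (chart_map (chart_at A p) p) (r p) \<subseteq> chart_map (chart_at A p) ` chart_dom (chart_at A p)"
          using N[of p] unfolding N_def by blast+
        fix x w assume x: "x \<in> chart_dom (chart_at A p)"
          "chart_map (chart_at A p) x \<in> cball (chart_map (chart_at A p) p) (r p)"
        have b: "c1 p * norm w \<le> tnorm g x (of_chart A (chart_at A p) x w)"
           "tnorm g x (of_chart A (chart_at A p) x w) \<le> c2 p * norm w"
          using N[of p] x unfolding N_def by blast+
        show "d1 * norm w \<le> tnorm g x (of_chart A (chart_at A p) x w)"
          using b(1) mult_right_mono[OF d(3)[OF p] norm_ge_zero[of w]] by linarith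
        show "tnorm g x (of_chart A (chart_at A p) x w) \<le> d2 * norm w"
          using b(2) mult_right_mono[OF d(4)[OF p] norm_ge_zero[of w]] by linarith
      qed
    qed
    show "\<forall>p. \<exists>i\<in>I. case i of (c, a, r) \<Rightarrow> p \<in> chart_ball c a r"
      using P(2) by (fastforce simp: I_def U_def)
  qed (use d in auto)
qed

end

text \<open>The net is fixed before \<open>N\<close>, so that \<open>c1\<close>, \<open>c2\<close>
  and with them the covering constant do not depend on the number of iterates.\<close>

locale charted_repeller = split_expanding A g f \<Lambda> \<kappa> k E m lam Cd \<eta>
  for A :: "('m::t2_space, 'e::euclidean_space) chart set" and g :: "'m \<Rightarrow> 'e \<Rightarrow> 'e \<Rightarrow> real"
    and f :: "'m \<Rightarrow> 'm" and \<Lambda> :: "'m set" and \<kappa> :: real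
    and k :: nat and E :: "nat \<Rightarrow> 'm \<Rightarrow> 'e set" and m :: "nat \<Rightarrow> nat"
    and lam :: "nat \<Rightarrow> real" and Cd \<eta> :: real +
  fixes I :: "(('m, 'e) chart \<times> 'e \<times> real) set" and c1 c2 :: real
  assumes I: "finite I" and c12: "0 < c1" "0 < c2"
    and net: "\<And>c a r. (c, a, r) \<in> I \<Longrightarrow> c \<in> A \<and> 0 < r \<and> cball a r \<subseteq> chart_map c ` chart_dom c"
    and net_norm: "\<And>c a r p w. (c, a, r) \<in> I \<Longrightarrow> p \<in> chart_dom c \<Longrightarrow> chart_map c p \<in> cball a r \<Longrightarrow>
        c1 * norm w \<le> tnorm g p (of_chart A c p w) \<and> tnorm g p (of_chart A c p w) \<le> c2 * norm w"
    and net_cover: "\<And>p. \<exists>c a r. (c, a, r) \<in> I \<and> p \<in> chart_ball c a r"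
begin

text \<open>The chart is part of the notion: the step for \<open>f\<^sup>N\<close> is linearized at one base point of a whole
  cell, so all pieces covering the cell have to be measured in the same chart.\<close>

definition csmall :: "('m, 'e) chart \<times> 'e \<times> real \<Rightarrow> real \<Rightarrow> 'm set \<Rightarrow> bool" where
  "csmall i \<rho> S \<longleftrightarrow> i \<in> I \<and> S \<subseteq> \<Lambda> \<and> S \<subseteq> chart_ball (fst i) (fst (snd i)) (snd (snd i)) \<and>
     (\<forall>y\<in>S. \<forall>z\<in>S. norm (chart_map (fst i) y - chart_map (fst i) z) \<le> \<rho>)"

lemma csmall_mono: "csmall i \<rho> S \<Longrightarrow> \<rho> \<le> \<rho>' \<Longrightarrow> csmall i \<rho>' S"
  unfolding csmall_def by (meson order_trans)

lemma csmall_subset: "csmall i \<rho> S \<Longrightarrow> T \<subseteq> S \<Longrightarrow> csmall i \<rho> T"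
  unfolding csmall_def by (meson order_trans subsetD)

text \<open>In each closed chart ball the pairs outside \<open>G\<close> form a compact set off the
  diagonal, on which the coordinate distance has a positive minimum; the net is finite.\<close>

lemma csmall_entourage:
  assumes G: "open G" "\<And>p. (p, p) \<in> G"
  shows "\<exists>\<rho>>0. \<forall>i S y z. csmall i \<rho> S \<longrightarrow> y \<in> S \<longrightarrow> z \<in> S \<longrightarrow> (y, z) \<in> G"
proof -
  have one: "\<exists>\<rho>>0. \<forall>y\<in>chart_ball c a r. \<forall>z\<in>chart_ball c a r. norm (chart_map c y - chart_map c z) \<le> \<rho> \<longrightarrow> (y, z) \<in> G"
    if i: "(c, a, r) \<in> I" for c a r
  proof -
    have c: "c \<in> A" "cball a r \<subseteq> chart_map c ` chart_dom c" using net[OF i] by auto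
    define Kc where "Kc = chart_inv c ` cball a r"
    have Kc: "compact Kc" "Kc \<subseteq> chart_dom c"
      unfolding Kc_def using chart_inv_in[OF c(1)] c(2)
      by (auto intro!: compact_continuous_image continuous_on_subset[OF chart_inv_cont[OF c(1)] c(2)])
    have inK: "chart_ball c a r \<subseteq> Kc"
    proof
      fix x assume "x \<in> chart_ball c a r"
      then have "x \<in> chart_dom c" "chart_map c x \<in> cball a r" by (auto simp: chart_ball_def)
      then show "x \<in> Kc" unfolding Kc_def using chart_inv_map[OF c(1)] by (metis imageI)
    qed
    define Z where "Z = Kc \<times> Kc - G"
    have Z: "compact Z" unfolding Z_def by (intro compact_diff compact_Times Kc G)
    have cont: "continuous_on Z (\<lambda>q. norm (chart_map c (fst q) - chart_map c (snd q)))"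
      using Kc(2) by (intro continuous_intros continuous_on_compose2[OF chart_map_cont[OF c(1)]]) (auto simp: Z_def)
    show ?thesis
    proof (cases "Z = {}")
      case True
      then show ?thesis using inK unfolding Z_def by (intro exI[of _ 1]) auto
    next
      case False
      obtain q where q: "q \<in> Z" "\<And>q'. q' \<in> Z \<Longrightarrow> norm (chart_map c (fst q) - chart_map c (snd q))
          \<le> norm (chart_map c (fst q') - chart_map c (snd q'))"
        using continuous_attains_inf[OF Z False cont] by blast
      define d where "d = norm (chart_map c (fst q) - chart_map c (snd q))"
      have "fst q \<noteq> snd q" using q(1) G(2) by (cases q) (auto simp: Z_def)
      moreover have "fst q \<in> chart_dom c" "snd q \<in> chart_dom c" using q(1) Kc(2) by (auto simp: Z_def)
      ultimately have "d > 0" using chart_map_inj[OF c(1)] by (auto simp: d_def)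
      moreover have "(y, z) \<in> G" if "y \<in> chart_ball c a r" "z \<in> chart_ball c a r"
        "norm (chart_map c y - chart_map c z) \<le> d / 2" for y z
        using q(2)[of "(y, z)"] that inK \<open>d > 0\<close> unfolding d_def[symmetric] by (force simp: Z_def)
      ultimately show ?thesis by (intro exI[of _ "d / 2"]) auto
    qed
  qed
  define Q where "Q i \<rho> \<longleftrightarrow> (\<forall>y\<in>chart_ball (fst i) (fst (snd i)) (snd (snd i)). \<forall>z\<in>chart_ball (fst i) (fst (snd i)) (snd (snd i)).
     norm (chart_map (fst i) y - chart_map (fst i) z) \<le> \<rho> \<longrightarrow> (y, z) \<in> G)"
    for i :: "('m, 'e) chart \<times> 'e \<times> real" and \<rho> :: real
  have "\<forall>i\<in>I. \<exists>\<rho>>0. Q i \<rho>" using one unfolding Q_def by fastforce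
  from bchoice[OF this] obtain \<rho> where \<rho>: "\<And>i. i \<in> I \<Longrightarrow> \<rho> i > 0" "\<And>i. i \<in> I \<Longrightarrow> Q i (\<rho> i)" by blast
  define \<rho>0 where "\<rho>0 = Min (insert 1 (\<rho> ` I))"
  have "\<rho>0 > 0" unfolding \<rho>0_def using I \<rho>(1) by (subst Min_gr_iff) auto
  moreover have "(y, z) \<in> G" if sm: "csmall i \<rho>0 S" and yz: "y \<in> S" "z \<in> S" for i S y z
  proof -
    have i: "i \<in> I" "S \<subseteq> chart_ball (fst i) (fst (snd i)) (snd (snd i))"
       "\<forall>y\<in>S. \<forall>z\<in>S. norm (chart_map (fst i) y - chart_map (fst i) z) \<le> \<rho>0" using sm unfolding csmall_def by blast+
    have "\<rho>0 \<le> \<rho> i" unfolding \<rho>0_def using I i(1) by (intro Min_le) auto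
    then have "norm (chart_map (fst i) y - chart_map (fst i) z) \<le> \<rho> i" using i(3) yz order_trans by blast
    then show ?thesis using \<rho>(2)[OF i(1)] i(2) yz unfolding Q_def by auto
  qed
  ultimately show ?thesis by blast
qed

lemma finite_csmall_cover:
  assumes "0 < \<rho>"
  shows "\<exists>\<U>. finite \<U> \<and> \<Lambda> \<subseteq> \<Union>\<U> \<and> (\<forall>S\<in>\<U>. \<exists>i. csmall i \<rho> S)"
proof -
  have "\<exists>W. open W \<and> p \<in> W \<and> (\<exists>i. csmall i \<rho> (\<Lambda> \<inter> W))" for p
  proof -
    obtain c a r where i: "(c, a, r) \<in> I" "p \<in> chart_ball c a r" using net_cover by blast
    have c: "c \<in> A" using net[OF i(1)] by blast
    define W where "W = chart_ball c a r \<inter> chart_ball c (chart_map c p) (\<rho> / 2)"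
    have "open W" unfolding W_def by (intro open_Int open_chart_ball c)
    moreover have "p \<in> W" using i(2) assms by (auto simp: W_def chart_ball_def)
    moreover have "norm (chart_map c y - chart_map c z) \<le> \<rho>" if "y \<in> W" "z \<in> W" for y z
    proof -
      have "dist (chart_map c p) (chart_map c y) < \<rho> / 2" "dist (chart_map c p) (chart_map c z) < \<rho> / 2"
        using that by (auto simp: W_def chart_ball_def)
      then show ?thesis using dist_triangle3[of "chart_map c y" "chart_map c z" "chart_map c p"]
        by (simp add: dist_norm)
    qed
    then have "csmall (c, a, r) \<rho> (\<Lambda> \<inter> W)" using i(1) unfolding csmall_def by (auto simp: W_def)
    ultimately show ?thesis by blast
  qed
  then have "\<forall>p. \<exists>W. open W \<and> p \<in> W \<and> (\<exists>i. csmall i \<rho> (\<Lambda> \<inter> W))" by blast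
  from choice[OF this] obtain W where W: "\<And>p. open (W p)" "\<And>p. p \<in> W p"
    "\<And>p. \<exists>i. csmall i \<rho> (\<Lambda> \<inter> W p)" by blast
  obtain P where P: "finite P" "\<Lambda> \<subseteq> (\<Union>p\<in>P. W p)"
  proof (rule compactE_image[OF compact_\<Lambda>, of \<Lambda> W])
    show "\<Lambda> \<subseteq> (\<Union>p\<in>\<Lambda>. W p)" using W(2) by blast
  qed (use W(1) in auto)
  show ?thesis
    using P W(3) by (intro exI[of _ "(\<lambda>p. \<Lambda> \<inter> W p) ` P"]) auto
qed

section \<open>The linear step\<close>

text \<open>\<open>w\<close> stands for the coordinate displacement of two points, \<open>v\<close>
  for that of their images. In the Riemannian norm the linearization error amounts to at most
  \<open>c1 / 2 * norm w\<close>, which expansion absorbs. The second bound keeps preimages no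
  larger than their images once \<open>\<kappa> ^ N\<close> is large.\<close>

lemma linear_step:
  assumes x: "x \<in> \<Lambda>" "x \<in> chart_ball c a r" "(f ^^ N) x \<in> chart_ball c' a' r'"
    and I': "(c, a, r) \<in> I" "(c', a', r') \<in> I"
    and v: "norm v \<le> \<rho>" "norm (v - chart_deriv (f ^^ N) c c' x w) \<le> c1 / (2 * c2) * norm w"
  shows "tnorm g ((f ^^ N) x) (Dn N x (of_chart A c x w)) \<le> 2 * c2 * \<rho>"
    and "(\<kappa> ^ N - 1 / 2) * c1 * norm w \<le> c2 * \<rho>"
proof -
  let ?F = "f ^^ N" and ?v = "of_chart A c x w"
  have cA: "c \<in> A" "c' \<in> A" using net I' by auto
  have xc: "x \<in> chart_dom c" "chart_map c x \<in> cball a r"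
    using x(2) by (auto simp: chart_ball_def)
  have Fxc: "?F x \<in> chart_dom c'" "chart_map c' (?F x) \<in> cball a' r'"
    using x(3) by (auto simp: chart_ball_def)
  have D: "chart_deriv ?F c c' x w = to_chart A c' (?F x) (Dn N x ?v)"
    by (rule chart_deriv_eq[OF funpow_cont funpow_sd cA(1) xc(1) cA(2) Fxc(1)])
  have "norm (chart_deriv ?F c c' x w) \<le> \<rho> + c1 / (2 * c2) * norm w"
    using v by (smt (verit) norm_triangle_ineq2 norm_minus_commute)
  then have "c2 * norm (chart_deriv ?F c c' x w) \<le> c2 * (\<rho> + c1 / (2 * c2) * norm w)"
    using c12 by (intro mult_left_mono) auto
  also have "\<dots> = c2 * \<rho> + c1 / 2 * norm w" using c12 by (simp add: field_simps)
  finally have "c2 * norm (chart_deriv ?F c c' x w) \<le> c2 * \<rho> + c1 / 2 * norm w" .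
  moreover have "tnorm g (?F x) (Dn N x ?v) \<le> c2 * norm (chart_deriv ?F c c' x w)"
    using net_norm[OF I'(2) Fxc, of "chart_deriv ?F c c' x w"] of_to_chart[OF cA(2) Fxc(1)] D by simp
  ultimately have T: "tnorm g (?F x) (Dn N x ?v) \<le> c2 * \<rho> + c1 / 2 * norm w" by linarith
  have k1: "1 \<le> \<kappa> ^ N" using \<kappa> by (simp add: one_le_power)
  have "\<kappa> ^ N * (c1 * norm w) \<le> \<kappa> ^ N * tnorm g x ?v"
    using net_norm[OF I'(1) xc] k1 by (intro mult_left_mono) auto
  also have "\<dots> \<le> tnorm g (?F x) (Dn N x ?v)" by (rule expand_funpow[OF x(1)])
  finally have *: "\<kappa> ^ N * (c1 * norm w) \<le> c2 * \<rho> + c1 / 2 * norm w" using T by linarith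
  then show "(\<kappa> ^ N - 1 / 2) * c1 * norm w \<le> c2 * \<rho>" by (simp add: algebra_simps)
  have "1 * (c1 * norm w) \<le> \<kappa> ^ N * (c1 * norm w)" using k1 c12 by (intro mult_right_mono) auto
  then have "c1 / 2 * norm w \<le> c2 * \<rho>" using * by simp
  then show "tnorm g (?F x) (Dn N x ?v) \<le> 2 * c2 * \<rho>" using T by simp
qed

text \<open>The components are compared at the image point: the minimum norm bounds each component
  by its image, invariance keeps the images in the splitting, and \<open>Ca\<close> bounds them by
  the image of the whole displacement. So the sides are a constant free of \<open>N\<close> times
  \<open>\<rho> / M j\<close>. With mesh \<open>\<rho> / M i\<close> the bundles
  \<open>j \<le> i\<close> cost only a constant, since \<open>M i \<le> M j\<close> there.\<close>

lemma linear_step_cover: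
  assumes Ca: "1 \<le> Ca"
    "\<And>x u j. x \<in> \<Lambda> \<Longrightarrow> (\<And>j. j \<in> {1..k} \<Longrightarrow> u j \<in> E j x) \<Longrightarrow> j \<in> {1..k} \<Longrightarrow>
       tnorm g x (u j) \<le> Ca * tnorm g x (\<Sum>j=1..k. u j)"
    and q: "q = (\<Sum>j=1..k. m j)"
    and N: "\<And>i j. 1 \<le> i \<Longrightarrow> i \<le> j \<Longrightarrow> j \<le> k \<Longrightarrow> minorm N j x \<le> minorm N i x"
    and i: "i \<in> {1..k}" and \<rho>: "0 < \<rho>" and x: "x \<in> \<Lambda>" "x \<in> chart_ball c a r" "(f ^^ N) x \<in> chart_ball c' a' r'"
    and W: "W \<subseteq> \<Lambda>" "W \<subseteq> chart_ball c a r"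
    and c: "(c, a, r) \<in> I" and c': "(c', a', r') \<in> I"
    and diam: "\<And>y z. y \<in> W \<Longrightarrow> z \<in> W \<Longrightarrow>
       norm (chart_map c' ((f ^^ N) y) - chart_map c' ((f ^^ N) z)) \<le> \<rho>"
    and est: "\<And>y z. y \<in> W \<Longrightarrow> z \<in> W \<Longrightarrow>
       norm (chart_map c' ((f ^^ N) y) - chart_map c' ((f ^^ N) z)
          - chart_deriv (f ^^ N) c c' x (chart_map c y - chart_map c z))
         \<le> c1 / (2 * c2) * norm (chart_map c y - chart_map c z)"
  shows "\<exists>\<C>. finite \<C> \<and> real (card \<C>) \<le> (2 * (real q * (2 * Ca * c2 / c1)) + 2) ^ q *
       (\<Prod>j=i+1..k. (minorm N i x / minorm N j x) ^ m j) \<and> W \<subseteq> \<Union>\<C> \<and>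
       (\<forall>T\<in>\<C>. csmall (c, a, r) (\<rho> / minorm N i x) T)"
proof (cases "W = {}")
  case True
  have "0 \<le> minorm N j x" if "j \<in> {1..k}" for j using minorm_ge_1[OF x(1) that, of N] by linarith
  then show ?thesis using True i Ca(1) c12
    by (intro exI[of _ "{}"]) (auto intro!: prod_nonneg mult_nonneg_nonneg)
next
  case False
  then obtain y0 where y0: "y0 \<in> W" by blast
  let ?F = "f ^^ N" and ?M = "\<lambda>j. minorm N j x"
  define Q where "Q = 2 * Ca * c2 / c1"
  have Q: "0 < Q" using Ca(1) c12 by (simp add: Q_def)
  note x\<Lambda> = x(1)
  have cA: "c \<in> A" "c' \<in> A" using net[OF c] net[OF c'] by auto
  have xc: "x \<in> chart_dom c" "chart_map c x \<in> cball a r"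
    using x(2) by (auto simp: chart_ball_def)
  have M1: "1 \<le> ?M j" if "j \<in> {1..k}" for j using minorm_ge_1[OF x\<Lambda> that] .
  have lin_to: "linear (to_chart A c x)" by (rule to_chart_linear[OF cA(1) xc(1)])
  have lin_of: "linear (of_chart A c x)" by (rule of_chart_linear[OF cA(1) xc(1)])
  have inj_to: "inj (to_chart A c x)" using of_to_chart[OF cA(1) xc(1)] by (metis injI)
  \<comment> \<open>Displacements are taken from an arbitrary \<open>y0\<close> in \<open>W\<close>;
    the point \<open>x\<close> supplies the derivative and the splitting and may lie outside
    \<open>W\<close>.\<close>
  define \<phi> where "\<phi> y = chart_map c y - chart_map c y0" for y
  have "\<forall>y. \<exists>u. (\<forall>j\<in>{1..k}. u j \<in> E j x) \<and> of_chart A c x (\<phi> y) = (\<Sum>j=1..k. u j)"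
  proof
    fix y
    obtain u where "\<And>j. j \<in> {1..k} \<Longrightarrow> u j \<in> E j x" "of_chart A c x (\<phi> y) = (\<Sum>j=1..k. u j)"
      using components_exist[OF x\<Lambda>] by metis
    then show "\<exists>u. (\<forall>j\<in>{1..k}. u j \<in> E j x) \<and> of_chart A c x (\<phi> y) = (\<Sum>j=1..k. u j)" by blast
  qed
  from choice[OF this] obtain U where U: "\<And>y j. j \<in> {1..k} \<Longrightarrow> U y j \<in> E j x"
    "\<And>y. of_chart A c x (\<phi> y) = (\<Sum>j=1..k. U y j)" by blast
  define R where "R j = Q * \<rho> / ?M j" for j
  have bound: "norm (to_chart A c x (U y j)) \<le> R j" if y: "y \<in> W" and j: "j \<in> {1..k}" for y j
  proof -
    let ?v = "of_chart A c x (\<phi> y)"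
    have T2: "tnorm g (?F x) (Dn N x ?v) \<le> 2 * c2 * \<rho>"
      unfolding \<phi>_def by (rule linear_step(1)[OF x c c' diam[OF y y0] est[OF y y0]])
    have "?M j * tnorm g x (U y j) \<le> tnorm g (?F x) (Dn N x (U y j))"
      by (rule minorm_lower[OF x\<Lambda> j U(1)[OF j]])
    also have "\<dots> \<le> Ca * tnorm g (?F x) (\<Sum>j=1..k. Dn N x (U y j))"
      by (rule Ca(2)[OF funpow_\<Lambda>[OF x\<Lambda>] E_inv_funpow[OF x\<Lambda> _ U(1)] j])
    also have "(\<Sum>j=1..k. Dn N x (U y j)) = Dn N x ?v"
      unfolding U(2) linear_sum[OF Dn_linear] ..
    also have "Ca * tnorm g (?F x) (Dn N x ?v) \<le> Ca * (2 * c2 * \<rho>)"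
      using T2 Ca(1) by simp
    finally have *: "?M j * tnorm g x (U y j) \<le> Ca * (2 * c2 * \<rho>)" .
    have "c1 * norm (to_chart A c x (U y j)) \<le> tnorm g x (U y j)"
      using net_norm[OF c xc, of "to_chart A c x (U y j)"] of_to_chart[OF cA(1) xc(1)] by simp
    then have "?M j * (c1 * norm (to_chart A c x (U y j))) \<le> ?M j * tnorm g x (U y j)"
      using M1[OF j] by (intro mult_left_mono) auto
    then have "?M j * (c1 * norm (to_chart A c x (U y j))) \<le> Ca * (2 * c2 * \<rho>)" using * by linarith
    then show ?thesis using M1[OF j] c12 by (simp add: R_def Q_def field_simps)
  qed
  have "\<exists>\<C>. finite \<C> \<and> real (card \<C>) \<le> (\<Prod>j\<in>{1..k}. (2 * (real q * R j / (\<rho> / ?M i)) + 2) ^ m j) \<and> W \<subseteq> \<Union>\<C> \<and>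
     (\<forall>T\<in>\<C>. T \<subseteq> W \<and> (\<forall>y\<in>T. \<forall>z\<in>T. norm (\<phi> y - \<phi> z) \<le> \<rho> / ?M i))"
  proof (rule parallelepiped_cover[where F = "\<lambda>j. to_chart A c x ` E j x" and u = "\<lambda>j y. to_chart A c x (U y j)"])
    fix j assume j: "j \<in> {1..k}"
    show "subspace (to_chart A c x ` E j x)"
      by (rule linear_subspace_image[OF lin_to E_subspace[OF x\<Lambda> j]])
    show "dim (to_chart A c x ` E j x) = m j"
      using dim_image_eq[OF lin_to, of "E j x"] inj_to E_dim[OF x\<Lambda> j] by (metis inj_on_subset subset_UNIV)
    show "0 \<le> R j" using M1[OF j] Q \<rho> by (simp add: R_def)
  next
    show "0 < q" using q m_pos k by (auto intro!: sum_pos)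
    show "0 < \<rho> / ?M i" using \<rho> M1[OF i] by simp
    fix y assume "y \<in> W"
    have "\<phi> y = to_chart A c x (of_chart A c x (\<phi> y))" using of_to_chart[OF cA(1) xc(1)] by simp
    then show "\<phi> y = (\<Sum>j\<in>{1..k}. to_chart A c x (U y j))"
      by (simp add: U(2) linear_sum[OF lin_to])
  qed (use q U(1) bound in auto)
  then obtain \<C> where \<C>: "finite \<C>" "real (card \<C>) \<le> (\<Prod>j\<in>{1..k}. (2 * (real q * R j / (\<rho> / ?M i)) + 2) ^ m j)"
    "W \<subseteq> \<Union>\<C>" "\<forall>T\<in>\<C>. T \<subseteq> W \<and> (\<forall>y\<in>T. \<forall>z\<in>T. norm (\<phi> y - \<phi> z) \<le> \<rho> / ?M i)"
    by (elim exE conjE) (rule that)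
  define C0 where "C0 = 2 * (real q * Q) + 2"
  have C0: "1 \<le> C0" using Q by (simp add: C0_def)
  have "(\<Prod>j\<in>{1..k}. (2 * (real q * R j / (\<rho> / ?M i)) + 2) ^ m j) \<le>
     (\<Prod>j\<in>{1..k}. C0 ^ m j * (if i < j then (?M i / ?M j) ^ m j else 1))"
  proof (rule prod_mono, intro conjI)
    fix j assume j: "j \<in> {1..k}"
    have Mij: "?M i > 0" "?M j > 0" using M1[OF i] M1[OF j] by auto
    have eq: "real q * R j / (\<rho> / ?M i) = real q * Q * (?M i / ?M j)"
      using \<rho> Mij by (simp add: R_def field_simps)
    have nn: "0 \<le> real q * Q * (?M i / ?M j)" using Q Mij by simp
    have nn': "0 \<le> 2 * (real q * R j / (\<rho> / ?M i)) + 2" unfolding eq using nn by linarith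
    then show "0 \<le> (2 * (real q * R j / (\<rho> / ?M i)) + 2) ^ m j" by simp
    show "(2 * (real q * R j / (\<rho> / ?M i)) + 2) ^ m j \<le> C0 ^ m j * (if i < j then (?M i / ?M j) ^ m j else 1)"
    proof (cases "i < j")
      case True
      then have "?M j \<le> ?M i" using N[of i j] i j by auto
      then have 1: "1 \<le> ?M i / ?M j" using Mij by simp
      have "2 * (real q * R j / (\<rho> / ?M i)) + 2 \<le> C0 * (?M i / ?M j)"
        unfolding eq C0_def distrib_right mult.assoc using 1 by linarith
      then have "(2 * (real q * R j / (\<rho> / ?M i)) + 2) ^ m j \<le> (C0 * (?M i / ?M j)) ^ m j"
        by (intro power_mono nn')
      then show ?thesis using True by (simp only: power_mult_distrib if_True)
    next
      case False
      then have "?M i \<le> ?M j" using N[of j i] i j by auto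
      then have 1: "?M i / ?M j \<le> 1" using Mij by simp
      have "2 * (real q * R j / (\<rho> / ?M i)) + 2 \<le> C0"
        unfolding eq C0_def using mult_left_mono[OF 1, of "real q * Q"] Q by simp
      then have "(2 * (real q * R j / (\<rho> / ?M i)) + 2) ^ m j \<le> C0 ^ m j"
        by (intro power_mono nn')
      then show ?thesis using False by simp
    qed
  qed
  also have "\<dots> = C0 ^ q * (\<Prod>j\<in>{1..k}. if i < j then (?M i / ?M j) ^ m j else 1)"
    by (simp add: prod.distrib q power_sum)
  also have "(\<Prod>j\<in>{1..k}. if i < j then (?M i / ?M j) ^ m j else 1) = (\<Prod>j=i+1..k. (?M i / ?M j) ^ m j)"
    using i by (intro prod.mono_neutral_cong_right) auto
  finally have "real (card \<C>) \<le> C0 ^ q * (\<Prod>j=i+1..k. (?M i / ?M j) ^ m j)" using \<C>(2) by linarith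
  moreover have "csmall (c, a, r) (\<rho> / ?M i) T" if T: "T \<in> \<C>" for T
  proof -
    have "norm (chart_map c y - chart_map c z) \<le> \<rho> / ?M i" if "y \<in> T" "z \<in> T" for y z
      using \<C>(4) T that by (simp add: \<phi>_def)
    moreover have "T \<subseteq> W" using \<C>(4) T by blast
    ultimately show ?thesis using W c unfolding csmall_def by auto
  qed
  ultimately show ?thesis using \<C>(1,3) unfolding C0_def Q_def by (intro exI[of _ \<C>]) simp
qed

text \<open>If \<open>f ^^ N\<close> sends \<open>p\<close> outside the chart \<open>c'\<close>, it
  also sends nearby points outside the compact coordinate ball, and nothing is claimed there. This
  lets one neighbourhood of \<open>p\<close> serve every chart of the finite net.\<close>

lemma local_estimate:
  assumes \<tau>: "0 < \<tau>" and i: "(c, a, r) \<in> I" "p \<in> chart_ball c a r" and i': "(c', a', r') \<in> I"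
  shows "\<exists>W. open W \<and> p \<in> W \<and> (\<forall>x\<in>W. \<forall>y\<in>W. \<forall>z\<in>W. (f ^^ N) x \<in> chart_ball c' a' r' \<longrightarrow>
      norm (chart_map c' ((f ^^ N) y) - chart_map c' ((f ^^ N) z)
          - chart_deriv (f ^^ N) c c' x (chart_map c y - chart_map c z))
         \<le> \<tau> * norm (chart_map c y - chart_map c z))"
proof -
  let ?F = "f ^^ N"
  have c: "c \<in> A" "p \<in> chart_dom c" using net[OF i(1)] i(2) by (auto simp: chart_ball_def)
  have c': "c' \<in> A" "cball a' r' \<subseteq> chart_map c' ` chart_dom c'" using net[OF i'] by auto
  show ?thesis
  proof (cases "?F p \<in> chart_dom c'")
    case True
    obtain W where "open W" "p \<in> W" "W \<subseteq> chart_dom c" "?F ` W \<subseteq> chart_dom c'"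
      "\<forall>x\<in>W. \<forall>w. norm (chart_deriv ?F c c' x w - chart_deriv ?F c c' p w) \<le> \<tau> * norm w"
      "\<forall>x\<in>W. \<forall>y\<in>W. \<forall>z\<in>W.
       norm (chart_map c' (?F y) - chart_map c' (?F z) - chart_deriv ?F c c' x (chart_map c y - chart_map c z))
         \<le> \<tau> * norm (chart_map c y - chart_map c z)"
      by (rule chart_linearization[OF funpow_cont funpow_sd c c'(1) True \<tau>]) (rule that)
    then show ?thesis by (intro exI[of _ W]) blast
  next
    case False
    define K' where "K' = chart_inv c' ` cball a' r'"
    have "closed K'" unfolding K'_def
      by (intro compact_imp_closed compact_continuous_image continuous_on_subset[OF chart_inv_cont[OF c'(1)] c'(2)]) auto
    moreover have "?F p \<notin> K'" using False chart_inv_in[OF c'(1)] c'(2) by (auto simp: K'_def)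
    moreover have "chart_ball c' a' r' \<subseteq> K'"
    proof
      fix y assume "y \<in> chart_ball c' a' r'"
      then have "y \<in> chart_dom c'" "chart_map c' y \<in> cball a' r'" by (auto simp: chart_ball_def)
      then show "y \<in> K'" unfolding K'_def using chart_inv_map[OF c'(1)] by (metis imageI)
    qed
    ultimately show ?thesis
      by (intro exI[of _ "?F -` (- K')"]) (auto intro!: open_vimage funpow_cont)
  qed
qed

text \<open>One step back along a piece \<open>V\<close>: \<open>S\<close> is the coarse cell
  reached after \<open>N\<close> steps and the sets \<open>T\<close> are fine pieces of it. The
  chart \<open>i0\<close> is chosen before \<open>T\<close> and \<open>\<rho>\<close>, so the
  pulled-back fine pieces all lie in one chart, as the next step requires; \<open>x\<close> is an
  arbitrary base point.\<close>

definition pullback_bound :: "('m \<times> 'm) set \<Rightarrow> real \<Rightarrow> nat \<Rightarrow> nat \<Rightarrow> real \<Rightarrow> bool" where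
  "pullback_bound K C N i \<rho>0 \<longleftrightarrow> (\<forall>i' S V x. csmall i' \<rho>0 S \<longrightarrow> V \<subseteq> \<Lambda> \<longrightarrow>
     (\<forall>y\<in>V. \<forall>z\<in>V. \<forall>l<N. ((f ^^ l) y, (f ^^ l) z) \<in> K) \<longrightarrow> x \<in> V \<longrightarrow> (f ^^ N) x \<in> S \<longrightarrow>
     (\<exists>i0. csmall i0 \<rho>0 {y \<in> V. (f ^^ N) y \<in> S} \<and> (\<forall>T \<rho>. T \<subseteq> S \<longrightarrow> 0 < \<rho> \<longrightarrow> csmall i' \<rho> T \<longrightarrow>
       (\<exists>\<C>. finite \<C> \<and> real (card \<C>) \<le> C * (\<Prod>j=i+1..k. (minorm N i x / minorm N j x) ^ m j) \<and>
        {y \<in> V. (f ^^ N) y \<in> T} \<subseteq> \<Union>\<C> \<and> (\<forall>T'\<in>\<C>. csmall i0 (\<rho> / minorm N i x) T')))))"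

text \<open>\<open>C\<close> comes from the splitting and the net, before \<open>N\<close>. The
  scale \<open>\<rho>0\<close> depends on \<open>N\<close>: it makes \<open>S\<close> so small that
  the pulled-back cell lies in one neighbourhood where \<open>f ^^ N\<close> is linearized.\<close>

lemma pullback_cover:
  assumes K: "compact K" "\<forall>y z. (y, z) \<in> K \<longrightarrow> f y = f z \<longrightarrow> y = z"
  shows "\<exists>C\<ge>1. \<exists>N1. \<forall>N\<ge>N1. \<forall>i\<in>{1..k}. \<exists>\<rho>0>0. pullback_bound K C N i \<rho>0"
proof -
  have K2: "\<And>y z. (y, z) \<in> K \<Longrightarrow> f y = f z \<Longrightarrow> y = z" using K(2) by blast
  obtain Ca where Ca: "1 \<le> Ca"
    "\<And>x u j. x \<in> \<Lambda> \<Longrightarrow> (\<And>j. j \<in> {1..k} \<Longrightarrow> u j \<in> E j x) \<Longrightarrow> j \<in> {1..k} \<Longrightarrow>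
       tnorm g x (u j) \<le> Ca * tnorm g x (\<Sum>j=1..k. u j)"
    using components_bounded by blast
  obtain N1 where N1: "\<And>n x i j. n \<ge> N1 \<Longrightarrow> x \<in> \<Lambda> \<Longrightarrow> 1 \<le> i \<Longrightarrow> i \<le> j \<Longrightarrow> j \<le> k \<Longrightarrow> minorm n j x \<le> minorm n i x"
    using minorm_ordered by blast
  define q where "q = (\<Sum>j=1..k. m j)"
  define C where "C = (2 * (real q * (2 * Ca * c2 / c1)) + 2) ^ q"
  have "1 \<le> C" unfolding C_def using Ca(1) c12 by (intro one_le_power) simp
  \<comment> \<open>Ensures \<open>c2 \<le> (\<kappa> ^ N - 1 / 2) * c1\<close>, so that the
    preimage of a cell of size \<open>\<rho>0\<close> again has size at most \<open>\<rho>0\<close>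
    in its own chart; this closes the induction over itineraries.\<close>
  obtain N2 where N2: "c2 / c1 + 1 / 2 < \<kappa> ^ N2" using real_arch_pow[OF \<kappa>] by blast
  define \<tau> where "\<tau> = c1 / (2 * c2)"
  have \<tau>: "0 < \<tau>" using c12 by (simp add: \<tau>_def)
  have main: "\<exists>\<rho>0>0. pullback_bound K C N i \<rho>0"
    if N: "N \<ge> max N1 N2" and i: "i \<in> {1..k}" for N i
  proof -
    let ?F = "f ^^ N"
    define est where "est c c' x y z \<longleftrightarrow> norm (chart_map c' (?F y) - chart_map c' (?F z)
          - chart_deriv ?F c c' x (chart_map c y - chart_map c z)) \<le> \<tau> * norm (chart_map c y - chart_map c z)"
      for c c' :: "('m, 'e) chart" and x y z
    \<comment> \<open>One chart for the source and all charts of the net for the target, because the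
      chart of \<open>S\<close> is not known in advance.\<close>
    define good where "good p W \<longleftrightarrow> (\<exists>c a r. (c, a, r) \<in> I \<and> W \<subseteq> chart_ball c a r \<and>
       (\<forall>i'\<in>I. \<forall>x\<in>W. \<forall>y\<in>W. \<forall>z\<in>W. ?F x \<in> chart_ball (fst i') (fst (snd i')) (snd (snd i')) \<longrightarrow>
           est c (fst i') x y z))" for p :: 'm and W
    have "\<exists>W. open W \<and> p \<in> W \<and> good p W" for p
    proof -
      obtain c a r where c: "(c, a, r) \<in> I" "p \<in> chart_ball c a r" using net_cover by blast
      have "\<exists>W. open W \<and> p \<in> W \<and> (\<forall>x\<in>W. \<forall>y\<in>W. \<forall>z\<in>W.
          ?F x \<in> chart_ball (fst i') (fst (snd i')) (snd (snd i')) \<longrightarrow> est c (fst i') x y z)"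
        if "i' \<in> I" for i'
        using local_estimate[OF \<tau> c, of "fst i'" "fst (snd i')" "snd (snd i')" N] that
        unfolding est_def by simp
      then have "\<forall>i'\<in>I. \<exists>W. open W \<and> p \<in> W \<and> (\<forall>x\<in>W. \<forall>y\<in>W. \<forall>z\<in>W.
          ?F x \<in> chart_ball (fst i') (fst (snd i')) (snd (snd i')) \<longrightarrow> est c (fst i') x y z)" by blast
      from bchoice[OF this] obtain W where W: "\<And>i'. i' \<in> I \<Longrightarrow> open (W i')" "\<And>i'. i' \<in> I \<Longrightarrow> p \<in> W i'"
        "\<forall>i'\<in>I. \<forall>x\<in>W i'. \<forall>y\<in>W i'. \<forall>z\<in>W i'.
          ?F x \<in> chart_ball (fst i') (fst (snd i')) (snd (snd i')) \<longrightarrow> est c (fst i') x y z" by blast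
      define V where "V = chart_ball c a r \<inter> (\<Inter>i'\<in>I. W i')"
      have "open V" unfolding V_def
        using W(1) I net[OF c(1)] by (intro open_Int open_chart_ball open_INT) auto
      moreover have "p \<in> V" using c W(2) by (simp add: V_def)
      moreover have "good p V" unfolding good_def
      proof (intro exI[of _ c] exI[of _ a] exI[of _ r] conjI ballI impI)
        fix i' x y z assume *: "i' \<in> I" "x \<in> V" "y \<in> V" "z \<in> V"
          "?F x \<in> chart_ball (fst i') (fst (snd i')) (snd (snd i'))"
        then have "x \<in> W i'" "y \<in> W i'" "z \<in> W i'" by (auto simp: V_def)
        then show "est c (fst i') x y z" using W(3) *(1,5) by blast
      qed (use c in \<open>auto simp: V_def\<close>)
      ultimately show ?thesis by blast
    qed
    then have "\<forall>p. \<exists>W. open W \<and> p \<in> W \<and> good p W" by blast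
    from choice[OF this] obtain W where W: "\<And>p. open (W p)" "\<And>p. p \<in> W p" "\<And>p. good p (W p)" by blast
    obtain P G where P: "finite P" and G: "open G" "\<And>p. (p, p) \<in> G"
      "\<And>x. x \<in> \<Lambda> \<Longrightarrow> \<exists>p\<in>P. \<forall>z. (x, z) \<in> G \<longrightarrow> z \<in> W p"
      using lebesgue_entourage[OF compact_\<Lambda> W(1,2)] by blast
    obtain H where H: "open H" "\<And>p. (p, p) \<in> H"
      "\<And>y z. (\<forall>l<N. ((f ^^ l) y, (f ^^ l) z) \<in> K) \<Longrightarrow> (?F y, ?F z) \<in> H \<Longrightarrow> (y, z) \<in> G"
      using pullback_entourage[OF K(1) K2 G(1,2), of N] by blast
    obtain \<rho>0 where \<rho>0: "\<rho>0 > 0" "\<And>i S y z. csmall i \<rho>0 S \<Longrightarrow> y \<in> S \<Longrightarrow> z \<in> S \<Longrightarrow> (y, z) \<in> H"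
      using csmall_entourage[OF H(1,2)] by blast
    show ?thesis unfolding pullback_bound_def
    proof (intro exI[of _ \<rho>0] conjI \<rho>0(1) allI impI)
      fix i' S V x assume S: "csmall i' \<rho>0 S" and V: "V \<subseteq> \<Lambda>"
        and VK: "\<forall>y\<in>V. \<forall>z\<in>V. \<forall>l<N. ((f ^^ l) y, (f ^^ l) z) \<in> K" and x: "x \<in> V" "?F x \<in> S"
      define Y where "Y = {y \<in> V. ?F y \<in> S}"
      have Y: "Y \<subseteq> \<Lambda>" "x \<in> Y" using V x by (auto simp: Y_def)
      have YG: "(x, y) \<in> G" if "y \<in> Y" for y
        using H(3)[of x y] \<rho>0(2)[OF S x(2)] VK x(1) that by (auto simp: Y_def)
      obtain p where p: "\<And>z. (x, z) \<in> G \<Longrightarrow> z \<in> W p" using G(3) Y by blast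
      have YW: "Y \<subseteq> W p" using p YG by blast
      obtain c a r where c: "(c, a, r) \<in> I" "W p \<subseteq> chart_ball c a r"
        "\<forall>i'\<in>I. \<forall>x\<in>W p. \<forall>y\<in>W p. \<forall>z\<in>W p. ?F x \<in> chart_ball (fst i') (fst (snd i')) (snd (snd i')) \<longrightarrow>
           est c (fst i') x y z"
        using W(3)[of p] unfolding good_def by blast
      obtain c' a' r' where i': "i' = (c', a', r')" by (metis prod_cases3)
      have c': "(c', a', r') \<in> I" "S \<subseteq> chart_ball c' a' r'"
         "\<forall>y\<in>S. \<forall>z\<in>S. norm (chart_map c' y - chart_map c' z) \<le> \<rho>0"
        using S unfolding csmall_def i' by auto
      have x': "x \<in> \<Lambda>" "x \<in> chart_ball c a r" "?F x \<in> chart_ball c' a' r'"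
        using Y YW c(2) c'(2) x(2) by auto
      have estY: "norm (chart_map c' (?F y) - chart_map c' (?F z) - chart_deriv ?F c c' x (chart_map c y - chart_map c z))
           \<le> c1 / (2 * c2) * norm (chart_map c y - chart_map c z)" if "y \<in> Y" "z \<in> Y" for y z
      proof -
        have "est c (fst (c', a', r')) x y z"
          using c(3)[rule_format, OF c'(1), of x y z] that Y YW x(2) c'(2) by auto
        then show ?thesis unfolding est_def \<tau>_def by simp
      qed
      have "csmall (c, a, r) \<rho>0 Y"
      proof -
        have "norm (chart_map c y - chart_map c z) \<le> \<rho>0" if yz: "y \<in> Y" "z \<in> Y" for y z
        proof -
          have "norm (chart_map c' (?F y) - chart_map c' (?F z)) \<le> \<rho>0" using yz c'(3) by (auto simp: Y_def)
          then have le: "(\<kappa> ^ N - 1 / 2) * c1 * norm (chart_map c y - chart_map c z) \<le> c2 * \<rho>0"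
            by (rule linear_step(2)[OF x' c(1) c'(1) _ estY[OF yz]])
          have "\<kappa> ^ N2 \<le> \<kappa> ^ N" using N \<kappa> by (intro power_increasing) auto
          then have "c2 / c1 \<le> \<kappa> ^ N - 1 / 2" using N2 by linarith
          then have "c2 \<le> (\<kappa> ^ N - 1 / 2) * c1" using c12 by (simp add: pos_divide_le_eq)
          then have "c2 * norm (chart_map c y - chart_map c z) \<le> c2 * \<rho>0"
            using le mult_right_mono[OF _ norm_ge_zero] order_trans by blast
          then show ?thesis using c12 by simp
        qed
        then show ?thesis using c(1,2) Y(1) YW unfolding csmall_def by auto
      qed
      moreover have "\<exists>\<C>. finite \<C> \<and> real (card \<C>) \<le> C * (\<Prod>j=i+1..k. (minorm N i x / minorm N j x) ^ m j) \<and>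
        {y \<in> V. ?F y \<in> T} \<subseteq> \<Union>\<C> \<and> (\<forall>T'\<in>\<C>. csmall (c, a, r) (\<rho> / minorm N i x) T')"
        if T: "T \<subseteq> S" "0 < \<rho>" "csmall i' \<rho> T" for T \<rho>
        unfolding C_def
      proof (rule linear_step_cover[OF Ca q_def _ i T(2) x' _ _ c(1) c'(1)])
        show "minorm N j x \<le> minorm N i x" if "1 \<le> i" "i \<le> j" "j \<le> k" for i j
          using N1[OF _ x'(1) that] N by auto
        have sub: "{y \<in> V. ?F y \<in> T} \<subseteq> Y" using T(1) by (auto simp: Y_def)
        then show "{y \<in> V. ?F y \<in> T} \<subseteq> \<Lambda>" "{y \<in> V. ?F y \<in> T} \<subseteq> chart_ball c a r"
          using Y(1) YW c(2) by blast+
        fix y z assume yz: "y \<in> {y \<in> V. ?F y \<in> T}" "z \<in> {y \<in> V. ?F y \<in> T}"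
        then show "norm (chart_map c' (?F y) - chart_map c' (?F z)) \<le> \<rho>"
          using T(3) unfolding csmall_def i' by simp
        show "norm (chart_map c' (?F y) - chart_map c' (?F z) - chart_deriv ?F c c' x (chart_map c y - chart_map c z))
           \<le> c1 / (2 * c2) * norm (chart_map c y - chart_map c z)" using estY yz sub by blast
      qed
      ultimately show "\<exists>i0. csmall i0 \<rho>0 {y \<in> V. ?F y \<in> S} \<and> (\<forall>T \<rho>. T \<subseteq> S \<longrightarrow> 0 < \<rho> \<longrightarrow> csmall i' \<rho> T \<longrightarrow>
       (\<exists>\<C>. finite \<C> \<and> real (card \<C>) \<le> C * (\<Prod>j=i+1..k. (minorm N i x / minorm N j x) ^ m j) \<and>
        {y \<in> V. ?F y \<in> T} \<subseteq> \<Union>\<C> \<and> (\<forall>T'\<in>\<C>. csmall i0 (\<rho> / minorm N i x) T')))"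
        unfolding Y_def by (intro exI[of _ "(c, a, r)"] conjI allI impI)
    qed
  qed
  show ?thesis
    by (rule exI[of _ C], rule conjI[OF \<open>1 \<le> C\<close>], rule exI[of _ "max N1 N2"], intro allI impI ballI, rule main)
qed

end

section \<open>Counting itineraries\<close>

text \<open>Each choice takes a point whose value exceeds half of the supremum and discards its
  \<open>R\<close>-neighbours. The factor 2 replaces an attained maximum. The bound \<open>n\<close>
  on separated sets drops by one because the chosen point extends any separated set of the
  rest.\<close>

lemma greedy_net:
  fixes \<psi> :: "'a \<Rightarrow> real"
  assumes R: "\<And>x. R x x" "\<And>x y. R x y \<Longrightarrow> R y x"
    and \<psi>: "\<And>x. x \<in> X \<Longrightarrow> 0 < \<psi> x" "\<And>x. x \<in> X \<Longrightarrow> \<psi> x \<le> b"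
    and card: "\<And>F. finite F \<Longrightarrow> F \<subseteq> X \<Longrightarrow> (\<forall>x\<in>F. \<forall>y\<in>F. x \<noteq> y \<longrightarrow> \<not> R x y) \<Longrightarrow> card F \<le> n"
  shows "\<exists>E \<pi>. finite E \<and> E \<subseteq> X \<and> (\<forall>x\<in>E. \<forall>y\<in>E. x \<noteq> y \<longrightarrow> \<not> R x y) \<and>
     (\<forall>x\<in>X. \<pi> x \<in> E \<and> R (\<pi> x) x \<and> \<psi> x \<le> 2 * \<psi> (\<pi> x))"
  using \<psi> card
proof (induction n arbitrary: X)
  case 0
  have "X = {}"
  proof (rule ccontr)
    assume "X \<noteq> {}"
    then obtain x where "x \<in> X" by blast
    then show False using 0(3)[of "{x}"] by simp
  qed
  then show ?case by auto
next
  case (Suc n)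
  show ?case
  proof (cases "X = {}")
    case False
    have bdd: "bdd_above (\<psi> ` X)" using Suc.prems(2) by (rule bdd_aboveI2)
    obtain y where y: "y \<in> X" using False by blast
    have "0 < \<psi> y" using Suc.prems(1) y by blast
    also have "\<psi> y \<le> Sup (\<psi> ` X)" using y bdd by (rule cSUP_upper)
    finally have "Sup (\<psi> ` X) / 2 < Sup (\<psi> ` X)" by simp
    then obtain x1 where x1: "x1 \<in> X" "Sup (\<psi> ` X) / 2 < \<psi> x1"
      using less_cSUP_iff[OF False bdd] by blast
    have half: "\<psi> x \<le> 2 * \<psi> x1" if "x \<in> X" for x
      using cSUP_upper[OF that bdd] x1(2) by simp
    define X' where "X' = {x \<in> X. \<not> R x1 x}"
    have "\<exists>E \<pi>. finite E \<and> E \<subseteq> X' \<and> (\<forall>x\<in>E. \<forall>y\<in>E. x \<noteq> y \<longrightarrow> \<not> R x y) \<and>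
       (\<forall>x\<in>X'. \<pi> x \<in> E \<and> R (\<pi> x) x \<and> \<psi> x \<le> 2 * \<psi> (\<pi> x))"
    proof (rule Suc.IH)
      fix F assume F: "finite F" "F \<subseteq> X'" "\<forall>x\<in>F. \<forall>y\<in>F. x \<noteq> y \<longrightarrow> \<not> R x y"
      have "x1 \<notin> F" using F(2) R(1) by (auto simp: X'_def)
      moreover have "card (insert x1 F) \<le> Suc n"
        using F x1(1) R(2) by (intro Suc.prems(3)) (auto simp: X'_def)
      ultimately show "card F \<le> n" using F(1) by simp
    qed (use Suc.prems in \<open>auto simp: X'_def\<close>)
    then obtain E \<pi> where E: "finite E" "E \<subseteq> X'" "\<forall>x\<in>E. \<forall>y\<in>E. x \<noteq> y \<longrightarrow> \<not> R x y"
       "\<forall>x\<in>X'. \<pi> x \<in> E \<and> R (\<pi> x) x \<and> \<psi> x \<le> 2 * \<psi> (\<pi> x)" by blast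
    show ?thesis
    proof (intro exI[of _ "insert x1 E"] exI[of _ "\<lambda>x. if R x1 x then x1 else \<pi> x"] conjI)
      show "finite (insert x1 E)" "insert x1 E \<subseteq> X" using E x1 by (auto simp: X'_def)
      show "\<forall>x\<in>insert x1 E. \<forall>y\<in>insert x1 E. x \<noteq> y \<longrightarrow> \<not> R x y"
        using E(2,3) R(2) by (auto simp: X'_def)
      show "\<forall>x\<in>X. (if R x1 x then x1 else \<pi> x) \<in> insert x1 E \<and> R (if R x1 x then x1 else \<pi> x) x \<and>
         \<psi> x \<le> 2 * \<psi> (if R x1 x then x1 else \<pi> x)"
        using half E(4) by (auto simp: X'_def)
    qed
  qed auto
qed

section \<open>Itineraries and stopping times\<close>

context charted_repeller
begin

definition cell :: "nat \<Rightarrow> ('m \<Rightarrow> 'b) \<Rightarrow> nat \<Rightarrow> (nat \<Rightarrow> 'b) \<Rightarrow> 'm set \<Rightarrow> 'm set" where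
  "cell N \<pi> q \<omega> S = {x \<in> \<Lambda>. (\<forall>l<q. \<pi> (((f ^^ N) ^^ l) x) = \<omega> l) \<and> ((f ^^ N) ^^ q) x \<in> S}"

text \<open>A product of one-step minimum norms rather than the minimum norm of the composed map,
  since each step back divides the scale by one such factor.\<close>

definition growth :: "nat \<Rightarrow> nat \<Rightarrow> nat \<Rightarrow> 'm \<Rightarrow> real" where
  "growth N i q x = (\<Prod>l<q. minorm N i (((f ^^ N) ^^ l) x))"

lemma iterate_\<Lambda>: "x \<in> \<Lambda> \<Longrightarrow> ((f ^^ N) ^^ l) x \<in> \<Lambda>"
  by (induction l) (auto intro: funpow_\<Lambda>)

lemma growth_Suc: "growth N i (Suc q) x = minorm N i x * growth N i q ((f ^^ N) x)"
proof -
  have "growth N i (Suc q) x = minorm N i (((f ^^ N) ^^ 0) x) * (\<Prod>l<q. minorm N i (((f ^^ N) ^^ Suc l) x))"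
    unfolding growth_def by (rule prod.lessThan_Suc_shift)
  also have "(\<Prod>l<q. minorm N i (((f ^^ N) ^^ Suc l) x)) = growth N i q ((f ^^ N) x)"
    unfolding growth_def by (simp only: funpow_Suc_right comp_def)
  finally show ?thesis by simp
qed

lemma growth_ge_power: "x \<in> \<Lambda> \<Longrightarrow> i \<in> {1..k} \<Longrightarrow> (\<kappa> ^ N) ^ q \<le> growth N i q x"
proof -
  assume x: "x \<in> \<Lambda>" and i: "i \<in> {1..k}"
  have "(\<Prod>l<q. \<kappa> ^ N) \<le> growth N i q x"
    unfolding growth_def using \<kappa> by (intro prod_mono conjI minorm_ge_power iterate_\<Lambda> x i) auto
  then show ?thesis by simp
qed

lemma growth_ge_1: "x \<in> \<Lambda> \<Longrightarrow> i \<in> {1..k} \<Longrightarrow> 1 \<le> growth N i q x"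
  using growth_ge_power[of x i N q] one_le_power[OF one_le_power, of \<kappa> N q] \<kappa> by linarith

text \<open>Peels off the first symbol, so that a cell arises by pulling the cell of the shifted
  itinerary back through one piece.\<close>

lemma cell_Suc:
  "cell N \<pi> (Suc q) \<omega> S = {y \<in> {y \<in> \<Lambda>. \<pi> y = \<omega> 0}. (f ^^ N) y \<in> cell N \<pi> q (\<omega> \<circ> Suc) S}"
proof -
  have "(\<forall>l<Suc q. \<pi> (((f ^^ N) ^^ l) x) = \<omega> l) \<longleftrightarrow>
      \<pi> x = \<omega> 0 \<and> (\<forall>l<q. \<pi> (((f ^^ N) ^^ l) ((f ^^ N) x)) = \<omega> (Suc l))" for x
    unfolding All_less_Suc2 by (simp only: funpow_Suc_right comp_def funpow_0)
  then show ?thesis unfolding cell_def using funpow_\<Lambda>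
    by (auto simp only: funpow_Suc_right comp_def mem_Collect_eq)
qed

text \<open>Induction from the end of the itinerary: the cover of the shifted cell is pulled back
  piece by piece. All base points lie on the orbit of one point \<open>x\<close>, so the shrinking
  factors multiply to \<open>growth\<close> and no comparison between orbits enters.\<close>

lemma cell_cover:
  assumes i: "i \<in> {1..k}" and \<rho>0: "0 < \<rho>0"
    and step: "pullback_bound K C N i \<rho>0"
    and \<pi>: "\<And>y z l. y \<in> \<Lambda> \<Longrightarrow> z \<in> \<Lambda> \<Longrightarrow> \<pi> y = \<pi> z \<Longrightarrow> l < N \<Longrightarrow> ((f ^^ l) y, (f ^^ l) z) \<in> K"
    and \<theta>: "\<And>x. x \<in> \<Lambda> \<Longrightarrow> C * (\<Prod>j=i+1..k. (minorm N i x / minorm N j x) ^ m j) \<le> minorm N i x powr s * \<theta> (\<pi> x)"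
    and S: "csmall i' \<rho>0 S" and x: "x \<in> cell N \<pi> q \<omega> S"
  shows "\<exists>i0. csmall i0 \<rho>0 (cell N \<pi> q \<omega> S) \<and> (\<exists>\<C>. finite \<C> \<and>
     real (card \<C>) \<le> growth N i q x powr s * (\<Prod>l<q. \<theta> (\<omega> l)) \<and> cell N \<pi> q \<omega> S \<subseteq> \<Union>\<C> \<and>
     (\<forall>T\<in>\<C>. csmall i0 (\<rho>0 / growth N i q x) T))"
  using x
proof (induction q arbitrary: x \<omega>)
  case 0
  have "csmall i' \<rho>0 (cell N \<pi> 0 \<omega> S)" by (rule csmall_subset[OF S]) (auto simp: cell_def)
  then show ?case
    by (intro exI[of _ i'] conjI exI[of _ "{cell N \<pi> 0 \<omega> S}"]) (auto simp: growth_def)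
next
  case (Suc q)
  let ?F = "f ^^ N"
  define V where "V = {y \<in> \<Lambda>. \<pi> y = \<omega> 0}"
  define S' where "S' = cell N \<pi> q (\<omega> \<circ> Suc) S"
  have cellS: "cell N \<pi> (Suc q) \<omega> S = {y \<in> V. ?F y \<in> S'}" unfolding cell_Suc V_def S'_def ..
  have x: "x \<in> V" "?F x \<in> S'" using Suc.prems unfolding cellS by auto
  have x\<Lambda>: "x \<in> \<Lambda>" using x(1) by (simp add: V_def)
  have F\<Lambda>: "?F x \<in> \<Lambda>" by (rule funpow_\<Lambda>[OF x\<Lambda>])
  obtain i1 \<C> where i1: "csmall i1 \<rho>0 S'" and \<C>: "finite \<C>"
     "real (card \<C>) \<le> growth N i q (?F x) powr s * (\<Prod>l<q. \<theta> ((\<omega> \<circ> Suc) l))" "S' \<subseteq> \<Union>\<C>"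
     "\<forall>T\<in>\<C>. csmall i1 (\<rho>0 / growth N i q (?F x)) T"
    using Suc.IH[OF x(2)[unfolded S'_def], folded S'_def] by (elim exE conjE) (rule that)
  define \<rho> where "\<rho> = \<rho>0 / growth N i q (?F x)"
  have \<rho>: "0 < \<rho>" unfolding \<rho>_def using \<rho>0 growth_ge_1[OF F\<Lambda> i, of N q] by simp
  have VK: "\<forall>y\<in>V. \<forall>z\<in>V. \<forall>l<N. ((f ^^ l) y, (f ^^ l) z) \<in> K" using \<pi> by (simp add: V_def)
  have V\<Lambda>: "V \<subseteq> \<Lambda>" by (auto simp: V_def)
  obtain i0 where i0: "csmall i0 \<rho>0 {y \<in> V. ?F y \<in> S'}" and
    st: "\<forall>T \<rho>. T \<subseteq> S' \<longrightarrow> 0 < \<rho> \<longrightarrow> csmall i1 \<rho> T \<longrightarrow>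
       (\<exists>\<C>. finite \<C> \<and> real (card \<C>) \<le> C * (\<Prod>j=i+1..k. (minorm N i x / minorm N j x) ^ m j) \<and>
        {y \<in> V. ?F y \<in> T} \<subseteq> \<Union>\<C> \<and> (\<forall>T'\<in>\<C>. csmall i0 (\<rho> / minorm N i x) T'))"
    using step[unfolded pullback_bound_def, THEN spec, THEN spec, THEN spec, THEN spec,
        THEN mp, OF i1, THEN mp, OF V\<Lambda>, THEN mp, OF VK, THEN mp, OF x(1), THEN mp, OF x(2)]
    by (elim exE conjE) (rule that)
  define a where "a = C * (\<Prod>j=i+1..k. (minorm N i x / minorm N j x) ^ m j)"
  \<comment> \<open>The pieces are cut down to \<open>S'\<close>, the set for which the chart
    \<open>i0\<close> was chosen.\<close>
  have "\<forall>T\<in>\<C>. \<exists>\<D>. finite \<D> \<and> real (card \<D>) \<le> a \<and>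
        {y \<in> V. ?F y \<in> T \<inter> S'} \<subseteq> \<Union>\<D> \<and> (\<forall>T'\<in>\<D>. csmall i0 (\<rho> / minorm N i x) T')"
    unfolding a_def
  proof
    fix T assume "T \<in> \<C>"
    then have "csmall i1 \<rho> (T \<inter> S')" using \<C>(4) csmall_subset unfolding \<rho>_def by blast
    then show "\<exists>\<D>. finite \<D> \<and> real (card \<D>) \<le> C * (\<Prod>j=i+1..k. (minorm N i x / minorm N j x) ^ m j) \<and>
        {y \<in> V. ?F y \<in> T \<inter> S'} \<subseteq> \<Union>\<D> \<and> (\<forall>T'\<in>\<D>. csmall i0 (\<rho> / minorm N i x) T')"
      by (intro st[rule_format] \<rho>) auto
  qed
  from bchoice[OF this] obtain \<D> where \<D>: "\<forall>T\<in>\<C>. finite (\<D> T) \<and> real (card (\<D> T)) \<le> a \<and>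
    {y \<in> V. ?F y \<in> T \<inter> S'} \<subseteq> \<Union>(\<D> T) \<and> (\<forall>T'\<in>\<D> T. csmall i0 (\<rho> / minorm N i x) T')" ..
  define \<E> where "\<E> = (\<Union>T\<in>\<C>. \<D> T)"
  have "finite \<E>" unfolding \<E>_def using \<C>(1) \<D> by blast
  moreover have "cell N \<pi> (Suc q) \<omega> S \<subseteq> \<Union>\<E>"
  proof
    fix y assume "y \<in> cell N \<pi> (Suc q) \<omega> S"
    then have y: "y \<in> V" "?F y \<in> S'" unfolding cellS by auto
    then obtain T where T: "T \<in> \<C>" "?F y \<in> T" using \<C>(3) by auto
    then have "y \<in> \<Union>(\<D> T)" using \<D> y by blast
    then show "y \<in> \<Union>\<E>" using T(1) unfolding \<E>_def by blast
  qed
  moreover have "csmall i0 (\<rho>0 / growth N i (Suc q) x) T'" if "T' \<in> \<E>" for T'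
    using \<D> that unfolding \<E>_def growth_Suc \<rho>_def by (auto simp: mult.commute)
  moreover have "real (card \<E>) \<le> growth N i (Suc q) x powr s * (\<Prod>l<Suc q. \<theta> (\<omega> l))"
  proof -
    let ?M = "minorm N i x" and ?G = "growth N i q (?F x)"
    have "real (card \<E>) \<le> (\<Sum>T\<in>\<C>. real (card (\<D> T)))"
      unfolding \<E>_def using card_UN_le[OF \<C>(1), of \<D>] by (simp only: of_nat_sum[symmetric] of_nat_le_iff)
    also have "\<dots> \<le> real (card \<C>) * a" using \<D> by (intro sum_bounded_above) blast
    also have "\<dots> \<le> real (card \<C>) * (?M powr s * \<theta> (\<omega> 0))"
      using \<theta>[OF x\<Lambda>] x(1) unfolding a_def V_def by (intro mult_left_mono) auto
    also have "\<dots> \<le> (?G powr s * (\<Prod>l<q. \<theta> ((\<omega> \<circ> Suc) l))) * (?M powr s * \<theta> (\<omega> 0))"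
    proof (intro mult_right_mono \<C>(2))
      \<comment> \<open>The sign of the weight follows from the count: some piece contains
        \<open>(f ^^ N) x\<close>, so \<open>a\<close> bounds a cardinality.\<close>
      obtain T where "T \<in> \<C>" using \<C>(3) x(2) by blast
      then have "0 \<le> a" using \<D> of_nat_0_le_iff[of "card (\<D> T)"] by (meson order_trans)
      then show "0 \<le> ?M powr s * \<theta> (\<omega> 0)" using \<theta>[OF x\<Lambda>] x(1) unfolding a_def V_def by simp
    qed
    also have "\<dots> = growth N i (Suc q) x powr s * (\<Prod>l<Suc q. \<theta> (\<omega> l))"
      using minorm_ge_1[OF x\<Lambda> i, of N] growth_ge_1[OF F\<Lambda> i, of N q]
      unfolding growth_Suc prod.lessThan_Suc_shift by (simp add: powr_mult)
    finally show ?thesis .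
  qed
  ultimately show ?case using i0 unfolding cellS by blast
qed

text \<open>Every point stops when its own growth first reaches \<open>R\<close>; one factor is at
  most \<open>B\<close>, so the growth then is at most \<open>B * R\<close>. A cell with a point
  that stops at its end is covered by sets of size \<open>\<rho>0 / R\<close>, and the number of
  sets, summed over all words, is bounded by a geometric series of ratio at most 1/2.\<close>

lemma box_count:
  assumes i: "i \<in> {1..k}" and \<rho>0: "0 < \<rho>0" and N: "1 \<le> N" and s: "0 \<le> s"
    and step: "pullback_bound K C N i \<rho>0"
    and \<pi>: "\<And>y z l. y \<in> \<Lambda> \<Longrightarrow> z \<in> \<Lambda> \<Longrightarrow> \<pi> y = \<pi> z \<Longrightarrow> l < N \<Longrightarrow> ((f ^^ l) y, (f ^^ l) z) \<in> K"
    and \<theta>: "\<And>x. x \<in> \<Lambda> \<Longrightarrow> C * (\<Prod>j=i+1..k. (minorm N i x / minorm N j x) ^ m j) \<le> minorm N i x powr s * \<theta> (\<pi> x)"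
    and Es: "finite Es" "\<And>x. x \<in> \<Lambda> \<Longrightarrow> \<pi> x \<in> Es" and \<theta>0: "\<And>e. e \<in> Es \<Longrightarrow> 0 \<le> \<theta> e"
    and sum: "(\<Sum>e\<in>Es. \<theta> e) \<le> 1 / 2"
  shows "\<exists>B\<ge>0. \<forall>R\<ge>1. \<exists>\<C>. finite \<C> \<and> real (card \<C>) \<le> B * R powr s \<and> \<Lambda> \<subseteq> \<Union>\<C> \<and>
     (\<forall>T\<in>\<C>. \<exists>i. csmall i (\<rho>0 / R) T)"
proof -
  let ?F = "f ^^ N"
  obtain \<U> where \<U>: "finite \<U>" "\<Lambda> \<subseteq> \<Union>\<U>" "\<And>S. S \<in> \<U> \<Longrightarrow> \<exists>i. csmall i \<rho>0 S"
    using finite_csmall_cover[OF \<rho>0] by blast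
  obtain B where B: "1 \<le> B" "\<And>x. x \<in> \<Lambda> \<Longrightarrow> minorm N i x \<le> B" using minorm_bounded i by blast
  have main: "\<exists>\<C>. finite \<C> \<and> real (card \<C>) \<le> (2 * real (card \<U>) * B powr s) * R powr s \<and> \<Lambda> \<subseteq> \<Union>\<C> \<and>
     (\<forall>T\<in>\<C>. \<exists>i. csmall i (\<rho>0 / R) T)" if R: "1 \<le> R" for R
  proof -
    have "1 < \<kappa> ^ N" using \<kappa> N by (intro one_less_power) auto
    \<comment> \<open>A bound for all stopping times, from \<open>1 < \<kappa> ^ N\<close>; it makes
      the index set \<open>J\<close> finite.\<close>
    then obtain Q where Q: "R < (\<kappa> ^ N) ^ Q" using real_arch_pow by blast
    define \<tau> where "\<tau> x = (LEAST q. R \<le> growth N i q x)" for x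
    have \<tau>Q: "\<tau> x \<le> Q" and \<tau>R: "R \<le> growth N i (\<tau> x) x" if x: "x \<in> \<Lambda>" for x
    proof -
      have 1: "R \<le> growth N i Q x" using Q growth_ge_power[OF x i, of N Q] by linarith
      show "\<tau> x \<le> Q" unfolding \<tau>_def by (rule Least_le[of "\<lambda>q. R \<le> growth N i q x", OF 1])
      show "R \<le> growth N i (\<tau> x) x" unfolding \<tau>_def by (rule LeastI[of "\<lambda>q. R \<le> growth N i q x", OF 1])
    qed
    have \<tau>B: "growth N i (\<tau> x) x \<le> B * R" if x: "x \<in> \<Lambda>" for x
    proof (cases "\<tau> x")
      case 0
      have "1 * 1 \<le> B * R" using B(1) R by (intro mult_mono) auto
      then show ?thesis using 0 by (simp add: growth_def)
    next
      case (Suc q)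
      have "\<not> R \<le> growth N i q x" using not_less_Least[of q "\<lambda>q. R \<le> growth N i q x"] Suc by (simp add: \<tau>_def)
      moreover have "growth N i (Suc q) x = growth N i q x * minorm N i ((?F ^^ q) x)" by (simp add: growth_def)
      moreover have "growth N i q x * minorm N i ((?F ^^ q) x) \<le> R * B"
        using calculation(1) B(2)[OF iterate_\<Lambda>[OF x]] minorm_ge_1[OF iterate_\<Lambda>[where N = N and l = q, OF x] i, of N] R
        by (intro mult_mono) auto
      ultimately show ?thesis using Suc by (simp add: mult.commute)
    qed
    \<comment> \<open>The stopping time may vary within a cell. Any point that stops at
      \<open>q\<close> serves as base point, and the whole cell is then covered at the scale of that
      point.\<close>
    define D where "D q \<omega> S = {x \<in> cell N \<pi> q \<omega> S. \<tau> x = q}" for q \<omega> S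
    have ex: "\<exists>\<C>. finite \<C> \<and> real (card \<C>) \<le> (B * R) powr s * (\<Prod>l<q. \<theta> (\<omega> l)) \<and> D q \<omega> S \<subseteq> \<Union>\<C> \<and>
       (\<forall>T\<in>\<C>. \<exists>i. csmall i (\<rho>0 / R) T)"
      if \<omega>: "\<omega> \<in> (\<Pi>\<^sub>E l\<in>{..<q}. Es)" and S: "S \<in> \<U>" for q \<omega> S
    proof -
      have th: "0 \<le> (\<Prod>l<q. \<theta> (\<omega> l))" using \<omega> \<theta>0 by (intro prod_nonneg) auto
      show ?thesis
      proof (cases "D q \<omega> S = {}")
        case True
        then show ?thesis using th by (intro exI[of _ "{}"]) auto
      next
        case False
        then obtain x where x: "x \<in> cell N \<pi> q \<omega> S" "\<tau> x = q" by (auto simp: D_def)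
        have x\<Lambda>: "x \<in> \<Lambda>" using x(1) by (simp add: cell_def)
        obtain i' where i': "csmall i' \<rho>0 S" using \<U>(3)[OF S] by blast
        have cc: "\<exists>i0. csmall i0 \<rho>0 (cell N \<pi> q \<omega> S) \<and> (\<exists>\<C>. finite \<C> \<and>
          real (card \<C>) \<le> growth N i q x powr s * (\<Prod>l<q. \<theta> (\<omega> l)) \<and> cell N \<pi> q \<omega> S \<subseteq> \<Union>\<C> \<and>
          (\<forall>T\<in>\<C>. csmall i0 (\<rho>0 / growth N i q x) T))"
          by (rule cell_cover[where \<theta> = \<theta> and K = K and C = C, OF i \<rho>0 _ _ _ i' x(1)])
             (fact step | fact \<pi> | fact \<theta>)+
        obtain i0 \<C> where \<C>: "finite \<C>" "real (card \<C>) \<le> growth N i q x powr s * (\<Prod>l<q. \<theta> (\<omega> l))"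
          "cell N \<pi> q \<omega> S \<subseteq> \<Union>\<C>" "\<forall>T\<in>\<C>. csmall i0 (\<rho>0 / growth N i q x) T"
          using cc by (elim exE conjE) (rule that)
        have "growth N i q x powr s * (\<Prod>l<q. \<theta> (\<omega> l)) \<le> (B * R) powr s * (\<Prod>l<q. \<theta> (\<omega> l))"
          using \<tau>B[OF x\<Lambda>] x(2) s growth_ge_1[OF x\<Lambda> i, of N q] th by (intro mult_right_mono powr_mono2) auto
        moreover have "\<rho>0 / growth N i q x \<le> \<rho>0 / R"
          using \<tau>R[OF x\<Lambda>] x(2) R \<rho>0 by (intro divide_left_mono) auto
        then have "\<exists>i. csmall i (\<rho>0 / R) T" if "T \<in> \<C>" for T using \<C>(4) csmall_mono that by blast
        moreover have "D q \<omega> S \<subseteq> \<Union>\<C>" using \<C>(3) by (auto simp: D_def)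
        ultimately show ?thesis using \<C>(1,2) by (intro exI[of _ \<C>]) auto
      qed
    qed
    define J where "J = Sigma {..Q} (\<lambda>q. (\<Pi>\<^sub>E l\<in>{..<q}. Es) \<times> \<U>)"
    have finJ: "finite J" unfolding J_def using Es(1) \<U>(1) by (intro finite_SigmaI finite_cartesian_product finite_PiE) auto
    have "\<forall>p\<in>J. \<exists>\<C>. finite \<C> \<and> real (card \<C>) \<le> (B * R) powr s * (\<Prod>l<fst p. \<theta> (fst (snd p) l)) \<and>
       D (fst p) (fst (snd p)) (snd (snd p)) \<subseteq> \<Union>\<C> \<and> (\<forall>T\<in>\<C>. \<exists>i. csmall i (\<rho>0 / R) T)"
    proof
      fix p assume pJ: "p \<in> J"
      obtain q \<omega> S where p: "p = (q, \<omega>, S)" by (rule prod_cases3)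
      have "fst (snd p) \<in> (\<Pi>\<^sub>E l\<in>{..<fst p}. Es)" "snd (snd p) \<in> \<U>"
        using pJ unfolding J_def p by (simp_all only: mem_Sigma_iff fst_conv snd_conv)
      then show "\<exists>\<C>. finite \<C> \<and> real (card \<C>) \<le> (B * R) powr s * (\<Prod>l<fst p. \<theta> (fst (snd p) l)) \<and>
       D (fst p) (fst (snd p)) (snd (snd p)) \<subseteq> \<Union>\<C> \<and> (\<forall>T\<in>\<C>. \<exists>i. csmall i (\<rho>0 / R) T)"
        by (rule ex)
    qed
    from bchoice[OF this] obtain \<C> where \<C>: "\<forall>p\<in>J. finite (\<C> p) \<and>
      real (card (\<C> p)) \<le> (B * R) powr s * (\<Prod>l<fst p. \<theta> (fst (snd p) l)) \<and>
      D (fst p) (fst (snd p)) (snd (snd p)) \<subseteq> \<Union>(\<C> p) \<and> (\<forall>T\<in>\<C> p. \<exists>i. csmall i (\<rho>0 / R) T)" ..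
    define \<E> where "\<E> = (\<Union>p\<in>J. \<C> p)"
    have "finite \<E>" unfolding \<E>_def using finJ \<C> by blast
    moreover have "\<Lambda> \<subseteq> \<Union>\<E>"
    proof
      fix x assume x: "x \<in> \<Lambda>"
      obtain S where S: "S \<in> \<U>" "(?F ^^ \<tau> x) x \<in> S" using \<U>(2) iterate_\<Lambda>[OF x] by blast
      define \<omega> where "\<omega> = restrict (\<lambda>l. \<pi> ((?F ^^ l) x)) {..<\<tau> x}"
      have J: "(\<tau> x, \<omega>, S) \<in> J" unfolding J_def using \<tau>Q[OF x] S(1) Es(2) iterate_\<Lambda>[OF x] by (auto simp: \<omega>_def)
      have "x \<in> D (\<tau> x) \<omega> S" using x S(2) by (simp add: D_def cell_def \<omega>_def)
      then have "x \<in> \<Union>(\<C> (\<tau> x, \<omega>, S))" using \<C> J by fastforce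
      then show "x \<in> \<Union>\<E>" using J unfolding \<E>_def by blast
    qed
    moreover have "\<forall>T\<in>\<E>. \<exists>i. csmall i (\<rho>0 / R) T" using \<C> unfolding \<E>_def by blast
    moreover have "real (card \<E>) \<le> (2 * real (card \<U>) * B powr s) * R powr s"
    proof -
      have "real (card \<E>) \<le> (\<Sum>p\<in>J. real (card (\<C> p)))"
        unfolding \<E>_def using card_UN_le[OF finJ, of \<C>] by (simp only: of_nat_sum[symmetric] of_nat_le_iff)
      also have "\<dots> \<le> (\<Sum>p\<in>J. (B * R) powr s * (\<Prod>l<fst p. \<theta> (fst (snd p) l)))"
        using \<C> by (intro sum_mono) blast
      also have "\<dots> = (B * R) powr s * (\<Sum>q\<le>Q. \<Sum>p\<in>(\<Pi>\<^sub>E l\<in>{..<q}. Es) \<times> \<U>. \<Prod>l<q. \<theta> (fst p l))"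
        unfolding J_def sum_distrib_left[symmetric]
        by (subst sum.Sigma) (use Es(1) \<U>(1) in \<open>auto simp: case_prod_beta intro!: finite_cartesian_product finite_PiE\<close>)
      \<comment> \<open>The weights are multiplicative, so the sum over all words of length
        \<open>q\<close> is the \<open>q\<close>-th power of the sum over letters.\<close>
      also have "(\<Sum>q\<le>Q. \<Sum>p\<in>(\<Pi>\<^sub>E l\<in>{..<q}. Es) \<times> \<U>. \<Prod>l<q. \<theta> (fst p l)) =
          (\<Sum>q\<le>Q. real (card \<U>) * (\<Sum>e\<in>Es. \<theta> e) ^ q)"
      proof (rule sum.cong[OF refl])
        fix q :: nat
        have "(\<Sum>p\<in>(\<Pi>\<^sub>E l\<in>{..<q}. Es) \<times> \<U>. \<Prod>l<q. \<theta> (fst p l)) =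
            (\<Sum>\<omega>\<in>(\<Pi>\<^sub>E l\<in>{..<q}. Es). \<Sum>S\<in>\<U>. \<Prod>l<q. \<theta> (\<omega> l))"
          by (subst sum.cartesian_product) (simp add: case_prod_beta)
        also have "\<dots> = real (card \<U>) * (\<Sum>\<omega>\<in>(\<Pi>\<^sub>E l\<in>{..<q}. Es). \<Prod>l<q. \<theta> (\<omega> l))"
          by (simp add: sum_distrib_left)
        also have "(\<Sum>\<omega>\<in>(\<Pi>\<^sub>E l\<in>{..<q}. Es). \<Prod>l<q. \<theta> (\<omega> l)) = (\<Prod>l<q. \<Sum>e\<in>Es. \<theta> e)"
          using Es(1) by (intro prod_sum_PiE[symmetric]) auto
        finally show "(\<Sum>p\<in>(\<Pi>\<^sub>E l\<in>{..<q}. Es) \<times> \<U>. \<Prod>l<q. \<theta> (fst p l)) = real (card \<U>) * (\<Sum>e\<in>Es. \<theta> e) ^ q"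
          by simp
      qed
      also have "\<dots> \<le> real (card \<U>) * 2"
      proof -
        have "0 \<le> (\<Sum>e\<in>Es. \<theta> e)" using \<theta>0 by (rule sum_nonneg)
        then have "(\<Sum>q\<le>Q. (\<Sum>e\<in>Es. \<theta> e) ^ q) \<le> (\<Sum>q\<le>Q. (1 / 2) ^ q)" using sum by (intro sum_mono power_mono)
        also have "\<dots> \<le> (\<Sum>q. (1 / 2 :: real) ^ q)"
          by (intro sum_le_suminf summable_geometric) auto
        also have "\<dots> = 2" by (subst suminf_geometric) auto
        finally show ?thesis unfolding sum_distrib_left[symmetric] by (intro mult_left_mono) auto
      qed
      finally show ?thesis using B(1) R by (simp add: powr_mult mult_ac mult_left_mono)
    qed
    ultimately show ?thesis by blast
  qed
  have "0 \<le> 2 * real (card \<U>) * B powr s" by simp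
  then show ?thesis using main by blast
qed

end

section \<open>Pressure and box dimension\<close>

definition partition_sum ::
    "('m \<Rightarrow> 'm \<Rightarrow> ennreal) \<Rightarrow> 'm set \<Rightarrow> ('m \<Rightarrow> 'm) \<Rightarrow> (nat \<Rightarrow> 'm \<Rightarrow> real) \<Rightarrow> real \<Rightarrow> nat \<Rightarrow> ennreal" where
  "partition_sum d X f \<Phi> \<epsilon> n =
     (SUP E \<in> {E. finite E \<and> E \<subseteq> X \<and> separated d f n \<epsilon> E}. ennreal (\<Sum>x\<in>E. exp (\<Phi> n x)))"

definition pressure_at ::
    "('m \<Rightarrow> 'm \<Rightarrow> ennreal) \<Rightarrow> 'm set \<Rightarrow> ('m \<Rightarrow> 'm) \<Rightarrow> (nat \<Rightarrow> 'm \<Rightarrow> real) \<Rightarrow> real \<Rightarrow> ereal" where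
  "pressure_at d X f \<Phi> \<epsilon> = limsup (\<lambda>n. ereal (1 / real n) * log_ennreal (partition_sum d X f \<Phi> \<epsilon> n))"

lemma log_ennreal_mono: "a \<le> b \<Longrightarrow> log_ennreal a \<le> log_ennreal b"
proof -
  assume ab: "a \<le> b"
  consider "a = 0" | "b = \<infinity>" | "0 < a" "b < \<infinity>" by (metis not_gr_zero top.not_eq_extremum infinity_ennreal_def)
  then show ?thesis
  proof cases
    case 3
    then have "0 < enn2real a" "enn2real a \<le> enn2real b"
      using ab by (auto simp: enn2real_positive_iff intro: enn2real_mono order.strict_trans1)
    then show ?thesis using 3 ab by (auto simp: log_ennreal_def)
  qed (auto simp: log_ennreal_def)
qed

lemma pressure_at_antimono:
  assumes "0 < \<epsilon>" "\<epsilon> \<le> \<epsilon>'"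
  shows "pressure_at d X f \<Phi> \<epsilon>' \<le> pressure_at d X f \<Phi> \<epsilon>"
  unfolding pressure_at_def
proof (intro Limsup_mono always_eventually allI ereal_mult_left_mono log_ennreal_mono)
  fix n
  have "separated d f n \<epsilon>' E \<Longrightarrow> separated d f n \<epsilon> E" for E
    unfolding separated_def using ennreal_leI[OF assms(2)] by (meson order.strict_trans1)
  then show "partition_sum d X f \<Phi> \<epsilon>' n \<le> partition_sum d X f \<Phi> \<epsilon> n"
    unfolding partition_sum_def by (intro SUP_subset_mono) auto
qed simp

text \<open>A smaller \<open>\<epsilon>\<close> admits more separated sets, so the limit exists and
  \<open>Lim\<close> denotes it; the pressure then bounds the growth at every single scale.\<close>

lemma pressure_eq_SUP: "pressure d X f \<Phi> = (SUP \<epsilon>\<in>{0<..}. pressure_at d X f \<Phi> \<epsilon>)"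
proof -
  let ?L = "pressure_at d X f \<Phi>"
  have "(?L \<longlongrightarrow> (SUP \<epsilon>\<in>{0<..}. ?L \<epsilon>)) (at_right 0)"
  proof (rule order_tendstoI)
    fix a assume "a < (SUP \<epsilon>\<in>{0<..}. ?L \<epsilon>)"
    then obtain \<epsilon>0 where \<epsilon>0: "\<epsilon>0 > 0" "a < ?L \<epsilon>0" unfolding less_SUP_iff by auto
    have "a < ?L \<epsilon>" if "0 < \<epsilon>" "\<epsilon> < \<epsilon>0" for \<epsilon>
      using \<epsilon>0(2) pressure_at_antimono[OF that(1) less_imp_le[OF that(2)]] by (rule less_le_trans)
    then show "\<forall>\<^sub>F \<epsilon> in at_right 0. a < ?L \<epsilon>"
      unfolding eventually_at_right_field using \<epsilon>0(1) by blast
  next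
    fix a assume a: "(SUP \<epsilon>\<in>{0<..}. ?L \<epsilon>) < a"
    have "?L \<epsilon> < a" if "0 < \<epsilon>" for \<epsilon>
      using SUP_upper[of \<epsilon> "{0<..}" ?L] that a by (auto intro: order.strict_trans1)
    then show "\<forall>\<^sub>F \<epsilon> in at_right 0. ?L \<epsilon> < a"
      unfolding eventually_at_right_field by (intro exI[of _ 1]) auto
  qed
  then have "Lim (at_right 0) ?L = (SUP \<epsilon>\<in>{0<..}. ?L \<epsilon>)" by (intro tendsto_Lim) auto
  then show ?thesis unfolding pressure_def pressure_at_def partition_sum_def .
qed

text \<open>The form in which vanishing pressure enters the counting. The scale
  \<open>\<epsilon>\<close> is arbitrary because the pressure is a supremum over scales.\<close>

lemma partition_sum_bound_of_pressure:
  assumes "pressure d X f \<Phi> \<le> 0" "0 < \<epsilon>" "0 < \<delta>"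
  shows "\<exists>n0. \<forall>n\<ge>n0. \<forall>F. finite F \<longrightarrow> F \<subseteq> X \<longrightarrow> separated d f n \<epsilon> F \<longrightarrow>
     (\<Sum>x\<in>F. exp (\<Phi> n x)) \<le> exp (real n * \<delta>)"
proof -
  have "pressure_at d X f \<Phi> \<epsilon> \<le> 0"
    using assms(1,2) unfolding pressure_eq_SUP by (auto simp: SUP_le_iff)
  then have "pressure_at d X f \<Phi> \<epsilon> < ereal \<delta>" using assms(3) by (auto intro: order.strict_trans1)
  then have "\<forall>\<^sub>F n in sequentially. ereal (1 / real n) * log_ennreal (partition_sum d X f \<Phi> \<epsilon> n) < ereal \<delta>"
    unfolding pressure_at_def by (rule Limsup_lessD)
  then obtain n0 where n0: "\<And>n. n \<ge> n0 \<Longrightarrow>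
      ereal (1 / real n) * log_ennreal (partition_sum d X f \<Phi> \<epsilon> n) < ereal \<delta>"
    unfolding eventually_sequentially by blast
  have "(\<Sum>x\<in>F. exp (\<Phi> n x)) \<le> exp (real n * \<delta>)"
    \<comment> \<open>The 1 excludes \<open>n = 0\<close>, where \<open>1 / real n\<close> is 0 and
      the logarithm is lost.\<close>
    if n: "n \<ge> max 1 n0" and F: "finite F" "F \<subseteq> X" "separated d f n \<epsilon> F" for n F
  proof (cases "F = {}")
    case False
    let ?s = "\<Sum>x\<in>F. exp (\<Phi> n x)"
    have s: "0 < ?s" using False F(1) by (intro sum_pos) auto
    have "ennreal ?s \<le> partition_sum d X f \<Phi> \<epsilon> n"
      unfolding partition_sum_def using F by (intro SUP_upper) auto
    then have "log_ennreal (ennreal ?s) \<le> log_ennreal (partition_sum d X f \<Phi> \<epsilon> n)" by (rule log_ennreal_mono)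
    moreover have "log_ennreal (ennreal ?s) = ereal (ln ?s)" using s by (simp add: log_ennreal_def)
    ultimately have "ereal (1 / real n) * ereal (ln ?s) \<le> ereal (1 / real n) * log_ennreal (partition_sum d X f \<Phi> \<epsilon> n)"
      by (intro ereal_mult_left_mono) auto
    also have "\<dots> < ereal \<delta>" using n by (intro n0) simp
    finally have "1 / real n * ln ?s < \<delta>" by simp
    then have "ln ?s \<le> real n * \<delta>" using n by (simp add: field_simps)
    then have "exp (ln ?s) \<le> exp (real n * \<delta>)" by (simp only: exp_le_cancel_iff)
    then show ?thesis using s by simp
  qed simp
  then show ?thesis by blast
qed

lemma pressure_le_of_bound:
  assumes "\<And>\<epsilon>. 0 < \<epsilon> \<Longrightarrow> \<exists>n0. \<forall>n\<ge>n0. \<forall>F. finite F \<longrightarrow> F \<subseteq> X \<longrightarrow> separated d f n \<epsilon> F \<longrightarrow>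
     (\<Sum>x\<in>F. exp (\<Phi> n x)) \<le> exp (real n * a)"
  shows "pressure d X f \<Phi> \<le> ereal a"
  unfolding pressure_eq_SUP
proof (rule SUP_least)
  fix \<epsilon> :: real assume "\<epsilon> \<in> {0<..}"
  then obtain n0 where n0: "\<And>n F. n \<ge> n0 \<Longrightarrow> finite F \<Longrightarrow> F \<subseteq> X \<Longrightarrow> separated d f n \<epsilon> F \<Longrightarrow>
     (\<Sum>x\<in>F. exp (\<Phi> n x)) \<le> exp (real n * a)" using assms by (metis greaterThan_iff)
  have "ereal (1 / real n) * log_ennreal (partition_sum d X f \<Phi> \<epsilon> n) \<le> ereal a" if n: "n \<ge> max 1 n0" for n
  proof -
    have "partition_sum d X f \<Phi> \<epsilon> n \<le> ennreal (exp (real n * a))"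
      unfolding partition_sum_def using n n0 by (intro SUP_least ennreal_leI) auto
    then have "log_ennreal (partition_sum d X f \<Phi> \<epsilon> n) \<le> log_ennreal (ennreal (exp (real n * a)))"
      by (rule log_ennreal_mono)
    also have "\<dots> = ereal (real n * a)" by (simp add: log_ennreal_def)
    finally have "ereal (1 / real n) * log_ennreal (partition_sum d X f \<Phi> \<epsilon> n) \<le> ereal (1 / real n) * ereal (real n * a)"
      by (intro ereal_mult_left_mono) auto
    then show ?thesis using n by simp
  qed
  then show "pressure_at d X f \<Phi> \<epsilon> \<le> ereal a"
    unfolding pressure_at_def by (intro Limsup_bounded eventually_sequentiallyI[of "max 1 n0"])
qed

lemma ell_Suc: "d < k \<Longrightarrow> ell k m (Suc d) = ell k m d + m (k - d)"
proof -
  assume d: "d < k"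
  have "{k - Suc d + 1..k} = insert (k - d) {k - d + 1..k}" using d by auto
  then show ?thesis using d by (simp add: ell_def)
qed

section \<open>Dependence of the potential and the pressure on the exponent\<close>

context split_expanding
begin

text \<open>Bases of the bundles together span the tangent space. This places every \<open>t\<close>
  up to the dimension between two consecutive values of \<open>ell\<close>.\<close>

lemma DIM_le_ell:
  assumes x: "x \<in> \<Lambda>"
  shows "DIM('e) \<le> ell k m k"
proof -
  have "\<forall>j. \<exists>B. j \<in> {1..k} \<longrightarrow> finite B \<and> card B = m j \<and> E j x \<subseteq> span B"
  proof
    fix j
    show "\<exists>B. j \<in> {1..k} \<longrightarrow> finite B \<and> card B = m j \<and> E j x \<subseteq> span B"
    proof (cases "j \<in> {1..k}")
      case True
      obtain B where "B \<subseteq> E j x" "independent B" "E j x \<subseteq> span B" "card B = dim (E j x)"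
        using basis_exists by metis
      then show ?thesis using E_dim[OF x True] independent_imp_finite by metis
    qed blast
  qed
  from choice[OF this] obtain B where B: "\<And>j. j \<in> {1..k} \<Longrightarrow> finite (B j)"
    "\<And>j. j \<in> {1..k} \<Longrightarrow> card (B j) = m j" "\<And>j. j \<in> {1..k} \<Longrightarrow> E j x \<subseteq> span (B j)" by blast
  let ?B = "\<Union>j\<in>{1..k}. B j"
  have "v \<in> span ?B" for v
  proof -
    obtain u where u: "\<And>j. j \<in> {1..k} \<Longrightarrow> u j \<in> E j x" "v = (\<Sum>j=1..k. u j)"
      using components_exist[OF x] by metis
    have "u j \<in> span ?B" if j: "j \<in> {1..k}" for j
    proof -
      have "span (B j) \<subseteq> span ?B" using j by (intro span_mono) blast
      then show ?thesis using B(3)[OF j] u(1)[OF j] by blast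
    qed
    then show ?thesis unfolding u(2) by (intro span_sum)
  qed
  then have "dim (UNIV :: 'e set) \<le> card ?B" using B(1) by (intro dim_le_card) auto
  also have "\<dots> \<le> (\<Sum>j=1..k. card (B j))" by (rule card_UN_le) simp
  also have "\<dots> = ell k m k" using B(2) by (simp add: ell_def)
  finally show ?thesis by simp
qed

text \<open>Shows that the \<open>LEAST\<close> in \<open>phi_tilde\<close> picks an admissible
  index: the predecessor of the first \<open>e\<close> with \<open>t \<le> ell k m e\<close> is one,
  and 0 is one if \<open>t = 0\<close>.\<close>

lemma phi_index:
  assumes x: "x \<in> \<Lambda>" and t: "0 \<le> t" "t \<le> real DIM('e)"
  defines "d \<equiv> LEAST d. d < k \<and> real (ell k m d) \<le> t \<and> t \<le> real (ell k m (d + 1))"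
  shows "d < k" "real (ell k m d) \<le> t" "t \<le> real (ell k m (d + 1))"
proof -
  have le: "t \<le> real (ell k m k)" using DIM_le_ell[OF x] t(2) by linarith
  define e where "e = (LEAST e. t \<le> real (ell k m e))"
  have e: "t \<le> real (ell k m e)" unfolding e_def by (rule LeastI[of "\<lambda>e. t \<le> real (ell k m e)", OF le])
  have ek: "e \<le> k" unfolding e_def by (rule Least_le[of "\<lambda>e. t \<le> real (ell k m e)", OF le])
  have "\<exists>d. d < k \<and> real (ell k m d) \<le> t \<and> t \<le> real (ell k m (d + 1))"
  proof (cases e)
    case 0
    then show ?thesis using e t(1) k ell_Suc[of 0 k m] by (intro exI[of _ 0]) (auto simp: ell_def)
  next
    case (Suc e')
    then have "\<not> t \<le> real (ell k m e')" using not_less_Least[of e' "\<lambda>e. t \<le> real (ell k m e)"] by (simp add: e_def)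
    then show ?thesis using Suc e ek by (intro exI[of _ e']) auto
  qed
  from LeastI_ex[OF this] show "d < k" "real (ell k m d) \<le> t" "t \<le> real (ell k m (d + 1))"
    unfolding d_def by auto
qed

text \<open>In the exponent \<open>phi_tilde\<close> is piecewise linear; its slopes are logarithms
  of minimum norms, each at least \<open>n * ln \<kappa>\<close> by expansion.\<close>

lemma phi_tilde_increasing:
  assumes x: "x \<in> \<Lambda>" and t: "0 \<le> t" "t < s" "s \<le> real DIM('e)"
  shows "phi_tilde A g f k E m t n x + real n * ((s - t) * ln \<kappa>) \<le> phi_tilde A g f k E m s n x"
proof -
  define L where "L j = ln (minorm n j x)" for j
  define b where "b = real n * ln \<kappa>"
  have Lb: "b \<le> L j" if "j \<in> {1..k}" for j
  proof -
    have "ln (\<kappa> ^ n) \<le> L j" unfolding L_def using minorm_ge_power[OF x that, of n] \<kappa>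
      by (intro ln_mono) (auto intro: less_le_trans[of 0 "\<kappa> ^ n"])
    then show ?thesis using \<kappa> by (simp add: b_def ln_realpow)
  qed
  \<comment> \<open>The value of \<open>phi_tilde\<close> at the break point
    \<open>ell k m d\<close>; the increment from \<open>t\<close> to \<open>s\<close> is split at
    the break points between them.\<close>
  define H where "H d = (\<Sum>j = k - d + 1..k. real (m j) * L j)" for d
  have H_Suc: "H (Suc d) = H d + real (m (k - d)) * L (k - d)" if "d < k" for d
  proof -
    have "{k - Suc d + 1..k} = insert (k - d) {k - d + 1..k}" using that by auto
    then show ?thesis using that by (simp add: H_def)
  qed
  have H_mono: "(real (ell k m e) - real (ell k m d)) * b \<le> H e - H d" if "d \<le> e" "e \<le> k" for d e
    using that
  proof (induction rule: dec_induct)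
    case (step i)
    have "real (m (k - i)) * b \<le> real (m (k - i)) * L (k - i)"
      using step by (intro mult_left_mono Lb) auto
    then show ?case using step H_Suc[of i] ell_Suc[of i k m] by (simp add: algebra_simps)
  qed simp
  define dt where "dt = (LEAST d. d < k \<and> real (ell k m d) \<le> t \<and> t \<le> real (ell k m (d + 1)))"
  define ds where "ds = (LEAST d. d < k \<and> real (ell k m d) \<le> s \<and> s \<le> real (ell k m (d + 1)))"
  have dt: "dt < k" "real (ell k m dt) \<le> t" "t \<le> real (ell k m (dt + 1))"
    using phi_index[OF x, of t] t unfolding dt_def by auto
  have ds: "ds < k" "real (ell k m ds) \<le> s" "s \<le> real (ell k m (ds + 1))"
    using phi_index[OF x, of s] t unfolding ds_def by auto
  have pt: "phi_tilde A g f k E m t n x = H dt + (t - real (ell k m dt)) * L (k - dt)"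
    unfolding phi_tilde_def Let_def dt_def[symmetric] H_def L_def ..
  have ps: "phi_tilde A g f k E m s n x = H ds + (s - real (ell k m ds)) * L (k - ds)"
    unfolding phi_tilde_def Let_def ds_def[symmetric] H_def L_def ..
  have kd: "k - dt \<in> {1..k}" "k - ds \<in> {1..k}" using dt(1) ds(1) by auto
  have "(s - t) * b \<le> phi_tilde A g f k E m s n x - phi_tilde A g f k E m t n x"
  proof (cases "ds = dt")
    case True
    have "(s - t) * b \<le> (s - t) * L (k - dt)" using t Lb[OF kd(1)] by (intro mult_left_mono) auto
    then show ?thesis unfolding pt ps True by (simp add: algebra_simps)
  next
    case False
    have "dt < ds"
    proof (rule ccontr)
      assume "\<not> dt < ds"
      then have "ds + 1 \<le> dt" using False by simp
      have mono: "ell k m (ds + 1) \<le> ell k m dt"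
        unfolding ell_def using \<open>ds + 1 \<le> dt\<close> by (intro sum_mono2) auto
      then show False using ds(3) dt(2) t(2) by linarith
    qed
    then have "(real (ell k m ds) - real (ell k m (Suc dt))) * b \<le> H ds - H (Suc dt)"
      using ds(1) by (intro H_mono) auto
    moreover have "(s - real (ell k m ds)) * b \<le> (s - real (ell k m ds)) * L (k - ds)"
      using ds Lb[OF kd(2)] by (intro mult_left_mono) auto
    moreover have "(real (ell k m (Suc dt)) - t) * b \<le> (real (ell k m (Suc dt)) - t) * L (k - dt)"
      using dt Lb[OF kd(1)] by (intro mult_left_mono) auto
    moreover have "H (Suc dt) - (H dt + (t - real (ell k m dt)) * L (k - dt)) = (real (ell k m (Suc dt)) - t) * L (k - dt)"
      unfolding H_Suc[OF dt(1)] ell_Suc[OF dt(1)] by (simp add: algebra_simps)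
    ultimately show ?thesis unfolding pt ps by (simp add: algebra_simps)
  qed
  then show ?thesis by (simp add: b_def algebra_simps)
qed

text \<open>With \<open>c = (s - t) * ln \<kappa>\<close>, raising the exponent multiplies each
  summand by at most \<open>exp (- (n * c))\<close>, while a root leaves growth below any positive
  rate, here \<open>c / 2\<close>. Applied to two roots in either order it gives uniqueness.\<close>

lemma pressure_negative_above_root:
  assumes t: "0 \<le> t" "t < s" "s \<le> real DIM('e)" and zero: "P_sub_tilde A g f \<Lambda> k E m t = 0"
  shows "P_sub_tilde A g f \<Lambda> k E m s < 0"
proof -
  define c where "c = (s - t) * ln \<kappa>"
  have c: "0 < c" using t \<kappa> by (simp add: c_def)
  have "P_sub_tilde A g f \<Lambda> k E m s \<le> ereal (- (c / 2))"
    unfolding P_sub_tilde_def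
  proof (rule pressure_le_of_bound)
    fix \<epsilon> :: real assume \<epsilon>: "0 < \<epsilon>"
    obtain n0 where n0: "\<And>n F. n \<ge> n0 \<Longrightarrow> finite F \<Longrightarrow> F \<subseteq> \<Lambda> \<Longrightarrow> separated (riem_dist A g) f n \<epsilon> F \<Longrightarrow>
      (\<Sum>x\<in>F. exp (- phi_tilde A g f k E m t n x)) \<le> exp (real n * (c / 2))"
      using partition_sum_bound_of_pressure[of "riem_dist A g" \<Lambda> f _ \<epsilon> "c / 2"] zero \<epsilon> c
      unfolding P_sub_tilde_def by (metis half_gt_zero order_refl)
    have "(\<Sum>x\<in>F. exp (- phi_tilde A g f k E m s n x)) \<le> exp (real n * - (c / 2))"
      if n: "n \<ge> n0" and F: "finite F" "F \<subseteq> \<Lambda>" "separated (riem_dist A g) f n \<epsilon> F" for n F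
    proof -
      have "(\<Sum>x\<in>F. exp (- phi_tilde A g f k E m s n x)) \<le>
          (\<Sum>x\<in>F. exp (- (real n * c)) * exp (- phi_tilde A g f k E m t n x))"
      proof (rule sum_mono)
        fix x assume "x \<in> F"
        then have "phi_tilde A g f k E m t n x + real n * c \<le> phi_tilde A g f k E m s n x"
          unfolding c_def using F(2) t by (intro phi_tilde_increasing) auto
        then show "exp (- phi_tilde A g f k E m s n x) \<le> exp (- (real n * c)) * exp (- phi_tilde A g f k E m t n x)"
          by (simp add: mult_exp_exp)
      qed
      also have "\<dots> \<le> exp (- (real n * c)) * exp (real n * (c / 2))"
        unfolding sum_distrib_left[symmetric] using n0[OF n F] by simp
      also have "\<dots> = exp (real n * - (c / 2))" by (simp add: mult_exp_exp algebra_simps)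
      finally show ?thesis .
    qed
    then show "\<exists>n0. \<forall>n\<ge>n0. \<forall>F. finite F \<longrightarrow> F \<subseteq> \<Lambda> \<longrightarrow> separated (riem_dist A g) f n \<epsilon> F \<longrightarrow>
      (\<Sum>x\<in>F. exp (- phi_tilde A g f k E m s n x)) \<le> exp (real n * - (c / 2))" by blast
  qed
  also have "ereal (- (c / 2)) < 0" using c by simp
  finally show ?thesis .
qed

end

section \<open>From counting to the upper box dimension\<close>

context charted_repeller
begin

lemma riem_dist_self: "riem_dist A g p p = 0"
proof -
  obtain c a r where i: "(c, a, r) \<in> I" "p \<in> chart_ball c a r" using net_cover by blast
  have p: "p \<in> chart_dom c" "chart_map c p \<in> cball a r" using i(2) by (auto simp: chart_ball_def)
  have "riem_dist A g p p \<le> ennreal (c2 * norm (chart_map c p - chart_map c p))"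
    using net[OF i(1)] p net_norm[OF i(1)] by (intro riem_dist_le_chart[of c "cball a r"]) auto
  then show ?thesis by simp
qed

lemma upper_box_dim_le_of_count:
  assumes s: "0 \<le> s" and B: "0 \<le> B" and \<rho>0: "0 < \<rho>0"
    and count: "\<And>R. 1 \<le> R \<Longrightarrow> \<exists>\<C>. finite \<C> \<and> real (card \<C>) \<le> B * R powr s \<and> \<Lambda> \<subseteq> \<Union>\<C> \<and>
       (\<forall>T\<in>\<C>. \<exists>i. csmall i (\<rho>0 / R) T)"
  shows "upper_box_dim (riem_dist A g) \<Lambda> \<le> ereal s"
proof -
  \<comment> \<open>Chosen so that \<open>R = e0 / \<epsilon>\<close> gives pieces of coordinate
    size \<open>\<epsilon> / (2 * c2)\<close>, hence within Riemannian distance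
    \<open>\<epsilon> / 2\<close> of any of their points, strictly below
    \<open>\<epsilon>\<close>.\<close>
  define e0 where "e0 = 2 * c2 * \<rho>0"
  have e0: "0 < e0" using c12 \<rho>0 by (simp add: e0_def)
  \<comment> \<open>Adding 1 keeps \<open>ln B'\<close> nonnegative.\<close>
  define B' where "B' = B * e0 powr s + 1"
  have B': "1 \<le> B'" using B by (simp add: B'_def)
  have cov: "real (covering_number (riem_dist A g) \<Lambda> \<epsilon>) \<le> B' * (1 / \<epsilon>) powr s" if \<epsilon>: "0 < \<epsilon>" "\<epsilon> \<le> e0" for \<epsilon>
  proof -
    have "1 \<le> e0 / \<epsilon>" using \<epsilon> by simp
    then obtain \<C> where \<C>: "finite \<C>" "real (card \<C>) \<le> B * (e0 / \<epsilon>) powr s" "\<Lambda> \<subseteq> \<Union>\<C>"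
      "\<forall>T\<in>\<C>. \<exists>i. csmall i (\<rho>0 / (e0 / \<epsilon>)) T" using count by meson
    have sz: "\<rho>0 / (e0 / \<epsilon>) = \<epsilon> / (2 * c2)" using \<rho>0 c12 by (simp add: e0_def field_simps)
    define ctr where "ctr T = (SOME p. p \<in> T)" for T :: "'m set"
    have near: "riem_dist A g (ctr T) q < ennreal \<epsilon>" if T: "T \<in> \<C>" "q \<in> T" for T q
    proof -
      have p: "ctr T \<in> T" unfolding ctr_def using T(2) by (rule someI)
      obtain c a r where i: "csmall (c, a, r) (\<epsilon> / (2 * c2)) T" using \<C>(4) T(1) unfolding sz by (metis prod_cases3)
      then have iI: "(c, a, r) \<in> I" and ch: "\<And>y. y \<in> T \<Longrightarrow> y \<in> chart_dom c \<and> chart_map c y \<in> cball a r"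
        and d: "norm (chart_map c q - chart_map c (ctr T)) \<le> \<epsilon> / (2 * c2)"
        using p T(2) unfolding csmall_def chart_ball_def by auto
      have "riem_dist A g (ctr T) q \<le> ennreal (c2 * norm (chart_map c q - chart_map c (ctr T)))"
        using net[OF iI] ch[OF p] ch[OF T(2)] net_norm[OF iI] by (intro riem_dist_le_chart[of c "cball a r"]) auto
      also have "\<dots> \<le> ennreal (c2 * (\<epsilon> / (2 * c2)))" using d c12 by (intro ennreal_leI mult_left_mono) auto
      also have "\<dots> < ennreal \<epsilon>" using \<epsilon> c12 by (intro ennreal_lessI) auto
      finally show ?thesis .
    qed
    have "\<Lambda> \<subseteq> (\<Union>p\<in>ctr ` \<C>. {q. riem_dist A g p q < ennreal \<epsilon>})"
    proof
      fix q assume "q \<in> \<Lambda>"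
      then obtain T where "T \<in> \<C>" "q \<in> T" using \<C>(3) by blast
      then show "q \<in> (\<Union>p\<in>ctr ` \<C>. {q. riem_dist A g p q < ennreal \<epsilon>})" using near by blast
    qed
    then have "covering_number (riem_dist A g) \<Lambda> \<epsilon> \<le> card (ctr ` \<C>)"
      unfolding covering_number_def using \<C>(1) by (intro Least_le) blast
    also have "\<dots> \<le> card \<C>" by (rule card_image_le[OF \<C>(1)])
    finally have "real (covering_number (riem_dist A g) \<Lambda> \<epsilon>) \<le> B * (e0 / \<epsilon>) powr s" using \<C>(2) by linarith
    also have "\<dots> = B * e0 powr s * (1 / \<epsilon>) powr s" using e0 \<epsilon> by (simp add: powr_mult[symmetric])
    also have "\<dots> \<le> B' * (1 / \<epsilon>) powr s" by (intro mult_right_mono) (auto simp: B'_def)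
    finally show ?thesis .
  qed
  have "upper_box_dim (riem_dist A g) \<Lambda> \<le> ereal s + ereal \<delta>" if \<delta>: "0 < \<delta>" for \<delta>
  proof -
    \<comment> \<open>Below the last bound \<open>ln B'\<close> is at most
      \<open>\<delta> * ln (1 / \<epsilon>)\<close>, so the constant disappears into
      \<open>\<delta>\<close>; below 1/2 the denominator is positive.\<close>
    define e1 where "e1 = min e0 (min (1 / 2) (exp (- (ln B' / \<delta>))))"
    have e1: "0 < e1" using e0 by (simp add: e1_def)
    have "ln (real (covering_number (riem_dist A g) \<Lambda> \<epsilon>)) / ln (1 / \<epsilon>) \<le> s + \<delta>" if \<epsilon>: "0 < \<epsilon>" "\<epsilon> < e1" for \<epsilon>
    proof -
      let ?N = "real (covering_number (riem_dist A g) \<Lambda> \<epsilon>)"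
      have \<epsilon>': "\<epsilon> \<le> e0" "\<epsilon> < 1" "\<epsilon> < exp (- (ln B' / \<delta>))" using \<epsilon> by (auto simp: e1_def)
      have l: "0 < ln (1 / \<epsilon>)" using \<epsilon>(1) \<epsilon>'(2) by simp
      have "ln \<epsilon> < - (ln B' / \<delta>)" using \<epsilon>'(3) \<epsilon>(1) by (metis exp_gt_zero ln_exp ln_less_cancel_iff)
      then have "ln B' / \<delta> \<le> ln (1 / \<epsilon>)" using \<epsilon>(1) by (simp add: ln_div)
      then have 1: "ln B' \<le> \<delta> * ln (1 / \<epsilon>)" using \<delta> by (simp add: pos_divide_le_eq mult.commute)
      have "ln ?N \<le> ln B' + s * ln (1 / \<epsilon>)"
      proof (cases "?N = 0")
        \<comment> \<open>Covering number 0 belongs to the empty set; the default value of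
          \<open>ln 0\<close> is 0.\<close>
        case True
        then show ?thesis using B' l s by simp
      next
        case False
        then have "ln ?N \<le> ln (B' * (1 / \<epsilon>) powr s)" using cov[OF \<epsilon>(1) \<epsilon>'(1)] B' \<epsilon>(1) by (intro ln_mono) auto
        also have "\<dots> = ln B' + s * ln (1 / \<epsilon>)" using B' \<epsilon>(1) by (simp add: ln_mult ln_powr)
        finally show ?thesis .
      qed
      then show ?thesis using 1 l by (simp add: pos_divide_le_eq algebra_simps)
    qed
    then have "\<forall>\<^sub>F \<epsilon> in at_right 0. ereal (ln (real (covering_number (riem_dist A g) \<Lambda> \<epsilon>)) / ln (1 / \<epsilon>)) \<le> ereal (s + \<delta>)"
      unfolding eventually_at_right_field using e1 by (intro exI[of _ e1]) auto
    then show ?thesis unfolding upper_box_dim_def by (intro Limsup_bounded) simp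
  qed
  then show ?thesis by (rule ereal_le_epsilon2)
qed

text \<open>\<open>\<phi>\<close> is the potential at \<open>t\<close> with the index
  \<open>d\<close> frozen. This makes \<open>i = k - d\<close> the bundle whose minimum norm sets
  the scale, the choice for which the covering product becomes \<open>M i powr t\<close> times the
  weight of the point.\<close>

lemma upper_box_dim_le:
  assumes d: "d < k" and t: "0 \<le> t" "real (ell k m d) \<le> t" and s: "t < s"
  defines "\<phi> \<equiv> \<lambda>n x. (\<Sum>j = k - d + 1..k. real (m j) * ln (minorm n j x)) + (t - real (ell k m d)) * ln (minorm n (k - d) x)"
  assumes bound: "\<And>\<epsilon> \<delta>. 0 < \<epsilon> \<Longrightarrow> 0 < \<delta> \<Longrightarrow> \<exists>n0. \<forall>n\<ge>n0. \<forall>F. finite F \<longrightarrow> F \<subseteq> \<Lambda> \<longrightarrow>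
     separated (riem_dist A g) f n \<epsilon> F \<longrightarrow> (\<Sum>x\<in>F. exp (- \<phi> n x)) \<le> exp (real n * \<delta>)"
  shows "upper_box_dim (riem_dist A g) \<Lambda> \<le> ereal s"
proof -
  define i where "i = k - d"
  have i: "i \<in> {1..k}" using d by (auto simp: i_def)
  have sub: "j \<in> {1..k}" if "j \<in> {i+1..k}" for j using that by auto
  obtain \<epsilon> K where \<epsilon>: "\<epsilon> > 0" and K: "compact K" "\<forall>y z. (y, z) \<in> K \<longrightarrow> f y = f z \<longrightarrow> y = z"
    "\<forall>e\<in>\<Lambda>. \<forall>y\<in>\<Lambda>. \<forall>z\<in>\<Lambda>.
        (riem_dist A g e y \<le> ennreal \<epsilon> \<or> riem_dist A g y e \<le> ennreal \<epsilon>) \<longrightarrow>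
        (riem_dist A g e z \<le> ennreal \<epsilon> \<or> riem_dist A g z e \<le> ennreal \<epsilon>) \<longrightarrow> (y, z) \<in> K"
    using expansive_pairs by (elim exE conjE) (rule that)
  \<comment> \<open>\<open>2 * \<delta>\<close> is the exponential gain per iterate that expansion
    guarantees; one \<open>\<delta>\<close> is given to the partition sum.\<close>
  define \<delta> where "\<delta> = (s - t) * ln \<kappa> / 2"
  have \<delta>: "0 < \<delta>" using s \<kappa> by (simp add: \<delta>_def)
  obtain C N1 where C: "1 \<le> C" and pc: "\<forall>N\<ge>N1. \<forall>i\<in>{1..k}. \<exists>\<rho>0>0. pullback_bound K C N i \<rho>0"
    using pullback_cover[OF K(1,2)] by (elim exE conjE) (rule that)
  obtain N2 where N2: "\<And>n F. n \<ge> N2 \<Longrightarrow> finite F \<Longrightarrow> F \<subseteq> \<Lambda> \<Longrightarrow> separated (riem_dist A g) f n \<epsilon> F \<Longrightarrow>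
     (\<Sum>x\<in>F. exp (- \<phi> n x)) \<le> exp (real n * \<delta>)" using bound[OF \<epsilon> \<delta>] by blast
  \<comment> \<open>The remaining \<open>\<delta>\<close> absorbs \<open>C\<close>, the greedy
    factor 2 and the target 1/2, whence the constant 4.\<close>
  obtain N3 where N3: "\<And>n. n \<ge> N3 \<Longrightarrow> 4 * C \<le> exp (real n * \<delta>)" using exp_unbounded[OF \<delta>] by blast
  define N where "N = max (max N1 N2) (max N3 1)"
  have N: "N \<ge> N1" "N \<ge> N2" "N \<ge> N3" "N \<ge> 1" by (auto simp: N_def)
  obtain \<rho>0 where \<rho>0: "0 < \<rho>0" and step: "pullback_bound K C N i \<rho>0"
    using pc[rule_format, OF N(1) i] by (elim exE conjE) (rule that)
  define \<psi> where "\<psi> x = exp (- \<phi> N x)" for x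
  \<comment> \<open>Equality, or failure of separation in either order: reflexive and symmetric by
    construction, as the greedy choice requires.\<close>
  define R where "R x y \<longleftrightarrow> x = y \<or> \<not> (ennreal \<epsilon> < bowen_dist (riem_dist A g) f N x y) \<or>
     \<not> (ennreal \<epsilon> < bowen_dist (riem_dist A g) f N y x)" for x y
  have sepR: "separated (riem_dist A g) f N \<epsilon> F" if "\<forall>x\<in>F. \<forall>y\<in>F. x \<noteq> y \<longrightarrow> \<not> R x y" for F
    using that unfolding separated_def R_def by blast
  obtain B where B: "1 \<le> B" "\<And>x j. x \<in> \<Lambda> \<Longrightarrow> j \<in> {1..k} \<Longrightarrow> minorm N j x \<le> B" using minorm_bounded by blast
  \<comment> \<open>An upper bound of the potential at time \<open>N\<close>; every term of the
    partition sum is at least \<open>exp (- P)\<close>, which bounds the size of separated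
    sets.\<close>
  define P where "P = (\<Sum>j = k - d + 1..k. real (m j) * ln B) + (t - real (ell k m d)) * ln B"
  have \<phi>P: "0 \<le> \<phi> N x \<and> \<phi> N x \<le> P" if x: "x \<in> \<Lambda>" for x
  proof -
    have l: "0 \<le> ln (minorm N j x) \<and> ln (minorm N j x) \<le> ln B" if j: "j \<in> {1..k}" for j
      using minorm_ge_1[OF x j, of N] B(2)[OF x j] by (auto intro: ln_mono)
    have "0 \<le> (\<Sum>j = k - d + 1..k. real (m j) * ln (minorm N j x))"
      using l sub unfolding i_def by (intro sum_nonneg mult_nonneg_nonneg) auto
    moreover have "(\<Sum>j = k - d + 1..k. real (m j) * ln (minorm N j x)) \<le> (\<Sum>j = k - d + 1..k. real (m j) * ln B)"
      using l sub unfolding i_def by (intro sum_mono mult_left_mono) auto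
    moreover have "0 \<le> (t - real (ell k m d)) * ln (minorm N (k - d) x)"
      using l[OF i] t(2) unfolding i_def by simp
    moreover have "(t - real (ell k m d)) * ln (minorm N (k - d) x) \<le> (t - real (ell k m d)) * ln B"
      using l[OF i] t(2) unfolding i_def by (intro mult_left_mono) auto
    ultimately show ?thesis unfolding \<phi>_def P_def by linarith
  qed
  have net: "\<exists>Es \<pi>. finite Es \<and> Es \<subseteq> \<Lambda> \<and> (\<forall>x\<in>Es. \<forall>y\<in>Es. x \<noteq> y \<longrightarrow> \<not> R x y) \<and>
     (\<forall>x\<in>\<Lambda>. \<pi> x \<in> Es \<and> R (\<pi> x) x \<and> \<psi> x \<le> 2 * \<psi> (\<pi> x))"
  proof (rule greedy_net[where b = 1 and n = "nat \<lceil>exp (real N * \<delta>) * exp P\<rceil>"])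
    fix F assume F: "finite F" "F \<subseteq> \<Lambda>" "\<forall>x\<in>F. \<forall>y\<in>F. x \<noteq> y \<longrightarrow> \<not> R x y"
    have "real (card F) * exp (- P) \<le> (\<Sum>x\<in>F. exp (- \<phi> N x))"
      using \<phi>P F(2) by (intro sum_bounded_below) auto
    also have "\<dots> \<le> exp (real N * \<delta>)" by (rule N2[OF N(2) F(1,2) sepR[OF F(3)]])
    finally have "real (card F) * exp (- P) * exp P \<le> exp (real N * \<delta>) * exp P" by (intro mult_right_mono) auto
    then have "real (card F) \<le> exp (real N * \<delta>) * exp P" by (simp add: mult.assoc mult_exp_exp)
    then show "card F \<le> nat \<lceil>exp (real N * \<delta>) * exp P\<rceil>" by linarith
  qed (use \<phi>P in \<open>auto simp: R_def \<psi>_def\<close>)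
  obtain Es \<pi> where Es: "finite Es" "Es \<subseteq> \<Lambda>" "\<forall>x\<in>Es. \<forall>y\<in>Es. x \<noteq> y \<longrightarrow> \<not> R x y"
     "\<forall>x\<in>\<Lambda>. \<pi> x \<in> Es \<and> R (\<pi> x) x \<and> \<psi> x \<le> 2 * \<psi> (\<pi> x)"
    using net by (elim exE conjE) (rule that)
  \<comment> \<open>\<open>C\<close> and 2 come from the covering and the greedy choice, the
    exponential from trading \<open>M i powr t\<close> for \<open>M i powr s\<close>.\<close>
  define \<theta> where "\<theta> e = 2 * C * exp (- (2 * (real N * \<delta>))) * \<psi> e" for e
  have near: "riem_dist A g ((f ^^ l) e) ((f ^^ l) y) \<le> ennreal \<epsilon> \<or> riem_dist A g ((f ^^ l) y) ((f ^^ l) e) \<le> ennreal \<epsilon>"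
    if "R e y" "l < N" for e y l
  proof -
    have b: "riem_dist A g ((f ^^ l) u) ((f ^^ l) v) \<le> ennreal \<epsilon>"
      if "\<not> (ennreal \<epsilon> < bowen_dist (riem_dist A g) f N u v)" for u v
    proof -
      have "riem_dist A g ((f ^^ l) u) ((f ^^ l) v) \<le> bowen_dist (riem_dist A g) f N u v"
        unfolding bowen_dist_def using \<open>l < N\<close> by (intro SUP_upper) auto
      then show ?thesis using that by (meson not_le order_trans)
    qed
    show ?thesis using \<open>R e y\<close> b riem_dist_self unfolding R_def by auto
  qed
  have count: "\<exists>B\<ge>0. \<forall>R\<ge>1. \<exists>\<C>. finite \<C> \<and> real (card \<C>) \<le> B * R powr s \<and> \<Lambda> \<subseteq> \<Union>\<C> \<and>
     (\<forall>T\<in>\<C>. \<exists>i. csmall i (\<rho>0 / R) T)"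
  proof (rule box_count[OF i \<rho>0 N(4) _ step, where \<pi> = \<pi> and \<theta> = \<theta> and Es = Es])
    show "0 \<le> s" using t s by simp
    show "finite Es" by (rule Es(1))
    show "\<pi> x \<in> Es" if "x \<in> \<Lambda>" for x using Es(4) that by blast
    show "0 \<le> \<theta> e" for e using C by (simp add: \<theta>_def \<psi>_def)
    fix y z l assume yz: "y \<in> \<Lambda>" "z \<in> \<Lambda>" "\<pi> y = \<pi> z" "l < N"
    have "\<pi> y \<in> \<Lambda>" "R (\<pi> y) y" "R (\<pi> y) z" using Es(2,4) yz by auto
    then show "((f ^^ l) y, (f ^^ l) z) \<in> K"
      using K(3)[rule_format, of "(f ^^ l) (\<pi> y)" "(f ^^ l) y" "(f ^^ l) z"] near[OF _ yz(4)] funpow_\<Lambda> yz(1,2) by blast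
  next
    show "(\<Sum>e\<in>Es. \<theta> e) \<le> 1 / 2"
    proof -
      have "(\<Sum>e\<in>Es. \<psi> e) \<le> exp (real N * \<delta>)"
        unfolding \<psi>_def by (rule N2[OF N(2) Es(1,2) sepR[OF Es(3)]])
      then have "(\<Sum>e\<in>Es. \<theta> e) \<le> 2 * C * exp (- (2 * (real N * \<delta>))) * exp (real N * \<delta>)"
        unfolding \<theta>_def sum_distrib_left[symmetric] using C by (intro mult_left_mono) auto
      also have "\<dots> = 2 * C / exp (real N * \<delta>)"
        by (simp add: mult.assoc mult_exp_exp) (simp add: exp_minus field_simps)
      also have "\<dots> \<le> 1 / 2" using N3[OF N(3)] by (simp add: divide_simps)
      finally show ?thesis .
    qed
  next
    fix x assume x: "x \<in> \<Lambda>"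
    let ?M = "\<lambda>j. minorm N j x"
    have Mpos: "0 < ?M j" if "j \<in> {1..k}" for j using minorm_ge_1[OF x that, of N] by linarith
    \<comment> \<open>The later bundles have total dimension \<open>ell k m d\<close>, and the term
      \<open>(t - ell k m d) * ln (M i)\<close> of the potential completes the exponent of
      \<open>M i\<close> to \<open>t\<close>.\<close>
    have prod: "(\<Prod>j=i+1..k. (?M i / ?M j) ^ m j) = ?M i powr t * \<psi> x"
    proof -
      have "(\<Prod>j=i+1..k. (?M i / ?M j) ^ m j) = (\<Prod>j=i+1..k. exp (real (m j) * (ln (?M i) - ln (?M j))))"
      proof (rule prod.cong[OF refl])
        fix j assume j: "j \<in> {i+1..k}"
        have "ln (?M i / ?M j) = ln (?M i) - ln (?M j)" by (rule ln_divide_pos[OF Mpos[OF i] Mpos[OF sub[OF j]]])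
        moreover have "0 < ?M i / ?M j" using Mpos[OF i] Mpos[OF sub[OF j]] by simp
        ultimately show "(?M i / ?M j) ^ m j = exp (real (m j) * (ln (?M i) - ln (?M j)))"
          by (metis exp_ln exp_of_nat_mult)
      qed
      also have "\<dots> = exp (\<Sum>j=i+1..k. real (m j) * (ln (?M i) - ln (?M j)))" by (simp add: exp_sum)
      also have "(\<Sum>j=i+1..k. real (m j) * (ln (?M i) - ln (?M j))) = t * ln (?M i) - \<phi> N x"
        by (simp add: \<phi>_def i_def ell_def right_diff_distrib sum_subtractf sum_distrib_right[symmetric] algebra_simps)
      also have "exp (t * ln (?M i) - \<phi> N x) = ?M i powr t * \<psi> x"
        using Mpos[OF i] by (simp add: powr_def \<psi>_def mult_exp_exp)
      finally show ?thesis .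
    qed
    have "?M i powr t \<le> ?M i powr s * exp (- (2 * (real N * \<delta>)))"
    proof -
      have "ln (\<kappa> ^ N) \<le> ln (?M i)" using minorm_ge_power[OF x i, of N] \<kappa> by (intro ln_mono) auto
      then have "real N * ln \<kappa> \<le> ln (?M i)" using \<kappa> by (simp add: ln_realpow)
      then have "(s - t) * (real N * ln \<kappa>) \<le> (s - t) * ln (?M i)" using s by (intro mult_left_mono) auto
      moreover have "2 * (real N * \<delta>) = (s - t) * (real N * ln \<kappa>)" by (simp add: \<delta>_def)
      ultimately have "t * ln (?M i) \<le> s * ln (?M i) - 2 * (real N * \<delta>)" by (simp add: left_diff_distrib)
      then show ?thesis using Mpos[OF i] by (simp add: powr_def mult_exp_exp)
    qed
    moreover have "\<psi> x \<le> 2 * \<psi> (\<pi> x)" using Es(4) x by blast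
    ultimately have "?M i powr t * \<psi> x \<le> (?M i powr s * exp (- (2 * (real N * \<delta>)))) * (2 * \<psi> (\<pi> x))"
      by (intro mult_mono) (auto simp: \<psi>_def)
    then have "C * (?M i powr t * \<psi> x) \<le> C * ((?M i powr s * exp (- (2 * (real N * \<delta>)))) * (2 * \<psi> (\<pi> x)))"
      using C by (intro mult_left_mono) auto
    then show "C * (\<Prod>j=i+1..k. (?M i / ?M j) ^ m j) \<le> ?M i powr s * \<theta> (\<pi> x)"
      unfolding prod \<theta>_def by (simp add: mult_ac)
  qed
  obtain Bc where "Bc \<ge> 0" "\<forall>R\<ge>1. \<exists>\<C>. finite \<C> \<and> real (card \<C>) \<le> Bc * R powr s \<and> \<Lambda> \<subseteq> \<Union>\<C> \<and>
     (\<forall>T\<in>\<C>. \<exists>i. csmall i (\<rho>0 / R) T)" using count by (elim exE conjE) (rule that)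
  then show ?thesis using t s \<rho>0 by (intro upper_box_dim_le_of_count[of s Bc \<rho>0]) auto
qed

end

theorem theorem3p2:
  fixes A :: "('m::t2_space, 'e::euclidean_space) chart set"
    and g :: "'m \<Rightarrow> 'e \<Rightarrow> 'e \<Rightarrow> real"
    and f :: "'m \<Rightarrow> 'm" and \<Lambda> :: "'m set" and \<gamma> :: real
    and k :: nat and E :: "nat \<Rightarrow> 'm \<Rightarrow> 'e set" and m :: "nat \<Rightarrow> nat"
    and t :: real
  assumes "compact_riemannian_manifold A g"
    and "0 < \<gamma>" and "C1_holder_map A \<gamma> f"
    and "repeller A g f \<Lambda>"
    and "topologically_transitive_on \<Lambda> f"
    and "dominated_splitting A g f \<Lambda> k E m"
    and "t \<in> {0..real DIM('e)}" and "P_sub_tilde A g f \<Lambda> k E m t = 0"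
  shows "(\<forall>s\<in>{0..real DIM('e)}. P_sub_tilde A g f \<Lambda> k E m s = 0 \<longrightarrow> s = t) \<and>
         upper_box_dim (riem_dist A g) \<Lambda> \<le> ereal t"
proof -
  interpret compact_riem_mfd A g by unfold_locales (rule assms(1))
  obtain \<kappa> where \<kappa>: "1 < \<kappa>" "\<forall>x\<in>\<Lambda>. \<forall>v. tnorm g (f x) (tangent_map A f x v) \<ge> \<kappa> * tnorm g x v"
    using assms(4) unfolding repeller_def by (elim exE conjE) (rule that)
  obtain lam Cd \<eta> where dom: "0 < Cd" "0 < \<eta>"
    "\<forall>i\<in>{1..<k}. lam i > lam (Suc i) \<and> \<eta> < (lam i - lam (Suc i)) / 100"
    "\<forall>x\<in>\<Lambda>. \<forall>n. \<forall>j\<in>{1..k}. \<forall>u\<in>E j x. tnorm g x u = 1 \<longrightarrow>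
       inverse Cd * exp (real n * (lam j - \<eta>)) \<le> tnorm g ((f ^^ n) x) (tangent_map A (f ^^ n) x u) \<and>
       tnorm g ((f ^^ n) x) (tangent_map A (f ^^ n) x u) \<le> Cd * exp (real n * (lam j + \<eta>))"
    using assms(6) unfolding dominated_splitting_def by (elim exE conjE) (rule that)
  have spl: "continuous_splitting A \<Lambda> k E m"
    and inv: "\<forall>x\<in>\<Lambda>. \<forall>j\<in>{1..k}. tangent_map A f x ` E j x = E j (f x)"
    using assms(6) unfolding dominated_splitting_def by blast+
  interpret split_expanding A g f \<Lambda> \<kappa> k E m lam Cd \<eta>
  proof unfold_locales
    show "continuous_on UNIV f" using assms(3) by (simp add: C1_holder_map_def)
    show "strict_diff_at A f p" for p by (rule strict_diff_at_C1_holder[OF assms(3,2)])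
    show "compact \<Lambda>" "f ` \<Lambda> \<subseteq> \<Lambda>" using assms(4) by (auto simp: repeller_def)
    show "1 \<le> k" "\<And>j. j \<in> {1..k} \<Longrightarrow> 0 < m j"
      "\<And>x j. x \<in> \<Lambda> \<Longrightarrow> j \<in> {1..k} \<Longrightarrow> subspace (E j x)"
      "\<And>x j. x \<in> \<Lambda> \<Longrightarrow> j \<in> {1..k} \<Longrightarrow> dim (E j x) = m j"
      "\<And>x v. x \<in> \<Lambda> \<Longrightarrow> \<exists>!w. w \<in> (\<Pi>\<^sub>E j\<in>{1..k}. E j x) \<and> v = (\<Sum>j=1..k. w j)"
      using spl unfolding continuous_splitting_def by simp_all
  qed (use \<kappa> dom inv in auto)
  obtain I c1 c2 where net: "finite I" "0 < c1" "0 < c2"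
    "\<forall>i\<in>I. case i of (c, a, r) \<Rightarrow> c \<in> A \<and> 0 < r \<and> cball a r \<subseteq> chart_map c ` chart_dom c \<and>
        (\<forall>p\<in>chart_dom c. chart_map c p \<in> cball a r \<longrightarrow> (\<forall>w. c1 * norm w \<le> tnorm g p (of_chart A c p w) \<and>
            tnorm g p (of_chart A c p w) \<le> c2 * norm w))"
    "\<forall>p. \<exists>i\<in>I. case i of (c, a, r) \<Rightarrow> p \<in> chart_ball c a r"
    using finite_chart_net by (elim exE conjE) (rule that)
  interpret charted_repeller A g f \<Lambda> \<kappa> k E m lam Cd \<eta> I c1 c2
  proof unfold_locales
    show "\<exists>c a r. (c, a, r) \<in> I \<and> p \<in> chart_ball c a r" for p
    proof -
      obtain i where "i \<in> I" "case i of (c, a, r) \<Rightarrow> p \<in> chart_ball c a r" using net(5) by blast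
      moreover obtain c a r where "i = (c, a, r)" by (rule prod_cases3)
      ultimately show ?thesis by blast
    qed
  qed (use net(1-4) in auto)
  have t: "0 \<le> t" "t \<le> real DIM('e)" using assms(7) by auto
  \<comment> \<open>Whichever of \<open>s\<close> and \<open>t\<close> is larger would have negative
    pressure.\<close>
  have "s = t" if s: "s \<in> {0..real DIM('e)}" "P_sub_tilde A g f \<Lambda> k E m s = 0" for s
    using pressure_negative_above_root[of t s] pressure_negative_above_root[of s t] s t assms(8) by force
  moreover have "upper_box_dim (riem_dist A g) \<Lambda> \<le> ereal t"
  proof (cases "\<Lambda> = {}")
    \<comment> \<open>The index \<open>d\<close> is obtained from a point of
      \<open>\<Lambda>\<close>; the empty set is covered by no sets at all, at every scale.\<close>
    case True
    then show ?thesis using t(1) by (intro upper_box_dim_le_of_count[of t 0 1]) (auto intro!: exI[of _ "{}"])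
  next
    case False
    then obtain x where x: "x \<in> \<Lambda>" by blast
    define d where "d = (LEAST d. d < k \<and> real (ell k m d) \<le> t \<and> t \<le> real (ell k m (d + 1)))"
    have d: "d < k" "real (ell k m d) \<le> t" using phi_index[OF x t] unfolding d_def by auto
    have "upper_box_dim (riem_dist A g) \<Lambda> \<le> ereal t + ereal e" if e: "0 < e" for e
    proof -
      have "upper_box_dim (riem_dist A g) \<Lambda> \<le> ereal (t + e)"
      proof (rule upper_box_dim_le[OF d(1) t(1) d(2)])
        show "t < t + e" using e by simp
        fix \<epsilon> \<delta> :: real assume "0 < \<epsilon>" "0 < \<delta>"
        then show "\<exists>n0. \<forall>n\<ge>n0. \<forall>F. finite F \<longrightarrow> F \<subseteq> \<Lambda> \<longrightarrow> separated (riem_dist A g) f n \<epsilon> F \<longrightarrow>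
          (\<Sum>x\<in>F. exp (- ((\<Sum>j = k - d + 1..k. real (m j) * ln (minorm n j x)) +
             (t - real (ell k m d)) * ln (minorm n (k - d) x)))) \<le> exp (real n * \<delta>)"
          using partition_sum_bound_of_pressure[of "riem_dist A g" \<Lambda> f "\<lambda>n x. - phi_tilde A g f k E m t n x" \<epsilon> \<delta>] assms(8)
          unfolding P_sub_tilde_def phi_tilde_def Let_def d_def[symmetric] by simp
      qed
      then show ?thesis by simp
    qed
    then show ?thesis by (rule ereal_le_epsilon2)
  qed
  ultimately show ?thesis by blast
qed

end
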